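(* Let $F$ be a field with $\operatorname{char}(F)\neq 2$. Let $A$ and $B$ be prime associative unital $F$-algebras, and assume that $A$ and $B$ are also superalgebras with respect to gradings induced by idempotents. Let $C$ be the extended centroid of $A$ and assume that $A_C$ is not isomorphic to $C$ and not isomorphic to $M_2(C)$. Then every Lie superisomorphism $\varphi:B\to A$ is of the form $\varphi=\theta+\tau$, where $\theta$ is either a superhomomorphism or the negative of a superantihomomorphism from $B$ into $A_C$, and $\tau$ is a linear map from $B$ into $C$ satisfying $\tau([B,B]_s)=0$.
   Context: A superalgebra is an algebra $A=A_0\oplus A_1$ with $A_iA_j\subseteq A_{i+j}$ ($i,j\in\mathbb Z_2$); homogeneous elements of $A_i$ have degree $|x|=i$; graded linear maps preserve the degree. If $e$ is an idempotent of an associative unital algebra $A$, the grading induced by $e$ is $A_0=eAe+(1-e)A(1-e)$, $A_1=eA(1-e)+(1-e)Ae$. The supercommutator is $[x,y]_s=xy-(-1)^{|x||y|}yx$ for homogeneous $x,y$, extended bilinearly; $[B,B]_s$ is the span of all supercommutators. A Lie superisomorphism $\varphi:B\to A$ is a bijective graded linear map with $\varphi([x,y]_s)=[\varphi(x),\varphi(y)]_s$. A superhomomorphism is a graded algebra homomorphism; a superantihomomorphism is a graded linear map $\psi$ with $\psi(xy)=(-1)^{|x||y|}\psi(y)\psi(x)$ for homogeneous $x,y$. For a prime algebra $A$, $Q$ denotes its maximal left algebra of quotients, the extended centroid $C$ is the center of $Q$ (a field containing $F$), and $A_C$ is the subalgebra of $Q$ generated by $A$ and $C$. The grading of $A$ (induced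 by the idempotent $e\in A$) makes $A_C$ a superalgebra via the idempotent $e$, containing $A$ as a subsuperalgebra. *)

theory Defs
  imports Main
begin

text \<open>A unital associative F-algebra structure on a ring is given by a unital ring
  homomorphism from the field F into the centre of the ring (c \<mapsto> c\<cdot>1).\<close>
definition F_alg :: "('f::field \<Rightarrow> 'a::ring_1) \<Rightarrow> bool" where
  "F_alg \<iota> \<longleftrightarrow> \<iota> 1 = 1 \<and> (\<forall>c d. \<iota> (c + d) = \<iota> c + \<iota> d \<and> \<iota> (c * d) = \<iota> c * \<iota> d)
     \<and> (\<forall>c x. \<iota> c * x = x * \<iota> c)"

definition F_lin :: "('f::field \<Rightarrow> 'b::ring_1) \<Rightarrow> ('f \<Rightarrow> 'a::ring_1) \<Rightarrow> ('b \<Rightarrow> 'a) \<Rightarrow> bool" where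
  "F_lin \<iota>B \<iota>A f \<longleftrightarrow> (\<forall>x y. f (x + y) = f x + f y) \<and> (\<forall>c x. f (\<iota>B c * x) = \<iota>A c * f x)"

definition prime_ring :: "'a::ring_1 set \<Rightarrow> bool" where
  "prime_ring R \<longleftrightarrow> (\<forall>a\<in>R. \<forall>b\<in>R. (\<forall>x\<in>R. a * x * b = 0) \<longrightarrow> a = 0 \<or> b = 0)"

definition idem :: "'a::ring_1 \<Rightarrow> bool" where
  "idem e \<longleftrightarrow> e * e = e"

definition pr0 :: "'a::ring_1 \<Rightarrow> 'a \<Rightarrow> 'a" where
  "pr0 e x = e * x * e + (1 - e) * x * (1 - e)"

definition pr1 :: "'a::ring_1 \<Rightarrow> 'a \<Rightarrow> 'a" where
  "pr1 e x = e * x * (1 - e) + (1 - e) * x * e"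

text \<open>x is homogeneous of degree 0 (resp. 1), i.e. x \<in> eAe + (1-e)A(1-e)
  (resp. x \<in> eA(1-e) + (1-e)Ae).\<close>
definition is_even :: "'a::ring_1 \<Rightarrow> 'a \<Rightarrow> bool" where
  "is_even e x \<longleftrightarrow> x = pr0 e x"

definition is_odd :: "'a::ring_1 \<Rightarrow> 'a \<Rightarrow> bool" where
  "is_odd e x \<longleftrightarrow> x = pr1 e x"

text \<open>Supercommutator, defined on homogeneous elements and extended bilinearly.\<close>
definition scomm :: "'a::ring_1 \<Rightarrow> 'a \<Rightarrow> 'a \<Rightarrow> 'a" where
  "scomm e x y =
     (pr0 e x * pr0 e y - pr0 e y * pr0 e x) + (pr0 e x * pr1 e y - pr1 e y * pr0 e x)
   + (pr1 e x * pr0 e y - pr0 e y * pr1 e x) + (pr1 e x * pr1 e y + pr1 e y * pr1 e x)"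

inductive_set scomm_span :: "('f::field \<Rightarrow> 'b::ring_1) \<Rightarrow> 'b \<Rightarrow> 'b set"
  for \<iota> :: "'f \<Rightarrow> 'b" and e :: 'b where
  gen: "scomm e x y \<in> scomm_span \<iota> e"
| zero: "0 \<in> scomm_span \<iota> e"
| add: "x \<in> scomm_span \<iota> e \<Longrightarrow> y \<in> scomm_span \<iota> e \<Longrightarrow> x + y \<in> scomm_span \<iota> e"
| smult: "x \<in> scomm_span \<iota> e \<Longrightarrow> \<iota> c * x \<in> scomm_span \<iota> e"

definition graded :: "'b::ring_1 \<Rightarrow> 'a::ring_1 \<Rightarrow> ('b \<Rightarrow> 'a) \<Rightarrow> bool" where
  "graded eB eA f \<longleftrightarrow> (\<forall>x. (is_even eB x \<longrightarrow> is_even eA (f x)) \<and> (is_odd eB x \<longrightarrow> is_odd eA (f x)))"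

definition lie_superiso ::
  "('f::field \<Rightarrow> 'b::ring_1) \<Rightarrow> 'b \<Rightarrow> ('f \<Rightarrow> 'a::ring_1) \<Rightarrow> 'a \<Rightarrow> ('b \<Rightarrow> 'a) \<Rightarrow> bool" where
  "lie_superiso \<iota>B eB \<iota>A eA \<phi> \<longleftrightarrow> bij \<phi> \<and> F_lin \<iota>B \<iota>A \<phi> \<and> graded eB eA \<phi>
     \<and> (\<forall>x y. \<phi> (scomm eB x y) = scomm eA (\<phi> x) (\<phi> y))"

definition superhom ::
  "('f::field \<Rightarrow> 'b::ring_1) \<Rightarrow> 'b \<Rightarrow> ('f \<Rightarrow> 'a::ring_1) \<Rightarrow> 'a \<Rightarrow> ('b \<Rightarrow> 'a) \<Rightarrow> bool" where
  "superhom \<iota>B eB \<iota>A eA \<theta> \<longleftrightarrow> F_lin \<iota>B \<iota>A \<theta> \<and> graded eB eA \<theta>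
     \<and> (\<forall>x y. \<theta> (x * y) = \<theta> x * \<theta> y)"

definition superantihom ::
  "('f::field \<Rightarrow> 'b::ring_1) \<Rightarrow> 'b \<Rightarrow> ('f \<Rightarrow> 'a::ring_1) \<Rightarrow> 'a \<Rightarrow> ('b \<Rightarrow> 'a) \<Rightarrow> bool" where
  "superantihom \<iota>B eB \<iota>A eA \<psi> \<longleftrightarrow> F_lin \<iota>B \<iota>A \<psi> \<and> graded eB eA \<psi>
     \<and> (\<forall>x y. (is_even eB x \<or> is_odd eB x) \<and> (is_even eB y \<or> is_odd eB y) \<longrightarrow>
          \<psi> (x * y) = (if is_odd eB x \<and> is_odd eB y then - (\<psi> y * \<psi> x) else \<psi> y * \<psi> x))"

text \<open>Dense left ideal (in the sense of Lambek / Utumi).\<close>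
definition dense_left_ideal :: "'a::ring_1 set \<Rightarrow> bool" where
  "dense_left_ideal L \<longleftrightarrow> 0 \<in> L \<and> (\<forall>x\<in>L. \<forall>y\<in>L. x + y \<in> L) \<and> (\<forall>x\<in>L. - x \<in> L)
     \<and> (\<forall>r. \<forall>x\<in>L. r * x \<in> L)
     \<and> (\<forall>r1 r2. r1 \<noteq> 0 \<longrightarrow> (\<exists>r. r * r1 \<noteq> 0 \<and> r * r2 \<in> L))"

text \<open>j : A \<rightarrow> Q exhibits Q as the maximal left ring of quotients of A
  (Utumi's characterization).\<close>
definition max_left_quot :: "('a::ring_1 \<Rightarrow> 'q::ring_1) \<Rightarrow> bool" where
  "max_left_quot j \<longleftrightarrow> inj j \<and> j 1 = 1 \<and> (\<forall>x y. j (x + y) = j x + j y \<and> j (x * y) = j x * j y)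
     \<and> (\<forall>q. \<exists>L. dense_left_ideal L \<and> (\<forall>x\<in>L. j x * q \<in> range j))
     \<and> (\<forall>q L. q \<noteq> 0 \<and> dense_left_ideal L \<longrightarrow> (\<exists>x\<in>L. j x * q \<noteq> 0))
     \<and> (\<forall>L f. dense_left_ideal L \<and> (\<forall>x\<in>L. \<forall>y\<in>L. f (x + y) = f x + f y)
              \<and> (\<forall>r. \<forall>x\<in>L. f (r * x) = r * f x)
            \<longrightarrow> (\<exists>q. \<forall>x\<in>L. j (f x) = j x * q))"

text \<open>Extended centroid: the centre of Q.\<close>
definition ring_center :: "'q::ring_1 set" where
  "ring_center = {c. \<forall>q. c * q = q * c}"

inductive_set central_closure :: "('a::ring_1 \<Rightarrow> 'q::ring_1) \<Rightarrow> 'q set" for j where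
  emb: "j a \<in> central_closure j"
| cen: "c \<in> ring_center \<Longrightarrow> c \<in> central_closure j"
| add: "x \<in> central_closure j \<Longrightarrow> y \<in> central_closure j \<Longrightarrow> x + y \<in> central_closure j"
| neg: "x \<in> central_closure j \<Longrightarrow> - x \<in> central_closure j"
| mult: "x \<in> central_closure j \<Longrightarrow> y \<in> central_closure j \<Longrightarrow> x * y \<in> central_closure j"

definition ring_iso_on :: "'a set \<Rightarrow> ('a \<Rightarrow> 'a \<Rightarrow> 'a) \<Rightarrow> ('a \<Rightarrow> 'a \<Rightarrow> 'a)
    \<Rightarrow> 'q::ring_1 set \<Rightarrow> ('a \<Rightarrow> 'q) \<Rightarrow> bool" where
  "ring_iso_on S pl ml T h \<longleftrightarrow> bij_betw h S T
     \<and> (\<forall>x\<in>S. \<forall>y\<in>S. h (pl x y) = h x + h y \<and> h (ml x y) = h x * h y)"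

text \<open>M_2(K) for a subring K of Q: 2x2 matrices (a,b,c,d) = [[a,b],[c,d]].\<close>
definition M2 :: "'q::ring_1 set \<Rightarrow> ('q \<times> 'q \<times> 'q \<times> 'q) set" where
  "M2 K = {(a, b, c, d). a \<in> K \<and> b \<in> K \<and> c \<in> K \<and> d \<in> K}"

definition M2_add :: "'q::ring_1 \<times> 'q \<times> 'q \<times> 'q \<Rightarrow> 'q \<times> 'q \<times> 'q \<times> 'q \<Rightarrow> 'q \<times> 'q \<times> 'q \<times> 'q" where
  "M2_add = (\<lambda>(a, b, c, d) (a', b', c', d'). (a + a', b + b', c + c', d + d'))"

definition M2_mult :: "'q::ring_1 \<times> 'q \<times> 'q \<times> 'q \<Rightarrow> 'q \<times> 'q \<times> 'q \<times> 'q \<Rightarrow> 'q \<times> 'q \<times> 'q \<times> 'q" where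
  "M2_mult = (\<lambda>(a, b, c, d) (a', b', c', d').
     (a * a' + b * c', a * b' + b * d', c * a' + d * c', c * b' + d * d'))"

end

theory Submission
  imports Defs
begin

text \<open>
Everything rests on generalized polynomial identities: if a_1, ..., a_n in Q are independent over C
and a_1 x b_1 + ... + a_n x b_n = 0 for all x in A, then all b_i vanish.

Trivial grading. Transporting the product of B to A gives a symmetric map S with [S(x,x),x] = 0.
Fix t with 1, t, t^2 independent over C. In the linearization of this identity the unknown values
of S can be eliminated by substituting tx and wt, which leaves an identity with coefficients t,
S(t,t), S(t,t^2) only; it forces S(t,t) to lie in C + Ct + Ct^2, and further substitutions give
S(x,y) = l(xy + yx) + a(x)y + a(y)x + n(x,y) for all x and y. If there is no such t, every element
of A is quadratic over C, centralizers are small, and the same form is obtained with l = 1.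
Associativity of the product of B then leaves the standard forms only.

Nontrivial grading. The image of eB acts on the odd part as +e or -e up to a scalar, so \<phi> respects
the Peirce decompositions. Even elements b act on an odd corner by bx = P(b) x - x R(b), and comparing
b(bx) with (bb)x shows that P(b) or R(b) is scalar. Subtracting the scalar parts gives \<theta>; it
is multiplicative up to a scalar defect w on products of odd elements, and w = 0 unless the products
of odd elements are scalar, which happens for M_2(C) only.
\<close>

section \<open>The extended centroid and generalized polynomial identities\<close>

text \<open>The obstacle is that the coefficient functions are first found value by value, by
  choosing scalars for each argument, and nothing makes them additive. Two devices deal with this.
  The lemma on generalized polynomials fixes its constants before the right-hand factors are given,
  so that one pair of scalars can serve all x at once; and for trivial gradings the linearity of the
  scalar part is recovered afterwards, from the multiplicativity of \<theta>.

  The substitution of tx and wt works because, for an identity H(x,w) = 0 built from commutators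
  with unknown values, the combination H(tx,wt) - H(tx,w)t - tH(x,wt) + tH(x,w)t retains every
  unknown value only through its commutator with t. These commutators are known: they are expressed
  through S(t,t) and S(t,t^2). The independence of 1, t, t^2 is needed to make t^2 a left
  coefficient whose right-hand factor can be isolated.

  In a nontrivial grading no element of high degree is required. A generic element ezf of an odd
  corner separates what acts from the left from what acts from the right.\<close>

typedef (overloaded) 'q center = "ring_center :: 'q::ring_1 set"
  by (rule exI[of _ 0]) (simp add: ring_center_def)

instantiation center :: (ring_1) comm_ring_1
begin

definition "0 = Abs_center 0"
definition "1 = Abs_center 1"
definition "c + d = Abs_center (Rep_center c + Rep_center d)"
definition "c - d = Abs_center (Rep_center c - Rep_center d)"
definition "- c = Abs_center (- Rep_center c)"
definition "c * d = Abs_center (Rep_center c * Rep_center d)"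

lemma Rep_center_comm: "Rep_center c * q = q * Rep_center c"
  using Rep_center[of c] by (simp add: ring_center_def)

lemma Rep_center_hom [simp]:
  "Rep_center 0 = 0" "Rep_center 1 = 1"
  "Rep_center (c + d) = Rep_center c + Rep_center d"
  "Rep_center (c - d) = Rep_center c - Rep_center d"
  "Rep_center (- c) = - Rep_center c"
  "Rep_center (c * d) = Rep_center c * Rep_center d"
proof -
  have C: "(0::'a) \<in> ring_center" "(1::'a) \<in> ring_center"
    "Rep_center c + Rep_center d \<in> ring_center" "Rep_center c - Rep_center d \<in> ring_center"
    "- Rep_center c \<in> ring_center" "Rep_center c * Rep_center d \<in> ring_center"
    unfolding ring_center_def mem_Collect_eq
    by (simp, simp, metis Rep_center_comm distrib_left distrib_right,
        metis Rep_center_comm left_diff_distrib right_diff_distrib,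
        metis Rep_center_comm mult_minus_left mult_minus_right,
        metis Rep_center_comm mult.assoc)
  then show "Rep_center 0 = 0" "Rep_center 1 = 1"
    "Rep_center (c + d) = Rep_center c + Rep_center d"
    "Rep_center (c - d) = Rep_center c - Rep_center d"
    "Rep_center (- c) = - Rep_center c"
    "Rep_center (c * d) = Rep_center c * Rep_center d"
    by (simp_all add: zero_center_def one_center_def plus_center_def minus_center_def
      uminus_center_def times_center_def Abs_center_inverse)
qed

instance
proof
  fix a b c :: "'a center"
  show "a * b * c = a * (b * c)" "a + b + c = a + (b + c)" "0 + a = a" "1 * a = a"
    "- a + a = 0" "a - b = a + - b" "(a + b) * c = a * c + b * c" "(0::'a center) \<noteq> 1"
    "a + b = b + a"
    unfolding Rep_center_inject[symmetric] Rep_center_hom by (simp_all add: algebra_simps)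
  show "a * b = b * a"
    using Rep_center_comm[of a "Rep_center b"] by (simp add: Rep_center_inject[symmetric])
qed

end

text \<open>Scalars act through an operation of their own and not as elements of Q. The rules
  \<open>sc_simps\<close> can then collect all scalars in front, which simplification could not do
  with central factors of a product.\<close>

definition sc :: "'q::ring_1 center \<Rightarrow> 'q \<Rightarrow> 'q" where
  "sc c x = Rep_center c * x"

lemma sc_simps:
  "sc c (x + y) = sc c x + sc c y"
  "sc c (x - y) = sc c x - sc c y"
  "sc c (- x) = - sc c x"
  "sc (c + d) x = sc c x + sc d x"
  "sc (c - d) x = sc c x - sc d x"
  "sc (- c) x = - sc c x"
  "sc c (sc d x) = sc (c * d) x"
  "sc c x * y = sc c (x * y)"
  "x * sc c y = sc c (x * y)"
  by (simp_all add: sc_def algebra_simps)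
    (metis Rep_center_comm mult.assoc)

lemma sc_triv [simp]: "sc 0 x = 0" "sc c 0 = 0" "sc 1 x = x"
  by (simp_all add: sc_def)

lemmas scalg = sc_simps algebra_simps

abbreviation cst :: "'q::ring_1 center \<Rightarrow> 'q" where
  "cst c \<equiv> sc c 1"

lemma cst_eq_Rep: "cst c = Rep_center c"
  by (simp add: sc_def)

lemma cst_cancel: "cst c = cst d \<longleftrightarrow> c = d"
  by (simp add: sc_def Rep_center_inject)

lemma ring_center_cst: "x \<in> ring_center \<Longrightarrow> \<exists>c. x = cst c"
  by (rule exI[of _ "Abs_center x"]) (simp add: sc_def Abs_center_inverse)

section \<open>Spans over C and linear generalized polynomials\<close>

fun spn :: "'q::ring_1 list \<Rightarrow> 'q set" where
  "spn [] = {0}"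
| "spn (v # vs) = {sc c v + w | c w. w \<in> spn vs}"

lemma spn_1: "x \<in> spn [u] \<longleftrightarrow> (\<exists>c. x = sc c u)"
  and spn_2: "x \<in> spn [u, v] \<longleftrightarrow> (\<exists>c d. x = sc c u + sc d v)"
  by auto

lemma spn_Cons: "w \<in> spn K \<Longrightarrow> sc c v + w \<in> spn (v # K)"
  by auto

lemma spn_tail: "w \<in> spn K \<Longrightarrow> w \<in> spn (v # K)"
  using spn_Cons[of w K 0 v] by simp

lemma spn_sc: "w \<in> spn K \<Longrightarrow> sc d w \<in> spn K"
proof (induction K arbitrary: w)
  case (Cons v K)
  then obtain c w' where "w = sc c v + w'" "w' \<in> spn K" by auto
  with Cons.IH show ?case by (auto simp: sc_simps intro!: exI[of _ "d * c"] exI[of _ "sc d w'"])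
qed simp

text \<open>The generalized polynomial a_1 x b_1 + ... + a_n x b_n. The lists of left and right
  coefficients are kept apart because independence concerns the left ones only. A longer list is cut
  off silently, hence the length hypotheses in what follows.\<close>

fun lin :: "'q::ring_1 list \<Rightarrow> 'q list \<Rightarrow> 'q \<Rightarrow> 'q" where
  "lin (a # as) (b # bs) x = a * x * b + lin as bs x"
| "lin _ _ x = 0"

fun comb :: "'q::ring_1 center list \<Rightarrow> 'q list \<Rightarrow> 'q" where
  "comb (c # cs) (b # bs) = sc c b + comb cs bs"
| "comb _ _ = 0"

text \<open>A term w x b whose w is a combination of K distributes over the terms of K. The scalars
  depend on w alone, not on b or x.\<close>

lemma spn_subst:
  assumes "w \<in> spn K"
  shows "\<exists>cs. length cs = length K \<and>
    (\<forall>bs b x. length bs = length K \<longrightarrow>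
      lin K bs x + w * x * b = lin K (map2 (\<lambda>c p. p + sc c b) cs bs) x)"
  using assms
proof (induction K arbitrary: w)
  case Nil
  then show ?case by auto
next
  case (Cons v K)
  from Cons.prems obtain c w' where w: "w = sc c v + w'" "w' \<in> spn K" by auto
  from Cons.IH[OF w(2)] obtain cs where cs: "length cs = length K"
    "\<And>bs b x. length bs = length K \<Longrightarrow>
      lin K bs x + w' * x * b = lin K (map2 (\<lambda>c p. p + sc c b) cs bs) x" by blast
  have "lin (v # K) bs x + w * x * b = lin (v # K) (map2 (\<lambda>c p. p + sc c b) (c # cs) bs) x"
    if len: "length bs = length (v # K)" for bs b x
  proof -
    obtain p bs' where bs: "bs = p # bs'" "length bs' = length K"
      using len by (cases bs) auto
    show ?thesis
      using cs(2)[OF bs(2), of x b, symmetric] by (simp add: bs(1) w(1) scalg)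
  qed
  then show ?case using cs(1) by (intro exI[of _ "c # cs"]) auto
qed

lemma lin_map_mult:
  "length bs = length K \<Longrightarrow> lin K (map (\<lambda>b. l * b) bs) x = lin K bs (x * l)"
  by (induction K bs "x" rule: lin.induct) (auto simp: mult.assoc)

section \<open>Denominators, and C as a field\<close>

locale quotients =
  fixes j :: "'a::ring_1 \<Rightarrow> 'q::ring_1"
  assumes mlq: "max_left_quot j" and prime: "prime_ring (UNIV :: 'a set)"
begin

lemma j_add [simp]: "j (x + y) = j x + j y" and j_mult [simp]: "j (x * y) = j x * j y"
  and j_one [simp]: "j 1 = 1"
  and j_inj: "inj j"
  using mlq by (auto simp: max_left_quot_def)

lemma j_zero [simp]: "j 0 = 0"
  using j_add[of 0 0] by (simp del: j_add)

lemma j_minus [simp]: "j (- x) = - j x"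
  using j_add[of x "- x"] by (simp del: j_add add: eq_neg_iff_add_eq_0 add.commute)

lemma j_diff [simp]: "j (x - y) = j x - j y"
  using j_add[of x "- y"] by (simp del: j_add)

lemma j_eq_iff [simp]: "j x = j y \<longleftrightarrow> x = y"
  using j_inj by (auto simp: inj_def)

lemma j_eq_0_iff [simp]: "j x = 0 \<longleftrightarrow> x = 0"
  using j_eq_iff[of x 0] by (simp del: j_eq_iff)

lemma primeD: "(\<And>x. a * x * b = 0) \<Longrightarrow> a = 0 \<or> b = (0::'a)"
  using prime by (auto simp: prime_ring_def)

lemma denominators:
  obtains L where "dense_left_ideal L" "\<And>l. l \<in> L \<Longrightarrow> \<exists>a. j l * q = j a"
  using mlq unfolding max_left_quot_def by (metis rangeE)

lemma dense_faithful:
  "dense_left_ideal L \<Longrightarrow> (\<And>l. l \<in> L \<Longrightarrow> j l * q = j l * p) \<Longrightarrow> q = p"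
proof -
  assume L: "dense_left_ideal L" and eq: "\<And>l. l \<in> L \<Longrightarrow> j l * q = j l * p"
  have "\<forall>l\<in>L. j l * (q - p) = 0" using eq by (simp add: right_diff_distrib)
  moreover have "\<forall>q L. q \<noteq> 0 \<and> dense_left_ideal L \<longrightarrow> (\<exists>x\<in>L. j x * q \<noteq> 0)"
    using mlq by (simp add: max_left_quot_def)
  ultimately have "q - p = 0" using L by metis
  then show "q = p" by simp
qed

lemma denominator_nonzero:
  assumes "q \<noteq> 0"
  obtains l a where "j l * q = j a" "a \<noteq> 0"
proof -
  obtain L where L: "dense_left_ideal L" "\<And>l. l \<in> L \<Longrightarrow> \<exists>a. j l * q = j a"
    using denominators by blast
  have "\<exists>l\<in>L. j l * q \<noteq> 0" using dense_faithful[OF L(1), of q 0] assms by auto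
  then show thesis using L(2) that by force
qed

lemma ext_left:
  assumes "dense_left_ideal L" "\<And>x y. x \<in> L \<Longrightarrow> y \<in> L \<Longrightarrow> f (x + y) = f x + f y"
    "\<And>r x. x \<in> L \<Longrightarrow> f (r * x) = r * f x"
  obtains q where "\<And>x. x \<in> L \<Longrightarrow> j (f x) = j x * q"
proof -
  have "\<forall>L f. dense_left_ideal L \<and> (\<forall>x\<in>L. \<forall>y\<in>L. f (x + y) = f x + f y)
    \<and> (\<forall>r. \<forall>x\<in>L. f (r * x) = r * f x) \<longrightarrow> (\<exists>q. \<forall>x\<in>L. j (f x) = j x * q)"
    using mlq by (simp add: max_left_quot_def)
  then have "\<exists>q. \<forall>x\<in>L. j (f x) = j x * q"
    using assms by simp
  then show thesis using that by blast
qed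

text \<open>Primeness supplies the multiplier that density asks for: some u x r1 is nonzero, while u
  x r2 stays in the two-sided ideal.\<close>

lemma ideal_dense:
  assumes I: "0 \<in> I" "\<And>x y. x \<in> I \<Longrightarrow> y \<in> I \<Longrightarrow> x + y \<in> I" "\<And>x. x \<in> I \<Longrightarrow> - x \<in> I"
    "\<And>r x. x \<in> I \<Longrightarrow> r * x \<in> I" "\<And>r x. x \<in> I \<Longrightarrow> x * r \<in> I"
    and nz: "u \<in> I" "u \<noteq> 0"
  shows "dense_left_ideal (I :: 'a set)"
proof -
  have "\<exists>r. r * r1 \<noteq> 0 \<and> r * r2 \<in> I" if "r1 \<noteq> 0" for r1 r2
  proof -
    obtain x where "u * x * r1 \<noteq> 0" using primeD[of u r1] nz(2) \<open>r1 \<noteq> 0\<close> by blast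
    moreover have "u * x * r2 \<in> I" using I(5) nz(1) by simp
    ultimately show ?thesis by blast
  qed
  then show ?thesis unfolding dense_left_ideal_def using I by (intro conjI) auto
qed

text \<open>For p in Q take l with lp in A. Then q passes l as well as lp, so lqp = lpq; such l form
  a dense left ideal, and equality in Q can be tested on it.\<close>

lemma centralizer_of_image:
  assumes "\<And>r. q * j r = j r * q"
  shows "\<exists>c. q = cst c"
proof -
  have "q * p = p * q" for p
  proof -
    obtain L where L: "dense_left_ideal L" "\<And>l. l \<in> L \<Longrightarrow> \<exists>a. j l * p = j a"
      using denominators by blast
    have "j l * (q * p) = j l * (p * q)" if "l \<in> L" for l
    proof -
      obtain a where a: "j l * p = j a" using L(2) \<open>l \<in> L\<close> by blast
      have "j l * (q * p) = q * (j l * p)" by (simp add: assms mult.assoc[symmetric])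
      also have "\<dots> = j l * p * q" by (simp add: a assms)
      finally show ?thesis by (simp add: mult.assoc)
    qed
    then show ?thesis by (rule dense_faithful[OF L(1)])
  qed
  then show ?thesis by (intro ring_center_cst) (auto simp: ring_center_def)
qed

text \<open>The scalar is right multiplication on the ideal of all x with x b = c a for a suitable
  c in A; the equation is required in the form c z a = x z b so that the ideal is two-sided.\<close>
lemma proportional:
  assumes a: "a \<noteq> 0" and comm: "\<And>y. j a * j y * b = b * j y * j a"
  shows "\<exists>c. b = sc c (j a)"
proof -
  define R where "R x c \<longleftrightarrow> (\<forall>z. j c * j z * j a = j x * j z * b)" for x c
  define I where "I = {x. \<exists>c. R x c}"
  define f where "f x = (SOME c. R x c)" for x
  have uniq: "c = d" if "R x c" "R x d" for x c d
  proof -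
    have "(c - d) * z * a = 0" for z
      using that by (simp add: R_def algebra_simps del: j_mult flip: j_mult)
        (metis R_def that j_eq_iff j_mult mult.assoc)
    then show ?thesis using primeD[of "c - d" a] a by auto
  qed
  have Rf: "R x (f x)" if "x \<in> I" for x
    using that someI_ex[of "R x"] by (auto simp: I_def f_def)
  have fI: "f x = c" if "R x c" for x c
    using uniq[OF Rf that] that by (auto simp: I_def)
  have R_add: "R (x + y) (c + d)" if "R x c" "R y d" for x y c d
    using that by (simp add: R_def distrib_right)
  have R_left: "R (r * x) (r * c)" if "R x c" for r x c
    using that by (simp add: R_def mult.assoc)
  have R_right: "R (x * r) (c * r)" if "R x c" for r x c
  proof -
    have "j c * j (r * z) * j a = j x * j (r * z) * b" for z using that by (simp only: R_def)
    then show ?thesis by (simp add: R_def mult.assoc)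
  qed
  \<comment> \<open>A nonzero member of I: with lb in A and la nonzero, the commutation hypothesis
    says that la belongs to I, with companion lb.\<close>
  obtain L where L: "dense_left_ideal L" "\<And>l. l \<in> L \<Longrightarrow> \<exists>a. j l * b = j a"
    using denominators by blast
  obtain l where l: "l \<in> L" "j l * j a \<noteq> 0"
    using dense_faithful[OF L(1), of "j a" 0] a by auto
  obtain d where d: "j l * b = j d" using L(2) l(1) by blast
  have "R (l * a) d"
    unfolding R_def d[symmetric] using comm by (simp add: mult.assoc)
  then have la: "l * a \<in> I" "l * a \<noteq> 0" using l(2) by (auto simp: I_def simp flip: j_mult)
  have I_dense: "dense_left_ideal I"
  proof (rule ideal_dense[OF _ _ _ _ _ la])
    show "0 \<in> I" by (auto simp: I_def R_def intro: exI[of _ 0])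
    show "x + y \<in> I" if "x \<in> I" "y \<in> I" for x y
      using R_add[OF Rf[OF that(1)] Rf[OF that(2)]] by (auto simp only: I_def mem_Collect_eq)
    show "- x \<in> I" if "x \<in> I" for x
      using R_left[of x _ "- 1"] that by (auto simp: I_def)
    show "r * x \<in> I" if "x \<in> I" for r x using that R_left by (auto simp: I_def)
    show "x * r \<in> I" if "x \<in> I" for r x using that R_right by (auto simp: I_def)
  qed
  obtain q where q: "\<And>x. x \<in> I \<Longrightarrow> j (f x) = j x * q"
    by (rule ext_left[OF I_dense, of f]) (auto intro!: fI R_add R_left Rf)
  have "q * j r = j r * q" for r
  proof (rule dense_faithful[OF I_dense])
    fix x assume x: "x \<in> I"
    then have xr: "R (x * r) (f x * r)" using Rf R_right by blast
    then have "x * r \<in> I" by (auto simp: I_def)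
    have "j x * (q * j r) = j (f x * r)" using q[OF x] by (simp add: mult.assoc)
    also have "\<dots> = j (x * r) * q" using q[OF \<open>x * r \<in> I\<close>] fI[OF xr] by simp
    finally show "j x * (q * j r) = j x * (j r * q)" by (simp add: mult.assoc)
  qed
  then obtain c where c: "q = cst c" using centralizer_of_image by blast
  have "b = q * j a"
  proof (rule dense_faithful[OF I_dense])
    fix x assume x: "x \<in> I"
    have "j (f x) * j 1 * j a = j x * j 1 * b" using Rf[OF x] unfolding R_def by blast
    then show "j x * b = j x * (q * j a)" using q[OF x] by (simp add: mult.assoc)
  qed
  then have "b = sc c (j a)" by (simp add: c sc_simps)
  then show ?thesis ..
qed

lemma quotients_prime:
  assumes "\<And>x. p * j x * q = 0" "p \<noteq> 0"
  shows "q = 0"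
proof (rule ccontr)
  assume "q \<noteq> 0"
  obtain l a where l: "j l * p = j a" "a \<noteq> 0" using denominator_nonzero assms(2) by blast
  obtain m b where m: "j m * q = j b" "b \<noteq> 0" using denominator_nonzero \<open>q \<noteq> 0\<close> by blast
  have "a * x * b = 0" for x
  proof -
    have "j (a * x * b) = j l * (p * j (x * m) * q)"
      by (simp add: l(1)[symmetric] m(1)[symmetric] mult.assoc)
    then show ?thesis by (simp add: assms(1) del: j_mult)
  qed
  then show False using primeD l m by blast
qed

lemma sc_eq_0:
  assumes "sc c (q::'q) = 0"
  shows "c = 0 \<or> q = 0"
proof (rule ccontr)
  assume nz: "\<not> (c = 0 \<or> q = 0)"
  have "cst c * j x * q = 0" for x
  proof -
    have "cst c * j x * q = j x * sc c q" by (simp add: sc_simps)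
    then show ?thesis by (simp add: assms)
  qed
  moreover have "cst c \<noteq> cst 0" unfolding cst_cancel using nz by simp
  ultimately have "q = 0" using quotients_prime[of "cst c" q] by (simp only: sc_triv) blast
  then show False using nz by simp
qed

text \<open>Choose l such that a = lc is a nonzero element of A. As c is central, a y l = l y a for
  all y, so l is a scalar multiple of a, and this scalar inverts c.\<close>

lemma center_inverse:
  assumes "(c :: 'q center) \<noteq> 0"
  obtains d where "d * c = 1"
proof -
  have "cst c \<noteq> 0" using sc_eq_0[of c 1] assms by auto
  then obtain l a where l: "j l * cst c = j a" "a \<noteq> 0" using denominator_nonzero by blast
  have "\<exists>d. j l = sc d (j a)"
    by (rule proportional[OF l(2)]) (simp add: l(1)[symmetric] scalg)
  then obtain d where d: "j l = sc d (j a)" by blast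
  have "sc (d * c) (j l) = sc d (j l * cst c)" by (simp add: sc_simps)
  also have "\<dots> = j l" by (simp only: l(1) d[symmetric])
  finally have "sc (1 - d * c) (j l) = 0" by (simp add: sc_simps)
  then have "1 - d * c = 0 \<or> j l = 0" by (rule sc_eq_0)
  moreover have "j l \<noteq> 0" using l by auto
  ultimately show thesis using that by auto
qed

text \<open>Induction on K, removing its first term v x b1. Either v depends on the other
  coefficients and is absorbed by them, or the right-hand factor of v turns out to be a scalar
  multiple of that of p, and the two terms can be merged.\<close>

lemma spn_of_last:
  fixes p :: "'q"
  shows "(\<And>x. p * j x * b + lin K bs (j x) = 0) \<Longrightarrow> length bs = length K \<Longrightarrow> b \<noteq> 0 \<Longrightarrow> p \<in> spn K"
proof (induction K arbitrary: p b bs)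
  case Nil
  then show ?case using quotients_prime[of p b] by auto
next
  case (Cons v K)
  obtain b1 bs1 where bs: "bs = b1 # bs1" "length bs1 = length K"
    using Cons.prems(2) by (cases bs) auto
  show ?case
  proof (cases "v \<in> spn K")
    case True
    from spn_subst[OF True] obtain cs where cs: "length cs = length K"
      "\<And>bs b x. length bs = length K \<Longrightarrow>
        lin K bs x + v * x * b = lin K (map2 (\<lambda>c p. p + sc c b) cs bs) x" by blast
    have "p \<in> spn K"
      by (rule Cons.IH[of _ b "map2 (\<lambda>c p. p + sc c b1) cs bs1"])
        (use Cons.prems bs cs(1) in \<open>simp_all add: cs(2)[OF bs(2), symmetric] add_ac\<close>)
    then show ?thesis by (rule spn_tail)
  next
    case False
    \<comment> \<open>Substituting xl for x multiplies all right-hand factors by l from the left.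
      The factor of p may thus be taken in A, where it can itself be substituted into x.\<close>
    obtain l a where l: "j l * b = j a" "a \<noteq> 0" using denominator_nonzero Cons.prems(3) by blast
    define b2 where "b2 = j l * b1"
    define bs2 where "bs2 = map (\<lambda>b. j l * b) bs1"
    have len2: "length bs2 = length K" using bs(2) by (simp add: bs2_def)
    have rel: "p * j x * j a + v * j x * b2 + lin K bs2 (j x) = 0" for x
      using Cons.prems(1)[of "x * l"] lin_map_mult[OF bs(2), of "j l" "j x"]
      by (simp add: bs(1) bs2_def b2_def l(1)[symmetric] mult.assoc add.assoc)
    have "j a * j y * b2 = b2 * j y * j a" for y
    proof (rule ccontr)
      assume ne: "j a * j y * b2 \<noteq> b2 * j y * j a"
      \<comment> \<open>Evaluating at x a y and subtracting the identity times y a cancels the term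
        of p. What is left has v as leading coefficient and only K behind it.\<close>
      define bs3 where "bs3 = map (\<lambda>b. j a * j y * b - b * j y * j a) bs2"
      have lin3: "lin K' (map (\<lambda>b. j a * j y * b - b * j y * j a) bs) x =
          lin K' bs (x * (j a * j y)) - lin K' bs x * (j y * j a)" for K' bs x
        by (induction K' bs x rule: lin.induct) (simp_all add: algebra_simps)
      have "v * j x * (j a * j y * b2 - b2 * j y * j a) + lin K bs3 (j x) = 0" for x
      proof -
        have "v * j x * (j a * j y * b2 - b2 * j y * j a) + lin K bs3 (j x) =
          (p * j (x * (a * y)) * j a + v * j (x * (a * y)) * b2 + lin K bs2 (j (x * (a * y))))
          - (p * j x * j a + v * j x * b2 + lin K bs2 (j x)) * (j y * j a)"
          unfolding bs3_def lin3 by (simp add: algebra_simps)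
        then show ?thesis unfolding rel by simp
      qed
      then have "v \<in> spn K"
        by (rule Cons.IH) (use ne len2 in \<open>auto simp: bs3_def\<close>)
      then show False using False by simp
    qed
    then obtain c where c: "b2 = sc c (j a)" using proportional[OF l(2)] by blast
    have "(p + sc c v) * j x * j a + lin K bs2 (j x) = 0" for x
      using rel[of x] by (simp add: c scalg)
    then have "p + sc c v \<in> spn K"
      by (rule Cons.IH) (use l(2) len2 in auto)
    then have mem: "sc (- c) v + (p + sc c v) \<in> spn (v # K)" by (rule spn_Cons)
    have eq: "sc (- c) v + (p + sc c v) = p" by (simp add: sc_simps)
    show ?thesis using mem unfolding eq .
  qed
qed

text \<open>Morally, the coefficients are the negatives of the values on J of a linear functional that
  is 1 at p and vanishes on K; they do not depend on the right-hand factors.\<close>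
lemma martindale:
  assumes "p \<notin> spn K"
  shows "\<exists>cs. length cs = length J \<and> (\<forall>b ks bs. length ks = length K \<longrightarrow> length bs = length J \<longrightarrow>
    (\<forall>x. p * j x * b + lin K ks (j x) + lin J bs (j x) = 0) \<longrightarrow> b = comb cs bs)"
  using assms
proof (induction J arbitrary: K)
  case Nil
  show ?case
  proof (intro exI[of _ "[]"] conjI allI impI)
    fix b ks and bs :: "'q list"
    assume len: "length ks = length K"
      and rel: "\<forall>x. p * j x * b + lin K ks (j x) + lin [] bs (j x) = 0"
    have "b = 0" using spn_of_last[of p b K ks] len rel Nil by auto
    then show "b = comb [] bs" by simp
  qed simp
next
  case (Cons v J)
  show ?case
  proof (cases "p \<in> spn (v # K)")
    case False
    from Cons.IH[OF False] obtain cs where cs: "length cs = length J"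
      "\<And>b ks bs. length ks = length (v # K) \<Longrightarrow> length bs = length J \<Longrightarrow>
      (\<And>x. p * j x * b + lin (v # K) ks (j x) + lin J bs (j x) = 0) \<Longrightarrow> b = comb cs bs" by blast
    \<comment> \<open>Since p stays outside the span when v joins K, v is treated as one more
      coefficient of K, whose factor is not recorded.\<close>
    have "b = comb (0 # cs) bs" if len: "length ks = length K" "length bs = length (v # J)"
      and rel: "\<And>x. p * j x * b + lin K ks (j x) + lin (v # J) bs (j x) = 0" for b ks bs
    proof -
      obtain b1 bs1 where bs: "bs = b1 # bs1" "length bs1 = length J" using len by (cases bs) auto
      have "b = comb cs bs1"
        by (rule cs(2)[of "b1 # ks"]) (use len rel bs in \<open>auto simp: add_ac\<close>)
      then show ?thesis by (simp add: bs)
    qed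
    then show ?thesis using cs(1) by (intro exI[of _ "0 # cs"]) auto
  next
    case True
    then obtain c w where p: "p = sc c v + w" "w \<in> spn K" by auto
    have "c \<noteq> 0" using p Cons.prems by auto
    then obtain d where d: "d * c = 1" using center_inverse by blast
    \<comment> \<open>As c is invertible, v can be expressed by p and w. Its term then adds d b1 to
      the factor of p and alters only the unrecorded factors of K.\<close>
    have v: "v = sc d p + sc (- d) w" using d by (simp add: p scalg mult.commute)
    have "sc (- d) w \<in> spn K" using p(2) by (rule spn_sc)
    from spn_subst[OF this] obtain es where es: "length es = length K"
      "\<And>bs b x. length bs = length K \<Longrightarrow> lin K bs x + sc (- d) w * x * b =
         lin K (map2 (\<lambda>c p. p + sc c b) es bs) x" by blast
    from Cons.IH[OF Cons.prems] obtain cs where cs: "length cs = length J"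
      "\<And>b ks bs. length ks = length K \<Longrightarrow> length bs = length J \<Longrightarrow>
      (\<And>x. p * j x * b + lin K ks (j x) + lin J bs (j x) = 0) \<Longrightarrow> b = comb cs bs" by blast
    have "b = comb (- d # cs) bs" if len: "length ks = length K" "length bs = length (v # J)"
      and rel: "\<And>x. p * j x * b + lin K ks (j x) + lin (v # J) bs (j x) = 0" for b ks bs
    proof -
      obtain b1 bs1 where bs: "bs = b1 # bs1" "length bs1 = length J" using len by (cases bs) auto
      have "b + sc d b1 = comb cs bs1"
      proof (rule cs(2)[of "map2 (\<lambda>c p. p + sc c b1) es ks", OF _ bs(2)])
        show "length (map2 (\<lambda>c p. p + sc c b1) es ks) = length K" using es(1) len(1) by simp
        have vx: "v * j x * b1 = p * j x * sc d b1 + sc (- d) w * j x * b1" for x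
          by (subst v) (simp add: scalg)
        show "p * j x * (b + sc d b1) + lin K (map2 (\<lambda>c p. p + sc c b1) es ks) (j x)
            + lin J bs1 (j x) = 0" for x
          using rel[of x] unfolding bs(1) lin.simps vx es(2)[OF len(1), symmetric]
          by (simp add: algebra_simps)
      qed
      then show ?thesis by (simp add: bs sc_simps algebra_simps)
    qed
    then show ?thesis using cs(1) by (intro exI[of _ "- d # cs"]) auto
  qed
qed

end

section \<open>Commuting traces\<close>

abbreviation cm :: "'r::ring_1 \<Rightarrow> 'r \<Rightarrow> 'r" where
  "cm x y \<equiv> x * y - y * x"

context quotients
begin

lemma martindale_0:
  assumes "p \<notin> spn K" "length ks = length K" "\<And>x. p * j x * b + lin K ks (j x) = 0"
  shows "b = 0"
  using spn_of_last[of p b K ks] assms by auto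

lemma martindale_1:
  assumes "p \<notin> spn K"
  obtains c where "\<And>b b1 ks. length ks = length K \<Longrightarrow>
    (\<And>x. p * j x * b + lin K ks (j x) + u * j x * b1 = 0) \<Longrightarrow> b = sc c b1"
proof -
  obtain cs where len: "length cs = length [u]" and cs: "\<And>b ks bs. length ks = length K \<Longrightarrow>
      length bs = length [u] \<Longrightarrow>
      (\<And>x. p * j x * b + lin K ks (j x) + lin [u] bs (j x) = 0) \<Longrightarrow> b = comb cs bs"
    using martindale[OF assms, of "[u]"] by blast
  obtain c where "cs = [c]" using len by (cases cs) auto
  then show thesis using cs[of _ "[_]"] that[of c] by simp
qed

text \<open>The factors over K are discarded, those over u and v are recorded. The scalars are
  obtained before all right-hand factors, so they serve a whole family of identities with the same
  left coefficients.\<close>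

lemma martindale_2:
  assumes "p \<notin> spn K"
  obtains c d where "\<And>b b1 b2 ks. length ks = length K \<Longrightarrow>
    (\<And>x. p * j x * b + lin K ks (j x) + (u * j x * b1 + v * j x * b2) = 0) \<Longrightarrow>
    b = sc c b1 + sc d b2"
proof -
  obtain cs where len: "length cs = length [u, v]" and cs: "\<And>b ks bs. length ks = length K \<Longrightarrow>
      length bs = length [u, v] \<Longrightarrow>
      (\<And>x. p * j x * b + lin K ks (j x) + lin [u, v] bs (j x) = 0) \<Longrightarrow> b = comb cs bs"
    using martindale[OF assms, of "[u, v]"] by blast
  obtain c cs' where c: "cs = c # cs'" using len by (cases cs) auto
  obtain d where "cs' = [d]" using len c by (cases cs') auto
  then show thesis using cs[of _ "[_, _]"] that[of c d] c by simp
qed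

lemma central_diff:
  assumes "\<And>x. cm (q - p) (j x) = 0"
  obtains c where "q = p + cst c"
proof -
  obtain c where "q - p = cst c" using centralizer_of_image[of "q - p"] assms by auto
  then show thesis using that by (metis add.commute diff_add_cancel)
qed

text \<open>The commutator with t is a derivation, so a annihilates [t,yx] - [t,y]x = y[t,x] too,
  and primeness applies.\<close>

lemma noncentral_kill:
  assumes "j t \<notin> spn [1]" "\<And>x. a * cm (j t) (j x) = 0"
  shows "a = 0"
proof (rule ccontr)
  assume "a \<noteq> 0"
  have "a * j y * cm (j t) (j x) = 0" for x y
  proof -
    have "a * j y * cm (j t) (j x) = - (a * cm (j t) (j y) * j x) + a * cm (j t) (j (y * x))"
      by (simp add: algebra_simps)
    then show ?thesis by (simp only: assms(2)) simp
  qed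
  then have "cm (j t) (j x) = 0" for x using quotients_prime[of a] \<open>a \<noteq> 0\<close> by blast
  then obtain c where "j t = 0 + cst c" using central_diff[of "j t" 0] by auto
  then show False using assms(1) by auto
qed

lemma not_quadratic_noncentral:
  assumes "j t * j t \<notin> spn [1, j t]"
  shows "j t \<notin> spn [1]"
proof
  assume "j t \<in> spn [1]"
  then obtain c where "j t = cst c" by auto
  then have "j t * j t = sc 0 1 + sc c (j t)" by (simp add: sc_simps)
  then show False using assms unfolding spn_2 by blast
qed

lemma indep_1: "(q :: 'q) \<notin> spn [1] \<Longrightarrow> sc a q + cst b = 0 \<Longrightarrow> a = 0 \<and> b = 0"
proof -
  assume q: "q \<notin> spn [1]" and eq: "sc a q + cst b = 0"
  have "a = 0"
  proof (rule ccontr)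
    assume "a \<noteq> 0"
    then obtain d where d: "d * a = 1" using center_inverse by blast
    have "sc d (sc a q + cst b) = q + cst (d * b)" by (simp only: sc_simps d sc_triv)
    then have "q = cst (- (d * b))" unfolding eq by (simp add: sc_simps eq_neg_iff_add_eq_0)
    then show False using q by auto
  qed
  moreover from this have "cst b = cst 0" using eq by simp
  then have "b = 0" by (simp only: cst_cancel)
  ultimately show ?thesis by simp
qed

end

locale quotients_half = quotients j for j :: "'a::ring_1 \<Rightarrow> 'q::ring_1" +
  assumes two: "(2 :: 'a) \<noteq> 0"
begin

lemma half: obtains h :: "'q center" where "h + h = 1"
proof -
  have "(2 :: 'q center) \<noteq> 0"
  proof
    assume "(2 :: 'q center) = 0"
    moreover have "j (1 + 1) = cst (1 + 1)" by (simp only: j_add j_one sc_simps sc_triv)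
    ultimately have "j (1 + 1) = 0" by (simp only: one_add_one sc_triv)
    then show False using two by (simp del: j_add)
  qed
  then obtain h :: "'q center" where "h * 2 = 1" using center_inverse by blast
  then have "h + h = 1" by (metis mult_2_right)
  then show thesis using that by blast
qed

lemma double_cancel: "(x :: 'q) + x = y + y \<Longrightarrow> x = y"
proof -
  assume eq: "x + x = y + y"
  obtain h :: "'q center" where h: "h + h = 1" using half by blast
  have "sc h (z + z) = z" for z :: 'q
    by (simp only: sc_simps(1) sc_simps(4)[symmetric] h sc_triv)
  from this[of x] this[of y] show "x = y" unfolding eq by simp
qed

end

text \<open>\<open>cyc\<close> is the linearization of \<open>self\<close>. At x = y = z it gives
  only three times \<open>self\<close>, and characteristic 3 is allowed, so both are assumed.
  Additivity of S is not among the assumptions: every substitution has to be made in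
  \<open>cyc\<close> itself.\<close>

locale commuting_trace = quotients_half j for j :: "'a::ring_1 \<Rightarrow> 'q::ring_1" +
  fixes S :: "'a \<Rightarrow> 'a \<Rightarrow> 'q"
  assumes sym: "S x y = S y x"
    and cyc: "cm (S x y) (j z) + cm (S y z) (j x) + cm (S z x) (j y) = 0"
    and self: "cm (S x x) (j x) = 0"
begin

text \<open>The values S(t,w) are unknown, but their commutators with t are, up to the factor 2, an
  inner derivation applied to w. The elimination of unknowns rests on this and on the analogue for
  t^2.\<close>

lemma cm_slice: "cm (j t) (S t w) + cm (j t) (S t w) = cm (S t t) (j w)"
  using cyc[of t t w] unfolding sym[of w t] by (simp add: algebra_simps)

lemma cm_slice_square:
  "cm (j t) (S (t * t) w) =
    cm (S t (t * t)) (j w) - (j t * cm (j t) (S t w) + cm (j t) (S t w) * j t)"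
proof -
  have 1: "cm (S t (t * t)) (j w) + cm (S (t * t) w) (j t) + cm (S t w) (j t * j t) = 0"
    using cyc[of t "t * t" w] unfolding sym[of w t] by simp
  have "cm (j t) (S (t * t) w) -
      (cm (S t (t * t)) (j w) - (j t * cm (j t) (S t w) + cm (j t) (S t w) * j t)) =
    - (cm (S t (t * t)) (j w) + cm (S (t * t) w) (j t) + cm (S t w) (j t * j t))"
    by (simp add: algebra_simps)
  then show ?thesis unfolding 1 by simp
qed

text \<open>Two instances of \<open>cyc\<close>, one with t and one with t^2, contain S(x,w). It
  cancels because [S,t^2] = t[S,t] + [S,t]t.\<close>

lemma slice_relation:
  "cm (j x) (S (t * t) w) + cm (j w) (S (t * t) x) =
    j t * (cm (j x) (S t w) + cm (j w) (S t x)) + (cm (j x) (S t w) + cm (j w) (S t x)) * j t"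
    (is "?l = ?r")
proof -
  have 1: "cm (S x w) (j t) + cm (S t w) (j x) + cm (S t x) (j w) = 0"
    using cyc[of x w t] unfolding sym[of w t] by (simp add: add_ac)
  have 2: "cm (S x w) (j t * j t) + cm (S (t * t) w) (j x) + cm (S (t * t) x) (j w) = 0"
    using cyc[of x w "t * t"] unfolding sym[of w "t * t"] by (simp add: add_ac)
  have "?l - ?r = j t * (cm (S x w) (j t) + cm (S t w) (j x) + cm (S t x) (j w))
     + (cm (S x w) (j t) + cm (S t w) (j x) + cm (S t x) (j w)) * j t
     - (cm (S x w) (j t * j t) + cm (S (t * t) w) (j x) + cm (S (t * t) x) (j w))"
    by (simp add: algebra_simps)
  then show ?thesis unfolding 1 2 by simp
qed

lemma cm_square: "cm (S t (t * t)) (j t) = 0"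
proof -
  have c: "j t * S t t = S t t * j t" using self[of t] by simp
  have "j t * j t * S t t = j t * (S t t * j t)" by (simp only: mult.assoc c)
  also have "\<dots> = S t t * j t * j t" by (simp only: mult.assoc[symmetric] c)
  also have "\<dots> = S t t * (j t * j t)" by (rule mult.assoc)
  finally have "cm (j t) (S t (t * t)) + cm (j t) (S t (t * t)) = 0 + 0"
    using cm_slice[of t "t * t"] by simp
  then have "cm (j t) (S t (t * t)) = 0" by (rule double_cancel)
  then show ?thesis by simp
qed

text \<open>Let s be half of S(t,t). After the elimination an identity in w remains with left
  coefficients 1, t, t^2, s and c - 2ts. The factor of t^2 is [s,x], those of c - 2ts and s are
  [t,x] and -[t^2,x]. Hence [s,x] = a[t,x] - b[t^2,x] with scalars that do not depend on x, and s
  differs from at - bt^2 by a scalar. Terms occur twice because S(t,t) is the diagonal of a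
  symmetric form.\<close>

lemma trace_form:
  assumes deg: "j t * j t \<notin> spn [1, j t]"
  obtains l m n where "S t t = sc l (j t * j t) + sc l (j t * j t) + sc m (j t) + sc m (j t) + cst n"
proof -
  define T where "T = j t"
  define h where "h w = S t w" for w
  define k where "k w = S (t * t) w" for w
  define c where "c = S t (t * t)"
  obtain hf :: "'q center" where hf: "hf + hf = 1" using half by blast
  define s where "s = sc hf (S t t)"
  have ss: "s + s = S t t"
    unfolding s_def sc_simps(4)[symmetric] hf by simp
  have dh: "cm T (h w) = cm s (j w)" for w
  proof (rule double_cancel)
    show "cm T (h w) + cm T (h w) = cm s (j w) + cm s (j w)"
      using cm_slice[of t w] unfolding ss[symmetric] T_def h_def by (simp add: algebra_simps)
  qed
  have dk: "cm T (k w) = cm c (j w) - (T * cm s (j w) + cm s (j w) * T)" for w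
    using cm_slice_square[of t w] dh[of w] by (simp add: T_def h_def k_def c_def)
  define E where "E x w = cm (j x) (h w) + cm (j w) (h x)" for x w
  define H where "H x w = cm (j x) (k w) + cm (j w) (k x) - (T * E x w + E x w * T)" for x w
  have H0: "H x w = 0" for x w
    using slice_relation[of x t w] unfolding H_def E_def T_def h_def k_def by simp
  have gpi: "(cm c (j w) - (T * cm s (j w) + cm s (j w) * T)) * cm T (j x)
      - cm T (j w) * (cm c (j x) - (T * cm s (j x) + cm s (j x) * T))
      = T * (cm s (j w) * cm T (j x) - cm T (j w) * cm s (j x))
        + (cm s (j w) * cm T (j x) - cm T (j w) * cm s (j x)) * T" for x w
  proof -
    define F where "F = cm T (h (w * t)) * j x - cm T (h w) * j x * T
      + j w * cm T (h (t * x)) - T * j w * cm T (h x)"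
    have "H (t * x) (w * t) - H (t * x) w * T - T * H x (w * t) + T * H x w * T =
      cm T (k (w * t)) * j x - cm T (k w) * j x * T + j w * cm T (k (t * x)) - T * j w * cm T (k x)
      - (T * F + F * T)"
      unfolding H_def E_def F_def by (simp add: algebra_simps flip: T_def)
    then have 1: "cm T (k (w * t)) * j x - cm T (k w) * j x * T + j w * cm T (k (t * x))
      - T * j w * cm T (k x) = T * F + F * T"
      unfolding H0 by simp
    have sT: "s * T = T * s"
      using self[of t] unfolding ss[symmetric] T_def[symmetric]
      by (rule_tac double_cancel) (simp add: algebra_simps)
    have cT: "c * T = T * c"
      using cm_square[of t] by (simp add: c_def T_def)
    have F: "F = cm s (j w) * cm T (j x) - cm T (j w) * cm s (j x)"
    proof -
      have "F = cm s (j w * T) * j x - cm s (j w) * j x * T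
        + j w * cm s (T * j x) - T * j w * cm s (j x)"
        unfolding F_def dh by (simp add: T_def)
      also have "\<dots> = cm s (j w) * cm T (j x) - cm T (j w) * cm s (j x)
         + j w * (s * T - T * s) * j x + j w * (s * T - T * s) * j x"
        by (simp add: algebra_simps)
      finally show ?thesis by (simp add: sT)
    qed
    have dk1: "cm T (k (w * t)) = cm T (k w) * T"
    proof -
      have "cm c (j w * T) - (T * cm s (j w * T) + cm s (j w * T) * T)
        = (cm c (j w) - (T * cm s (j w) + cm s (j w) * T)) * T
         + j w * (c * T - T * c) - T * j w * (s * T - T * s) - j w * (s * T - T * s) * T"
        by (simp add: algebra_simps)
      moreover have "j (w * t) = j w * T" by (simp add: T_def)
      ultimately show ?thesis unfolding dk by (simp only: sT cT) simp
    qed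
    have dk2: "cm T (k (t * x)) = T * cm T (k x)"
    proof -
      have "cm c (T * j x) - (T * cm s (T * j x) + cm s (T * j x) * T)
        = T * (cm c (j x) - (T * cm s (j x) + cm s (j x) * T))
         + (c * T - T * c) * j x - T * (s * T - T * s) * j x - (s * T - T * s) * j x * T"
        by (simp add: algebra_simps)
      moreover have "j (t * x) = T * j x" by (simp add: T_def)
      ultimately show ?thesis unfolding dk by (simp only: sT cT) simp
    qed
    have "cm T (k (w * t)) * j x - cm T (k w) * j x * T + j w * cm T (k (t * x))
      - T * j w * cm T (k x) = cm T (k w) * cm T (j x) - cm T (j w) * cm T (k x)"
      unfolding dk1 dk2 by (simp add: algebra_simps)
    then show ?thesis using 1 unfolding F dk by simp
  qed
  obtain a b where ab: "\<And>y b1 b2 ks. length ks = length [1, T] \<Longrightarrow>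
    (\<And>w. T * T * j w * y + lin [1, T] ks (j w) + ((c - (T * s + T * s)) * j w * b1
      + s * j w * b2) = 0) \<Longrightarrow> y = sc a b1 + sc b b2"
    using martindale_2[OF deg[folded T_def], of "c - (T * s + T * s)" s] by blast
  have "cm s (j x) = sc a (cm T (j x)) + sc b (- cm (T * T) (j x))" for x
  proof -
    define A where "A = cm T (j x)"
    define D where "D = cm s (j x)"
    define B where "B = cm c (j x) - (T * D + D * T)"
    show ?thesis unfolding A_def[symmetric] D_def[symmetric]
    \<comment> \<open>The two list entries are the right-hand factors over 1 and T, read off from
      the expanded \<open>gpi\<close>.\<close>
    proof (rule ab[of "[s * T * A + T * B + s * A * T - c * A - T * D * T,
          s * A + s * A - B - T * D + D * T]"])
      fix w
      have "(cm c (j w) - (T * cm s (j w) + cm s (j w) * T)) * A - cm T (j w) * B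
        - (T * (cm s (j w) * A - cm T (j w) * D) + (cm s (j w) * A - cm T (j w) * D) * T) = 0"
        using gpi[of w x] unfolding A_def[symmetric] D_def[symmetric] B_def[symmetric] by simp
      moreover have "cm (T * T) (j x) = T * A + A * T" by (simp add: A_def algebra_simps)
      ultimately show "T * T * j w * D + lin [1, T] [s * T * A + T * B + s * A * T - c * A - T * D * T,
          s * A + s * A - B - T * D + D * T] (j w)
          + ((c - (T * s + T * s)) * j w * A + s * j w * - cm (T * T) (j x)) = 0"
        by (simp add: algebra_simps)
    qed simp
  qed
  then have "cm (s - (sc a T - sc b (T * T))) (j x) = 0" for x
    by (simp add: scalg)
  then obtain n where s: "s = (sc a T - sc b (T * T)) + cst n" using central_diff by blast
  have "S t t = sc (- b) (T * T) + sc (- b) (T * T) + sc a T + sc a T + (cst n + cst n)"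
    unfolding ss[symmetric] s by (simp add: scalg)
  also have "cst n + cst n = cst (n + n)" by (simp only: sc_simps)
  finally show thesis using that unfolding T_def by blast
qed

text \<open>Subtract from S(t,y), S(t^2,y) and S(t,t^2) what l and m already explain. The remainders
  of the first and the third commute with t, so the elimination collapses to [c,w][t,x] =
  [t,w][c,x], which puts c into C + Ct. A second elimination does the same for the remainder of
  S(t,w).\<close>

lemma slice_form:
  assumes deg: "j t * j t \<notin> spn [1, j t]"
  obtains l m \<alpha> \<beta> where
    "\<And>y. S t y = sc l (j t * j y + j y * j t) + sc m (j y) + sc (\<alpha> y) (j t) + cst (\<beta> y)"
proof -
  define T where "T = j t"
  have noncentral: "T \<notin> spn [1]"
    unfolding T_def by (rule not_quadratic_noncentral[OF deg])
  obtain l m n where tt: "S t t = sc l (T * T) + sc l (T * T) + sc m T + sc m T + cst n"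
    using trace_form[OF deg] unfolding T_def by blast
  define z where "z y = S t y - sc l (T * j y + j y * T) - sc m (j y)" for y
  define k where "k y = S (t * t) y - sc l (T * T * j y + j y * (T * T))" for y
  define c where "c = S t (t * t) - sc l (T * T * T) - sc l (T * T * T) - sc m (T * T)"
  have S1: "S t y = z y + sc l (T * j y + j y * T) + sc m (j y)" for y
    by (simp add: z_def)
  have S2: "S (t * t) y = k y + sc l (T * T * j y + j y * (T * T))" for y
    by (simp add: k_def)
  have S3: "S t (t * t) = c + sc l (T * T * T) + sc l (T * T * T) + sc m (T * T)"
    by (simp add: c_def)
  have zT: "cm T (z w) = 0" for w
  proof -
    have "cm T (z w) + cm T (z w) = 0 + 0"
      using cm_slice[of t w] unfolding tt unfolding S1 T_def[symmetric] by (simp add: scalg)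
    then show ?thesis by (rule double_cancel)
  qed
  have zc: "z w * T = T * z w" for w using zT[of w] by simp
  have cT: "c * T = T * c"
    using cm_square[of t] unfolding S3 T_def[symmetric] by (simp add: scalg)
  have kT: "cm T (k w) = cm c (j w)" for w
  proof -
    have 1: "cm T (S t w) = sc l (cm (T * T) (j w)) + sc m (cm T (j w))"
      unfolding S1 using zT[of w] by (simp add: scalg)
    show ?thesis
      using cm_slice_square[of t w] unfolding S3 S2 T_def[symmetric] 1 by (simp add: scalg)
  qed
  have rel: "cm (j x) (k w) + cm (j w) (k x) =
    T * (cm (j x) (z w) + cm (j w) (z x)) + (cm (j x) (z w) + cm (j w) (z x)) * T" for x w
    using slice_relation[of x t w] unfolding S1 S2 T_def[symmetric] by (simp add: scalg)
  define H where "H x w = cm (j x) (k w) + cm (j w) (k x) -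
    (T * (cm (j x) (z w) + cm (j w) (z x)) + (cm (j x) (z w) + cm (j w) (z x)) * T)" for x w
  have H0: "H x w = 0" for x w unfolding H_def rel by simp
  have gpi: "cm c (j w) * cm T (j x) = cm T (j w) * cm c (j x)" for x w
  proof -
    define F where "F = cm T (z (w * t)) * j x - cm T (z w) * j x * T
      + j w * cm T (z (t * x)) - T * j w * cm T (z x)"
    have "H (t * x) (w * t) - H (t * x) w * T - T * H x (w * t) + T * H x w * T =
      cm T (k (w * t)) * j x - cm T (k w) * j x * T + j w * cm T (k (t * x)) - T * j w * cm T (k x)
      - (T * F + F * T)"
      unfolding H_def F_def by (simp add: algebra_simps flip: T_def)
    moreover have "F = 0" unfolding F_def zT by simp
    ultimately have "cm c (j w * T) * j x - cm c (j w) * j x * T + j w * cm c (T * j x)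
        - T * j w * cm c (j x) = 0"
      unfolding H0 kT by (simp add: T_def)
    moreover have "cm c (j w * T) * j x - cm c (j w) * j x * T + j w * cm c (T * j x)
        - T * j w * cm c (j x) = cm c (j w) * cm T (j x) - cm T (j w) * cm c (j x)
        + j w * (c * T - T * c) * j x + j w * (c * T - T * c) * j x"
      by (simp add: algebra_simps)
    ultimately show ?thesis by (simp add: cT)
  qed
  have "c \<in> spn [1, T]"
  proof (rule ccontr)
    assume nin: "c \<notin> spn [1, T]"
    have "1 * cm T (j x) = 0" for x
    proof -
      have "cm T (j x) = 0"
      proof (rule martindale_0[OF nin, of "[T * cm c (j x) - c * cm T (j x), - cm c (j x)]"])
        show "c * j w * cm T (j x) + lin [1, T] [T * cm c (j x) - c * cm T (j x), - cm c (j x)] (j w) = 0" for w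
          using gpi[of w x] by (simp add: algebra_simps)
      qed simp
      then show ?thesis by simp
    qed
    then have "(1::'q) = 0" by (rule noncentral_kill[OF noncentral[unfolded T_def], folded T_def])
    then show False by simp
  qed
  then obtain r r' where c: "c = cst r' + sc r T" unfolding spn_2 by blast
  \<comment> \<open>Now [t,k(w)] = [c,w] = r[t,w], so after subtracting rw the second remainder
    commutes with t as well.\<close>
  define z' where "z' w = k w - sc r (j w)" for w
  have k: "k w = z' w + sc r (j w)" for w by (simp add: z'_def)
  have z'T: "z' w * T = T * z' w" for w
    using kT[of w] unfolding k c by (simp add: scalg)
  have rel': "cm (j x) (z' w) + cm (j w) (z' x) =
    T * (cm (j x) (z w) + cm (j w) (z x)) + (cm (j x) (z w) + cm (j w) (z x)) * T" for x w
    using rel[of x w] unfolding k by (simp add: scalg)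
  have z_spn: "z w \<in> spn [1, T]" for w
  proof (rule ccontr)
    assume nin: "z w \<notin> spn [1, T]"
    define z1 z0 z1' z0' where "z1 = z (w * t)" and "z0 = z w" and "z1' = z' (w * t)" and "z0' = z' w"
    obtain a b where ab: "\<And>y b1 b2 ks. length ks = length [1, T] \<Longrightarrow>
      (\<And>x. z0 * j x * y + lin [1, T] ks (j x) + ((T * z1 - z1') * j x * b1
        + (z0' + z1 - T * z0) * j x * b2) = 0) \<Longrightarrow> y = sc a b1 + sc b b2"
      using martindale_2[OF nin, of "T * z1 - z1'" "z0' + z1 - T * z0"] unfolding z0_def by blast
    \<comment> \<open>Comparing the relation at (x, wt) with T times the one at (x, w), multiplied
      on the right, removes the remainders at x, because they commute with T. In the identity that
      is left, z(w) has the factor -T^2 while the recorded factors are 1 and T.\<close>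
    have "- (T * T) = sc a 1 + sc b T"
    proof (rule ab[of "[z1' - z0' * T - z1 * T + z0 * T * T, z0 * T - z1]"])
      fix x
      have zx: "z x * T = T * z x" "z' x * T = T * z' x" using zc z'T by auto
      have "cm (j x) z1' + cm (j w * T) (z' x) =
        T * (cm (j x) z1 + cm (j w * T) (z x)) + (cm (j x) z1 + cm (j w * T) (z x)) * T"
        using rel'[of x "w * t"] by (simp add: z1'_def z1_def T_def)
      moreover have "cm (j w * T) (z' x) = cm (j w) (z' x) * T" "cm (j w * T) (z x) = cm (j w) (z x) * T"
        using zx by (simp_all add: algebra_simps)
      ultimately have 1: "cm (j x) z1' + cm (j w) (z' x) * T -
        (T * (cm (j x) z1 + cm (j w) (z x) * T) + (cm (j x) z1 + cm (j w) (z x) * T) * T) = 0"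
        by simp
      have 2: "cm (j x) z0' + cm (j w) (z' x) -
        (T * (cm (j x) z0 + cm (j w) (z x)) + (cm (j x) z0 + cm (j w) (z x)) * T) = 0"
        using rel'[of x w] by (simp add: z0'_def z0_def)
      have "z0 * j x * (- (T * T)) +
        lin [1, T] [z1' - z0' * T - z1 * T + z0 * T * T, z0 * T - z1] (j x)
        + ((T * z1 - z1') * j x * 1 + (z0' + z1 - T * z0) * j x * T) =
        (cm (j x) z1' + cm (j w) (z' x) * T -
        (T * (cm (j x) z1 + cm (j w) (z x) * T) + (cm (j x) z1 + cm (j w) (z x) * T) * T))
        - (cm (j x) z0' + cm (j w) (z' x) -
        (T * (cm (j x) z0 + cm (j w) (z x)) + (cm (j x) z0 + cm (j w) (z x)) * T)) * T"
        by (simp add: algebra_simps)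
      then show "z0 * j x * (- (T * T)) +
        lin [1, T] [z1' - z0' * T - z1 * T + z0 * T * T, z0 * T - z1] (j x)
        + ((T * z1 - z1') * j x * 1 + (z0' + z1 - T * z0) * j x * T) = 0"
        unfolding 1 2 by simp
    qed simp
    then have eq: "- (- (T * T)) = - (sc a 1 + sc b T)" by (simp only:)
    have "T * T = sc (- a) 1 + sc (- b) T"
      unfolding eq[unfolded minus_minus] by (simp add: sc_simps)
    then show False using deg unfolding T_def[symmetric] spn_2 by blast
  qed
  then have "\<forall>y. \<exists>b a. z y = cst b + sc a T" unfolding spn_2 by blast
  then obtain \<beta> \<alpha> where "\<And>y. z y = cst (\<beta> y) + sc (\<alpha> y) T" by metis
  then have "S t y = sc l (j t * j y + j y * j t) + sc m (j y) + sc (\<alpha> y) (j t) + cst (\<beta> y)" for y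
    unfolding S1 by (simp add: T_def)
  then show thesis by (rule that)
qed

lemma remainder_cyc:
  assumes R: "\<And>x y. R x y = S x y - sc l (j x * j y + j y * j x) - sc (\<alpha> x) (j y) - sc (\<alpha> y) (j x)"
  shows "R x y = R y x" "cm (R x y) (j z) + cm (R y z) (j x) + cm (R z x) (j y) = 0"
proof -
  show "R x y = R y x" unfolding R sym[of y x] by (simp add: add_ac)
  have "cm (R x y) (j z) + cm (R y z) (j x) + cm (R z x) (j y) =
    cm (S x y) (j z) + cm (S y z) (j x) + cm (S z x) (j y)"
    unfolding R by (simp add: scalg)
  then show "cm (R x y) (j z) + cm (R y z) (j x) + cm (R z x) (j y) = 0" by (simp only: cyc)
qed

text \<open>The coefficient of y in S(t,y) has to agree with the functional \<alpha> at t.\<close>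
lemma remainder_slice:
  assumes nc: "j t \<notin> spn [1]"
    and slice: "\<And>y. S t y = sc l (j t * j y + j y * j t) + sc m (j y) + sc (\<alpha> y) (j t) + cst (\<beta> y)"
    and R: "\<And>x y. R x y = S x y - sc l (j x * j y + j y * j x) - sc (\<alpha> x) (j y) - sc (\<alpha> y) (j x)"
  shows "R t y = cst (\<beta> y)" "cm (R x w) (j t) = 0"
proof -
  note RR = remainder_cyc[OF R]
  have Rt: "R t y = sc (m - \<alpha> t) (j y) + cst (\<beta> y)" for y
    unfolding R slice by (simp add: scalg)
  have "m - \<alpha> t = 0"
  proof (rule ccontr)
    assume ne: "m - \<alpha> t \<noteq> 0"
    have "sc (m - \<alpha> t) (cm (j t) (j y)) = 0" for y
    proof -
      have "cm (R t t) (j y) + cm (R t y) (j t) + cm (R t y) (j t) = 0"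
        using RR(2)[of t t y] unfolding RR(1)[of y t] .
      then show ?thesis unfolding Rt by (simp add: sc_simps(1-3) sc_simps(7-) algebra_simps)
    qed
    then have "1 * cm (j t) (j y) = 0" for y using sc_eq_0 ne by fastforce
    then have "(1::'q) = 0" by (rule noncentral_kill[OF nc])
    then show False by simp
  qed
  then show Rt': "R t y = cst (\<beta> y)" for y unfolding Rt by simp
  show "cm (R x w) (j t) = 0"
    using RR(2)[of x w t] unfolding Rt' RR(1)[of w t] by (simp add: sc_simps)
qed

text \<open>By now all R(x,w) commute with t. Substituting tx into the comparison of R(x,yt) with
  R(x,y)t shows that they differ by a(x) + b(x)t. With M(x) = R(x,y) + b(x) there remains M(w)[t,x]
  + M(x)[t,w] = 0, and replacing x by xt makes M vanish, again by the degree of t. Thus R(x,y) is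
  the scalar -b(x).\<close>

theorem commuting_trace_form:
  assumes deg: "j t * j t \<notin> spn [1, j t]"
  obtains l \<alpha> \<nu> where
    "\<And>x y. S x y = sc l (j x * j y + j y * j x) + sc (\<alpha> x) (j y) + sc (\<alpha> y) (j x) + cst (\<nu> x y)"
proof -
  define T where "T = j t"
  note nc = not_quadratic_noncentral[OF deg]
  obtain l m \<alpha> \<beta> where slice:
    "\<And>y. S t y = sc l (j t * j y + j y * j t) + sc m (j y) + sc (\<alpha> y) (j t) + cst (\<beta> y)"
    by (rule slice_form[OF deg]) blast
  define R where "R x y = S x y - sc l (j x * j y + j y * j x) - sc (\<alpha> x) (j y) - sc (\<alpha> y) (j x)"
    for x y
  note Rsym = remainder_cyc(1)[OF R_def] and Rcyc = remainder_cyc(2)[OF R_def]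
  have RT: "cm (R x w) T = 0" for x w
    unfolding T_def by (rule remainder_slice(2)[OF nc slice R_def])
  have "\<exists>n. R x y = cst n" for x y
  proof -
    define P where "P w = R w (y * t)" for w
    define Q where "Q w = R w y" for w
    have PT: "P w * T = T * P w" and QT: "Q w * T = T * Q w" for w
      using RT by (simp_all add: P_def Q_def)
    define G where "G w x = cm (P w) (j x) + cm (P x) (j w) - (cm (Q w) (j x) + cm (Q x) (j w)) * T"
      for w x
    have G0: "G w x = 0" for w x
    proof -
      have "G w x = (cm (R w (y * t)) (j x) + cm (R (y * t) x) (j w) + cm (R x w) (j (y * t)))
        - (cm (R w y) (j x) + cm (R y x) (j w) + cm (R x w) (j y)) * T - j y * cm (R x w) T"
        unfolding G_def P_def Q_def Rsym[of "y * t" x] Rsym[of y x]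
        by (simp add: algebra_simps flip: T_def)
      then show ?thesis unfolding Rcyc RT by simp
    qed
    have "\<exists>a b. P x - Q x * T = sc a 1 + sc b T" for x
    proof -
      obtain a b where ab: "\<And>y b1 b2 ks. length ks = length [1::'q] \<Longrightarrow>
        (\<And>w. T * j w * y + lin [1] ks (j w) + ((P (t * x) - T * P x) * j w * b1
          + (T * Q x - Q (t * x)) * j w * b2) = 0) \<Longrightarrow> y = sc a b1 + sc b b2"
        using martindale_2[OF nc[folded T_def], of "P (t * x) - T * P x" "T * Q x - Q (t * x)"]
        by blast
      have "P x - Q x * T = sc a 1 + sc b T"
      proof (rule ab[of "[Q (t * x) * T - P (t * x)]"])
        fix w
        have "G w (t * x) - T * G w x = T * j w * (P x - Q x * T) +
          lin [1] [Q (t * x) * T - P (t * x)] (j w) +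
          ((P (t * x) - T * P x) * j w * 1 + (T * Q x - Q (t * x)) * j w * T)
          + (P w * T - T * P w) * j x - (Q w * T - T * Q w) * j x * T"
          unfolding G_def by (simp add: algebra_simps flip: T_def)
        then show "T * j w * (P x - Q x * T) +
          lin [1] [Q (t * x) * T - P (t * x)] (j w) +
          ((P (t * x) - T * P x) * j w * 1 + (T * Q x - Q (t * x)) * j w * T) = 0"
          unfolding G0 by (simp only: PT QT) simp
      qed simp
      then show ?thesis by blast
    qed
    then obtain a b where ab: "\<And>x. P x - Q x * T = sc (a x) 1 + sc (b x) T" by metis
    have P: "P x = Q x * T + (sc (a x) 1 + sc (b x) T)" for x
      using ab[of x] by (simp add: algebra_simps)
    define M where "M x = Q x + cst (b x)" for x
    have M: "M w * cm T (j x) + M x * cm T (j w) = 0" for w x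
    proof -
      have "M w * cm T (j x) + M x * cm T (j w) = G w x"
        unfolding G_def P M_def by (simp add: scalg)
      then show ?thesis unfolding G0 by simp
    qed
    have "M x = 0" for x
    proof (rule ccontr)
      assume "M x \<noteq> 0"
      then have nin: "M x \<notin> spn []" by simp
      obtain a b where ab: "\<And>y b1 b2 ks. length ks = length ([]::'q list) \<Longrightarrow>
        (\<And>w. M x * j w * y + lin [] ks (j w) + (M (x * t) * T * j w * b1
          + - (M (x * t) + M x * T) * j w * b2) = 0) \<Longrightarrow> y = sc a b1 + sc b b2"
        using martindale_2[OF nin, of "M (x * t) * T" "- (M (x * t) + M x * T)"] by auto
      have "T * T = sc a 1 + sc b T"
      proof (rule ab[of "[]"])
        fix w
        have "M x * j w * (T * T) + lin [] [] (j w) + (M (x * t) * T * j w * 1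
          + - (M (x * t) + M x * T) * j w * T) =
          (M w * cm T (j (x * t)) + M (x * t) * cm T (j w)) - (M w * cm T (j x) + M x * cm T (j w)) * T"
          by (simp add: algebra_simps flip: T_def)
        then show "M x * j w * (T * T) + lin [] [] (j w) + (M (x * t) * T * j w * 1
          + - (M (x * t) + M x * T) * j w * T) = 0"
          unfolding M by simp
      qed simp
      then show False using deg unfolding T_def[symmetric] spn_2 by blast
    qed
    then have "R x y = cst (- b x)" unfolding M_def Q_def by (simp add: sc_simps eq_neg_iff_add_eq_0)
    then show ?thesis by blast
  qed
  then obtain \<nu> where "\<And>x y. R x y = cst (\<nu> x y)" by metis
  then have "S x y = sc l (j x * j y + j y * j x) + sc (\<alpha> x) (j y) + sc (\<alpha> y) (j x) + cst (\<nu> x y)"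
    for x y
    unfolding R_def by (simp add: algebra_simps)
  then show thesis by (rule that)
qed

section \<open>Small centralizers and quadratic algebras\<close>

lemma small_centralizer_form:
  assumes nc: "j t \<notin> spn [1]"
    and cent: "\<And>q. cm q (j t) = 0 \<Longrightarrow> q \<in> spn [1, j t]"
  obtains \<alpha> \<nu> where
    "\<And>x y. S x y = sc (\<alpha> x) (j y) + sc (\<alpha> y) (j x) + cst (\<nu> x y)"
proof -
  define T where "T = j t"
  obtain h :: "'q center" where h: "h + h = 1" using half by blast
  obtain n m' where tt: "S t t = cst n + sc m' T"
    using cent[OF self[of t]] unfolding spn_2 T_def by blast
  define m where "m = h * m'"
  have m: "sc m' q = sc m q + sc m q" for q
    by (simp only: m_def flip: sc_simps(4) distrib_right) (simp only: h mult_1)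
  have "S t y - sc m (j y) \<in> spn [1, T]" for y
    unfolding T_def
  proof (rule cent)
    have "cm (S t y - sc m (j y)) (j t) + cm (S t y - sc m (j y)) (j t) = 0 + 0"
      using cm_slice[of t y] unfolding tt m T_def by (simp add: scalg)
    then show "cm (S t y - sc m (j y)) (j t) = 0" by (rule double_cancel)
  qed
  then have "\<forall>y. \<exists>b a. S t y - sc m (j y) = cst b + sc a T" unfolding spn_2 by blast
  then obtain \<beta> \<alpha> where ab: "\<And>y. S t y - sc m (j y) = cst (\<beta> y) + sc (\<alpha> y) T" by metis
  have slice: "S t y = sc 0 (j t * j y + j y * j t) + sc m (j y) + sc (\<alpha> y) (j t) + cst (\<beta> y)" for y
    using ab[of y] by (simp add: T_def algebra_simps)
  define R where "R x y = S x y - sc 0 (j x * j y + j y * j x) - sc (\<alpha> x) (j y) - sc (\<alpha> y) (j x)"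
    for x y
  note Rsym = remainder_cyc(1)[OF R_def] and Rcyc = remainder_cyc(2)[OF R_def]
  have "cm (R x w) (j t) = 0" for x w
    by (rule remainder_slice(2)[OF nc slice R_def])
  then have "\<forall>x y. \<exists>b a. R x y = cst b + sc a T" using cent unfolding spn_2 T_def by blast
  then obtain \<nu> \<sigma> where R: "\<And>x y. R x y = cst (\<nu> x y) + sc (\<sigma> x y) T" by metis
  have \<sigma>sym: "\<sigma> x y = \<sigma> y x" for x y
  proof -
    have "sc (\<sigma> x y - \<sigma> y x) T + cst (\<nu> x y - \<nu> y x) = R x y - R y x"
      unfolding R by (simp add: sc_simps)
    then have "sc (\<sigma> x y - \<sigma> y x) T + cst (\<nu> x y - \<nu> y x) = 0" using Rsym[of x y] by simp
    then show ?thesis using indep_1[OF nc[folded T_def]] by fastforce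
  qed
  have \<sigma>cyc: "sc (\<sigma> x w) (cm T (j y)) + sc (\<sigma> w y) (cm T (j x)) + sc (\<sigma> y x) (cm T (j w)) = 0"
    for x w y
    using Rcyc[of x w y] unfolding R by (simp add: scalg)
  \<comment> \<open>If \<sigma>(x,x) is invertible, the cyclic identity puts all commutators [t,w]
    on the line Cu with u = [t,x]. Then [t,z]yu = uy[t,z] for all z, which forces uy into C + Ct. So
    uy commutes with t for every y, whence u[t,y] = 0 and u = 0.\<close>
  have diag: "\<sigma> x x = 0" for x
  proof (rule ccontr)
    assume "\<sigma> x x \<noteq> 0"
    then obtain d where d: "d * \<sigma> x x = 1" using center_inverse by blast
    define u where "u = cm T (j x)"
    have "\<exists>c. cm T (j w) = sc c u" for w
    proof -
      have "(sc (\<sigma> w x) u + sc (\<sigma> w x) u) + sc (\<sigma> x x) (cm T (j w)) = 0"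
        using \<sigma>cyc[of x w x] \<sigma>sym[of x w] by (simp add: u_def add_ac)
      then have "- (sc (\<sigma> w x) u + sc (\<sigma> w x) u) = sc (\<sigma> x x) (cm T (j w))"
        by (rule minus_unique)
      then have "sc (\<sigma> x x) (cm T (j w)) = - (sc (\<sigma> w x) u + sc (\<sigma> w x) u)" ..
      then have "sc d (sc (\<sigma> x x) (cm T (j w))) = sc (- (d * \<sigma> w x + d * \<sigma> w x)) u"
        by (simp only: sc_simps)
      then show ?thesis unfolding sc_simps(7) d sc_triv by blast
    qed
    then obtain c where c: "\<And>w. cm T (j w) = sc (c w) u" by metis
    have uy: "u * j y \<in> spn [1, T]" for y
    proof (rule ccontr)
      assume nin: "u * j y \<notin> spn [1, T]"
      obtain a where a: "\<And>b b1 ks. length ks = length [1, T] \<Longrightarrow>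
        (\<And>z. u * j y * j z * b + lin [1, T] ks (j z) + - (u * j y * T) * j z * b1 = 0) \<Longrightarrow> b = sc a b1"
        using martindale_1[OF nin, of "- (u * j y * T)"] by blast
      have "T = sc a 1"
      proof (rule a[of "[- T * (j y * u), j y * u]"])
        fix z
        have "cm T (j z) * j y * u - u * j y * cm T (j z) = 0" unfolding c by (simp add: scalg)
        then show "u * j y * j z * T + lin [1, T] [- T * (j y * u), j y * u] (j z)
            + - (u * j y * T) * j z * 1 = 0"
          by (simp add: algebra_simps)
      qed simp
      then show False using nc unfolding T_def spn_1 by blast
    qed
    have Tuy: "T * (u * j y) = u * j y * T" for y
    proof -
      obtain a b where "u * j y = sc a 1 + sc b T" using uy unfolding spn_2 by blast
      then show ?thesis by (simp add: scalg)
    qed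
    have "u * cm (j t) (j y) = 0" for y
    proof -
      have "u * cm (j t) (j y) = (T * (u * j y) - u * j y * T) - (T * (u * j 1) - u * j 1 * T) * j y"
        by (simp add: T_def algebra_simps)
      then show ?thesis unfolding Tuy by simp
    qed
    then have "u = 0" by (rule noncentral_kill[OF nc])
    then have "1 * cm (j t) (j y) = 0" for y using c[of y] by (simp add: T_def)
    then have "(1::'q) = 0" by (rule noncentral_kill[OF nc])
    then show False by simp
  qed
  have z: "\<sigma> x w = 0" if "cm T (j x) \<noteq> 0" for x w
  proof -
    have "sc (\<sigma> x w) (cm T (j x)) + sc (\<sigma> x w) (cm T (j x)) = 0 + 0"
      using \<sigma>cyc[of x w x] \<sigma>sym[of x w] diag[of x] by simp
    then have "sc (\<sigma> x w) (cm T (j x)) = 0" by (rule double_cancel)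
    then show ?thesis using sc_eq_0 that by blast
  qed
  have "\<sigma> x w = 0" for x w
  proof (cases "cm T (j x) = 0 \<and> cm T (j w) = 0")
    case True
    obtain y where y: "1 * cm (j t) (j y) \<noteq> 0" using noncentral_kill[OF nc, of 1] by auto
    have "sc (\<sigma> x w) (cm T (j y)) = 0"
      using \<sigma>cyc[of x w y] True by simp
    then show ?thesis using sc_eq_0 y unfolding T_def by fastforce
  next
    case False
    then show ?thesis using z[of x w] z[of w x] \<sigma>sym[of x w] by auto
  qed
  then have "R x y = cst (\<nu> x y)" for x y unfolding R by simp
  then have "S x y = sc (\<alpha> x) (j y) + sc (\<alpha> y) (j x) + cst (\<nu> x y)" for x y
    unfolding R_def by (simp add: algebra_simps)
  then show thesis by (rule that)
qed

end

context quotients_half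
begin

text \<open>The scalar m is the trace of t. Add the quadratic equations of t + z and t - z:
  independence of 1, t, z shows that their traces have sum 2m. Subtracting the equations then gives
  the claim. For z in C + Ct it is immediate.\<close>

lemma quadratic_linearized:
  assumes quad: "\<And>x. j x * j x \<in> spn [1, j x]" and nc: "j t \<notin> spn [1]"
  obtains m where "\<And>z. j t * j z + j z * j t - sc m (j z) \<in> spn [1, j t]"
proof -
  define T where "T = j t"
  have "\<exists>m n. T * T = sc m T + cst n" using quad[of t] unfolding spn_2 T_def by (metis add.commute)
  then obtain m n where t2: "T * T = sc m T + cst n" by blast
  have "T * j z + j z * T - sc m (j z) \<in> spn [1, T]" for z
  proof (cases "j z \<in> spn [1, T]")
    case True
    then obtain a b where "j z = cst a + sc b T" unfolding spn_2 by blast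
    then have "T * j z + j z * T - sc m (j z) =
      (cst (b * n) + cst (b * n) - cst (m * a)) + (sc a T + sc a T + sc (b * m) T)"
      by (simp add: scalg t2)
    also have "\<dots> = cst (b * n + b * n - m * a) + sc (a + a + b * m) T"
      by (simp only: sc_simps)
    finally show ?thesis unfolding spn_2 by blast
  next
    case False
    define Z where "Z = j z"
    have "\<exists>m n. q * q = sc m q + cst n" if "q = j x" for q x
      using quad[of x] unfolding spn_2 that by (metis add.commute)
    then obtain m1 n1 m2 n2 m3 n3 where
      z2: "Z * Z = sc m1 Z + cst n1" and
      p2: "(T + Z) * (T + Z) = sc m2 (T + Z) + cst n2" and
      d2: "(T - Z) * (T - Z) = sc m3 (T - Z) + cst n3"
      unfolding T_def Z_def by (metis j_add j_diff)
    have "sc (m2 - m3 - (m1 + m1)) Z + sc (m2 + m3 - (m + m)) T + cst (n2 + n3 - (n + n) - (n1 + n1))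
      = ((T + Z) * (T + Z) + (T - Z) * (T - Z)) - (T * T + T * T) - (Z * Z + Z * Z)"
      unfolding z2 p2 d2 t2 sc_simps by (simp add: algebra_simps)
    also have "\<dots> = 0" by (simp add: algebra_simps)
    finally have rel: "sc (m2 - m3 - (m1 + m1)) Z + sc (m2 + m3 - (m + m)) T
      + cst (n2 + n3 - (n + n) - (n1 + n1)) = 0" .
    have 1: "m2 - m3 - (m1 + m1) = 0"
    proof (rule ccontr)
      assume "m2 - m3 - (m1 + m1) \<noteq> 0"
      then obtain d where d: "d * (m2 - m3 - (m1 + m1)) = 1" using center_inverse by blast
      have "Z = sc d (sc (m2 - m3 - (m1 + m1)) Z)" by (simp only: sc_simps(7) d sc_triv)
      also have "\<dots> = sc d (sc (m2 - m3 - (m1 + m1)) Z + sc (m2 + m3 - (m + m)) T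
      + cst (n2 + n3 - (n + n) - (n1 + n1))) + (cst (- (d * (n2 + n3 - (n + n) - (n1 + n1))))
        + sc (- (d * (m2 + m3 - (m + m)))) T)" by (simp only: sc_simps(1) sc_simps(6,7)) simp
      finally have "Z \<in> spn [1, T]" unfolding rel sc_triv add_0 spn_2 by blast
      then show False using False by (simp add: Z_def)
    qed
    have 2: "m2 + m3 - (m + m) = 0"
      using rel unfolding 1 sc_triv add_0
      by (rule conjunct1[OF indep_1[OF nc[folded T_def]]])
    have "(T * Z + Z * T - sc m Z) + (T * Z + Z * T - sc m Z) =
      ((T + Z) * (T + Z) - (T - Z) * (T - Z)) - sc (m + m) Z"
      unfolding sc_simps by (simp add: algebra_simps)
    also have "\<dots> = sc (m2 + m3 - (m + m)) Z + (sc (m2 - m3) T + cst (n2 - n3))"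
      unfolding p2 d2 sc_simps by (simp add: algebra_simps)
    also have "\<dots> = sc (m2 - m3) T + cst (n2 - n3)" unfolding 2 by simp
    finally have eq: "(T * Z + Z * T - sc m Z) + (T * Z + Z * T - sc m Z) = \<dots>" .
    obtain h :: "'q center" where h: "h + h = 1" using half by blast
    have "T * Z + Z * T - sc m Z = sc h ((T * Z + Z * T - sc m Z) + (T * Z + Z * T - sc m Z))"
      by (simp only: sc_simps(1)[of h "T * Z + Z * T - sc m Z"] sc_simps(4)[symmetric] h sc_triv)
    also have "\<dots> = cst (h * (n2 - n3)) + sc (h * (m2 - m3)) T"
      unfolding eq by (simp only: sc_simps(1,7) add.commute)
    finally show ?thesis unfolding spn_2 Z_def by blast
  qed
  then show thesis using that unfolding T_def by blast
qed

text \<open>As q commutes with t, it commutes with tz + zt - mz, which lies in C + Ct. In this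
  identity in z the coefficient q has the factor t and the recorded coefficient qt - mq has the
  factor 1; for q outside C + Ct this would make t central.\<close>

lemma quadratic_centralizer:
  assumes quad: "\<And>x. j x * j x \<in> spn [1, j x]" and nc: "j t \<notin> spn [1]"
    and comm: "cm q (j t) = 0"
  shows "q \<in> spn [1, j t]"
proof (rule ccontr)
  assume nin: "q \<notin> spn [1, j t]"
  define T where "T = j t"
  have qT: "q * T = T * q" using comm by (simp add: T_def)
  then have qT': "q * (T * y) = T * (q * y)" for y by (metis mult.assoc)
  obtain m where m: "\<And>z. T * j z + j z * T - sc m (j z) \<in> spn [1, T]"
    using quadratic_linearized[OF quad nc] unfolding T_def by blast
  have rel: "q * (T * j z + j z * T - sc m (j z)) = (T * j z + j z * T - sc m (j z)) * q" for z
  proof -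
    obtain a b where "T * j z + j z * T - sc m (j z) = cst a + sc b T"
      using m[of z] unfolding spn_2 by blast
    then show ?thesis using qT by (simp add: scalg)
  qed
  obtain a where a: "\<And>b b1 ks. length ks = length [1, T] \<Longrightarrow>
    (\<And>z. q * j z * b + lin [1, T] ks (j z) + (q * T - sc m q) * j z * b1 = 0) \<Longrightarrow> b = sc a b1"
    using martindale_1[OF nin[folded T_def], of "q * T - sc m q"] by blast
  have "T = sc a 1"
  proof (rule a[of "[sc m q - T * q, - q]"])
    fix z
    show "q * j z * T + lin [1, T] [sc m q - T * q, - q] (j z) + (q * T - sc m q) * j z * 1 = 0"
      using rel[of z] by (simp add: scalg qT qT')
  qed simp
  then show False using nc unfolding T_def spn_1 by blast
qed

end

section \<open>Lie isomorphisms\<close>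

context quotients
begin

lemma sc_cancel_spn:
  assumes "sc a x \<in> spn K" "(a :: 'q center) \<noteq> 0"
  shows "x \<in> spn K"
proof -
  obtain d where "d * a = 1" using center_inverse assms(2) by blast
  then have "x = sc d (sc a x)" by (simp only: sc_simps(7) sc_triv)
  then show ?thesis using spn_sc[OF assms(1), of d] by simp
qed

lemma center_domain: "(a :: 'q center) * b = 0 \<Longrightarrow> a = 0 \<or> b = 0"
proof -
  assume "a * b = 0"
  then have "sc a (cst b) = 0" by (simp only: sc_simps(7) sc_triv)
  then have "a = 0 \<or> cst b = cst 0" using sc_eq_0[of a "cst b"] by (simp only: sc_triv)
  then show ?thesis by (simp only: cst_cancel)
qed

lemma exists_noncommuting:
  assumes "j t \<notin> spn [1]"
  obtains z where "cm (j t) (j z) \<noteq> 0"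
proof -
  have "\<exists>z. cm (j t) (j z) \<noteq> 0"
  proof (rule ccontr)
    assume "\<nexists>z. cm (j t) (j z) \<noteq> 0"
    then have "1 * cm (j t) (j x) = 0" for x by simp
    then have "(1::'q) = 0" by (rule noncentral_kill[OF assms])
    then show False by simp
  qed
  then show thesis using that by blast
qed

lemma not_spanned_by_two:
  assumes "j t \<notin> spn [1]"
  obtains z where "j z \<notin> spn [1, q]"
proof -
  have "\<exists>z. j z \<notin> spn [1, q]"
  proof (rule ccontr)
    assume "\<nexists>z. j z \<notin> spn [1, q]"
    then have *: "\<exists>a b. j z = cst a + sc b q" for z unfolding spn_2 by blast
    obtain z where z: "cm (j t) (j z) \<noteq> 0" using exists_noncommuting[OF assms] .
    obtain a b c d where "j t = cst a + sc b q" "j z = cst c + sc d q" using * by metis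
    then have "cm (j t) (j z) = 0" by (simp add: scalg)
    then show False using z by simp
  qed
  then show thesis using that by blast
qed

end

lemma (in quotients_half) commuting_trace_mult:
  "commuting_trace j (\<lambda>x y. j x * j y + j y * j x)"
  by unfold_locales (simp_all add: algebra_simps)

abbreviation hom_or_neg_antihom :: "('b::ring_1 \<Rightarrow> 'q::ring_1) \<Rightarrow> bool" where
  "hom_or_neg_antihom \<theta> \<equiv>
    (\<forall>x y. \<theta> (x * y) = \<theta> x * \<theta> y) \<or> (\<forall>x y. \<theta> (x * y) = - (\<theta> y * \<theta> x))"

locale lie_iso = quotients_half j for j :: "'a::ring_1 \<Rightarrow> 'q::ring_1" +
  fixes \<phi> :: "'b::ring_1 \<Rightarrow> 'a"
  assumes bij: "bij \<phi>"
    and add: "\<phi> (x + y) = \<phi> x + \<phi> y"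
    and bracket: "\<phi> (x * y - y * x) = \<phi> x * \<phi> y - \<phi> y * \<phi> x"
begin

definition \<Phi> :: "'b \<Rightarrow> 'q" where "\<Phi> x = j (\<phi> x)"

lemma \<Phi>_add: "\<Phi> (x + y) = \<Phi> x + \<Phi> y"
  and \<Phi>_bracket: "\<Phi> (x * y - y * x) = cm (\<Phi> x) (\<Phi> y)"
  by (simp_all add: \<Phi>_def add bracket)

lemma \<Phi>_surj: obtains b where "\<Phi> b = j x"
  using bij unfolding \<Phi>_def by (metis bij_pointE)

text \<open>This is the Jordan product of B carried over to A. In every associative ring the
  commutators [xy + yx, z] have cyclic sum 0, and \<phi> preserves commutators.\<close>

lemma commuting_trace_transport:
  "commuting_trace j (\<lambda>x y. \<Phi> (inv \<phi> x * inv \<phi> y + inv \<phi> y * inv \<phi> x))"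
proof
  have inv: "j x = \<Phi> (inv \<phi> x)" for x
    using bij by (simp add: \<Phi>_def bij_is_surj surj_f_inv_f)
  show "\<Phi> (inv \<phi> x * inv \<phi> y + inv \<phi> y * inv \<phi> x) = \<Phi> (inv \<phi> y * inv \<phi> x + inv \<phi> x * inv \<phi> y)"
    for x y by (simp add: add.commute)
  show "cm (\<Phi> (inv \<phi> x * inv \<phi> x + inv \<phi> x * inv \<phi> x)) (j x) = 0" for x
  proof -
    have "cm (\<Phi> (inv \<phi> x * inv \<phi> x + inv \<phi> x * inv \<phi> x)) (j x) = \<Phi> 0"
      unfolding inv[of x] \<Phi>_bracket[symmetric] by (simp add: algebra_simps)
    also have "\<Phi> 0 = 0" using \<Phi>_add[of 0 0] by simp
    finally show ?thesis .
  qed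
  show "cm (\<Phi> (inv \<phi> x * inv \<phi> y + inv \<phi> y * inv \<phi> x)) (j z)
    + cm (\<Phi> (inv \<phi> y * inv \<phi> z + inv \<phi> z * inv \<phi> y)) (j x)
    + cm (\<Phi> (inv \<phi> z * inv \<phi> x + inv \<phi> x * inv \<phi> z)) (j y) = 0" for x y z
  proof -
    have "cm (\<Phi> (inv \<phi> x * inv \<phi> y + inv \<phi> y * inv \<phi> x)) (j z)
      + cm (\<Phi> (inv \<phi> y * inv \<phi> z + inv \<phi> z * inv \<phi> y)) (j x)
      + cm (\<Phi> (inv \<phi> z * inv \<phi> x + inv \<phi> x * inv \<phi> z)) (j y) = \<Phi> 0"
      unfolding inv[of x] inv[of y] inv[of z] \<Phi>_bracket[symmetric] \<Phi>_add[symmetric]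
      by (simp add: algebra_simps)
    also have "\<Phi> 0 = 0" using \<Phi>_add[of 0 0] by simp
    finally show ?thesis .
  qed
qed

text \<open>The product of B is half the sum of Jordan product and commutator. The former is a
  commuting trace with leading coefficient l, the latter is carried over unchanged, so p = (l + 1)/2
  and q = (l - 1)/2. The disjunction on q records that l = 1 whenever no element of degree above two
  is at hand.\<close>

lemma product_form:
  assumes nc: "j t \<notin> spn [1]"
  obtains p q a n where
    "p - q = 1" "q = 0 \<or> (\<exists>t. j t * j t \<notin> spn [1, j t])"
    "\<And>x y. \<Phi> (x * y) = sc p (\<Phi> x * \<Phi> y) + sc q (\<Phi> y * \<Phi> x) + sc (a x) (\<Phi> y) + sc (a y) (\<Phi> x)
       + cst (n x y)"
proof -
  interpret S: commuting_trace j "\<lambda>x y. \<Phi> (inv \<phi> x * inv \<phi> y + inv \<phi> y * inv \<phi> x)"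
    by (rule commuting_trace_transport)
  interpret M: commuting_trace j "\<lambda>x y. j x * j y + j y * j x"
    by (rule commuting_trace_mult)
  have "\<exists>l \<alpha> \<nu>. (\<forall>x y. \<Phi> (inv \<phi> x * inv \<phi> y + inv \<phi> y * inv \<phi> x) =
      sc l (j x * j y + j y * j x) + sc (\<alpha> x) (j y) + sc (\<alpha> y) (j x) + cst (\<nu> x y)) \<and>
      (l = 1 \<or> (\<exists>t. j t * j t \<notin> spn [1, j t]))"
  proof (cases "\<exists>t. j t * j t \<notin> spn [1, j t]")
    case True
    then obtain t where "j t * j t \<notin> spn [1, j t]" by blast
    from S.commuting_trace_form[OF this] True show ?thesis by metis
  next
    case False
    note cent = quadratic_centralizer[OF _ nc]
    obtain \<alpha> \<nu> where 1: "\<And>x y. \<Phi> (inv \<phi> x * inv \<phi> y + inv \<phi> y * inv \<phi> x) =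
      sc (\<alpha> x) (j y) + sc (\<alpha> y) (j x) + cst (\<nu> x y)"
      using S.small_centralizer_form[OF nc cent] False by blast
    \<comment> \<open>The Jordan product of A has the same form without a quadratic term.
      Subtracting it leaves l at disposal, and l = 1 is the choice with q = 0.\<close>
    obtain \<beta> \<mu> where 2: "\<And>x y. j x * j y + j y * j x =
      sc (\<beta> x) (j y) + sc (\<beta> y) (j x) + cst (\<mu> x y)"
      using M.small_centralizer_form[OF nc cent] False by blast
    have "\<Phi> (inv \<phi> x * inv \<phi> y + inv \<phi> y * inv \<phi> x) =
      sc 1 (j x * j y + j y * j x) + sc (\<alpha> x - \<beta> x) (j y) + sc (\<alpha> y - \<beta> y) (j x)
      + cst (\<nu> x y - \<mu> x y)" for x y
      unfolding 1 2 by (simp add: scalg)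
    then show ?thesis
      by (intro exI[of _ 1] exI[of _ "\<lambda>x. \<alpha> x - \<beta> x"] exI[of _ "\<lambda>x y. \<nu> x y - \<mu> x y"]) blast
  qed
  then obtain l \<alpha> \<nu> where form: "\<And>x y. \<Phi> (inv \<phi> x * inv \<phi> y + inv \<phi> y * inv \<phi> x) =
      sc l (j x * j y + j y * j x) + sc (\<alpha> x) (j y) + sc (\<alpha> y) (j x) + cst (\<nu> x y)"
      and l: "l = 1 \<or> (\<exists>t. j t * j t \<notin> spn [1, j t])" by blast
  obtain h :: "'q center" where h: "h + h = 1" using half by blast
  have hh: "sc h z + sc h z = z" for z by (simp only: sc_simps(4)[symmetric] h sc_triv)
  define p where "p = h * l + h"
  define q where "q = h * l - h"
  have "p - q = 1" by (simp add: p_def q_def h)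
  moreover have "q = 0 \<or> (\<exists>t. j t * j t \<notin> spn [1, j t])" using l by (auto simp: q_def)
  moreover have "\<Phi> (x * y) = sc p (\<Phi> x * \<Phi> y) + sc q (\<Phi> y * \<Phi> x) + sc (h * \<alpha> (\<phi> x)) (\<Phi> y)
    + sc (h * \<alpha> (\<phi> y)) (\<Phi> x) + cst (h * \<nu> (\<phi> x) (\<phi> y))" for x y
  proof -
    have inv: "inv \<phi> (\<phi> z) = z" for z using bij by (simp add: bij_is_inj)
    have 1: "\<Phi> (x * y) + \<Phi> (y * x) = sc l (\<Phi> x * \<Phi> y + \<Phi> y * \<Phi> x)
       + sc (\<alpha> (\<phi> x)) (\<Phi> y) + sc (\<alpha> (\<phi> y)) (\<Phi> x) + cst (\<nu> (\<phi> x) (\<phi> y))"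
      using form[of "\<phi> x" "\<phi> y"] by (simp add: inv \<Phi>_add flip: \<Phi>_def)
    have "\<Phi> (x * y - y * x) + \<Phi> (y * x) = \<Phi> (x * y)" by (simp flip: \<Phi>_add)
    then have 2: "\<Phi> (x * y) - \<Phi> (y * x) = \<Phi> x * \<Phi> y - \<Phi> y * \<Phi> x"
      unfolding \<Phi>_bracket by (simp add: algebra_simps)
    have "\<Phi> (x * y) = sc h ((\<Phi> (x * y) + \<Phi> (y * x)) + (\<Phi> (x * y) - \<Phi> (y * x)))"
      using hh[of "\<Phi> (x * y)"] by (simp add: sc_simps)
    then show ?thesis unfolding 1 2 p_def q_def by (simp add: scalg)
  qed
  ultimately show thesis by (rule that)
qed

text \<open>Expand the image of xyz along (xy)z and along x(yz). Of the cubic terms only the double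
  commutator survives; \<open>\<epsilon>\<close> collects the coefficients of the linear
  ones.\<close>

lemma associativity_defect:
  assumes prod: "\<And>x y. \<Phi> (x * y) = sc p (\<Phi> x * \<Phi> y) + sc q (\<Phi> y * \<Phi> x) + sc (a x) (\<Phi> y)
       + sc (a y) (\<Phi> x) + cst (n x y)"
    and \<epsilon>: "\<And>x y. \<epsilon> x y = (p + q) * n x y + a (x * y) - a x * a y"
  obtains k where "sc (p * q) (cm (\<Phi> y) (cm (\<Phi> x) (\<Phi> z))) + sc (\<epsilon> x y) (\<Phi> z) - sc (\<epsilon> y z) (\<Phi> x)
    = cst k"
proof -
  have 1: "\<Phi> (x * y * z) = sc p (\<Phi> (x * y) * \<Phi> z) + sc q (\<Phi> z * \<Phi> (x * y)) + sc (a (x * y)) (\<Phi> z)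
       + sc (a z) (\<Phi> (x * y)) + cst (n (x * y) z)" by (rule prod)
  have 2: "\<Phi> (x * y * z) = sc p (\<Phi> x * \<Phi> (y * z)) + sc q (\<Phi> (y * z) * \<Phi> x) + sc (a x) (\<Phi> (y * z))
       + sc (a (y * z)) (\<Phi> x) + cst (n x (y * z))" unfolding mult.assoc by (rule prod)
  have "sc (p * q) (cm (\<Phi> y) (cm (\<Phi> x) (\<Phi> z))) + sc (\<epsilon> x y) (\<Phi> z) - sc (\<epsilon> y z) (\<Phi> x) =
    (sc p (\<Phi> (x * y) * \<Phi> z) + sc q (\<Phi> z * \<Phi> (x * y)) + sc (a (x * y)) (\<Phi> z)
       + sc (a z) (\<Phi> (x * y)) + cst (n (x * y) z))
    - (sc p (\<Phi> x * \<Phi> (y * z)) + sc q (\<Phi> (y * z) * \<Phi> x) + sc (a x) (\<Phi> (y * z))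
       + sc (a (y * z)) (\<Phi> x) + cst (n x (y * z)))
    + cst (a x * n y z + n x (y * z) - a z * n x y - n (x * y) z)"
    unfolding prod[of x y] prod[of y z] \<epsilon> by (simp add: scalg)
  then show thesis using that unfolding 1[symmetric] 2[symmetric] by simp
qed

text \<open>With t for x and t^2 for z the double commutator disappears, and the degree of t gives
  \<epsilon>(t,y) = 0. Then pq[y,[t,z]] lies in C + Ct and commutes with t, so [t,[y,[t,z]]] = 0 if
  pq is nonzero. As an identity in y this puts [t,z] into C + Ct; replacing z by zt lowers it to C
  and then to 0, contradicting that t is not central.\<close>

lemma product_one_sided:
  assumes prod: "\<And>x y. \<Phi> (x * y) = sc p (\<Phi> x * \<Phi> y) + sc q (\<Phi> y * \<Phi> x) + sc (a x) (\<Phi> y)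
       + sc (a y) (\<Phi> x) + cst (n x y)"
    and deg: "j t * j t \<notin> spn [1, j t]"
  shows "p * q = 0"
proof (rule ccontr)
  assume nz: "p * q \<noteq> 0"
  define T where "T = j t"
  note degT = deg[folded T_def]
  have nc: "T \<notin> spn [1]"
    unfolding T_def by (rule not_quadratic_noncentral[OF deg])
  define \<epsilon> where "\<epsilon> x y = (p + q) * n x y + a (x * y) - a x * a y" for x y
  note defect = associativity_defect[OF prod \<epsilon>_def]
  obtain b where b: "\<Phi> b = T" unfolding T_def by (rule \<Phi>_surj)
  obtain b2 where b2: "\<Phi> b2 = T * T" unfolding T_def j_mult[symmetric] by (rule \<Phi>_surj)
  have \<epsilon>0: "\<epsilon> b y = 0" for y
  proof (rule ccontr)
    assume ne: "\<epsilon> b y \<noteq> 0"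
    obtain k where "sc (p * q) (cm (\<Phi> y) (cm (\<Phi> b) (\<Phi> b2))) + sc (\<epsilon> b y) (\<Phi> b2)
      - sc (\<epsilon> y b2) (\<Phi> b) = cst k" by (rule defect)
    then have "sc (\<epsilon> b y) (T * T) = cst k + sc (\<epsilon> y b2) T"
      unfolding b b2 by (simp add: mult.assoc algebra_simps)
    then have "sc (\<epsilon> b y) (T * T) \<in> spn [1, T]" unfolding spn_2 by blast
    then show False using sc_cancel_spn ne degT by blast
  qed
  have gpi: "cm T (cm (j y) (cm T (j z))) = 0" for y z
  proof -
    obtain y' z' where y': "\<Phi> y' = j y" and z': "\<Phi> z' = j z" using \<Phi>_surj by metis
    obtain k where "sc (p * q) (cm (\<Phi> y') (cm (\<Phi> b) (\<Phi> z'))) + sc (\<epsilon> b y') (\<Phi> z')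
      - sc (\<epsilon> y' z') (\<Phi> b) = cst k" by (rule defect)
    then have "sc (p * q) (cm (j y) (cm T (j z))) = cst k + sc (\<epsilon> y' z') T"
      unfolding b y' z' \<epsilon>0 by (simp add: algebra_simps)
    then have "cm T (sc (p * q) (cm (j y) (cm T (j z)))) = 0" by (simp only:) (simp add: scalg)
    then have "sc (p * q) (cm T (cm (j y) (cm T (j z)))) = 0" by (simp add: scalg)
    then show ?thesis using sc_eq_0 nz by blast
  qed
  have mem: "cm T (j z) \<in> spn [1, T]" for z
  proof (rule ccontr)
    define u where "u = cm T (j z)"
    assume "cm T (j z) \<notin> spn [1, T]"
    then have nin: "u \<notin> spn [1, T]" unfolding u_def .
    obtain c where c: "\<And>b b1 ks. length ks = length [1, T] \<Longrightarrow>
      (\<And>y. u * j y * b + lin [1, T] ks (j y) + - (T * u) * j y * b1 = 0) \<Longrightarrow> b = sc c b1"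
      using martindale_1[OF nin, of "- (T * u)"] by blast
    have "T = sc c 1"
    proof (rule c[of "[- (u * T), u]"])
      show "u * j y * T + lin [1, T] [- (u * T), u] (j y) + - (T * u) * j y * 1 = 0" for y
        using gpi[of y z] unfolding u_def[symmetric] by (simp add: algebra_simps)
    qed simp
    then show False using nc unfolding spn_1 by blast
  qed
  have const: "\<exists>c. cm T (j z) = cst c" for z
  proof -
    obtain c d where cd: "cm T (j z) = cst c + sc d T" using mem[of z] unfolding spn_2 by blast
    obtain c' d' where cd': "cm T (j (z * t)) = cst c' + sc d' T"
      using mem[of "z * t"] unfolding spn_2 by blast
    have "cm T (j (z * t)) = cm T (j z) * T" by (simp add: algebra_simps flip: T_def)
    then have "sc d (T * T) = cst c' + sc (d' - c) T" unfolding cd cd' by (simp add: scalg)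
    then have "sc d (T * T) \<in> spn [1, T]" unfolding spn_2 by blast
    then have "d = 0" using sc_cancel_spn degT by blast
    then show ?thesis using cd by auto
  qed
  have "1 * cm (j t) (j z) = 0" for z
  proof -
    obtain c where c: "cm T (j z) = cst c" using const by blast
    obtain c' where c': "cm T (j (z * t)) = cst c'" using const by blast
    have "cm T (j (z * t)) = cm T (j z) * T" by (simp add: algebra_simps flip: T_def)
    then have "sc c T + cst (- c') = 0" unfolding c c' by (simp add: sc_simps)
    then have "c = 0" using indep_1[OF nc] by blast
    then show ?thesis using c by (simp add: T_def)
  qed
  then have "(1::'q) = 0" by (rule noncentral_kill[OF nc[unfolded T_def]])
  then show False by simp
qed

text \<open>The values of \<tau> were chosen one by one. Comparing \<theta>((x + y)z) with
  \<theta>(xz) + \<theta>(yz) shows that the defect d of additivity makes d\<theta>(z) scalar for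
  all z, and a noncentral value of \<theta> forces d = 0. The second part is F-linearity without F:
  r stands for the image of a field element in B.\<close>

lemma linear_correction:
  assumes nc: "j t \<notin> spn [1]"
    and \<theta>: "\<And>x. \<theta> x = \<Phi> x - cst (\<tau> x)"
    and mult: "hom_or_neg_antihom \<theta>"
  shows "\<tau> (x + y) = \<tau> x + \<tau> y"
    and "(\<And>y. \<Phi> (r * y) = sc c (\<Phi> y)) \<Longrightarrow> \<tau> (r * x) = c * \<tau> x"
proof -
  have zero: "d = 0" if d: "\<And>z. \<exists>k. sc d (\<theta> z) = cst k" for d
  proof (rule ccontr)
    assume "d \<noteq> 0"
    obtain b where b: "\<Phi> b = j t" by (rule \<Phi>_surj)
    obtain k where "sc d (\<theta> b) = cst k" using d by blast
    then have "sc d (j t) = sc (k + d * \<tau> b) 1" unfolding \<theta> b by (simp add: sc_simps algebra_simps)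
    then have "sc d (j t) \<in> spn [1]" unfolding spn_1 by blast
    then show False using sc_cancel_spn nc \<open>d \<noteq> 0\<close> by blast
  qed
  have \<theta>_add: "\<theta> (x + y) = \<theta> x + \<theta> y + cst (\<tau> x + \<tau> y - \<tau> (x + y))" for x y
    unfolding \<theta> \<Phi>_add by (simp add: sc_simps)
  have "\<tau> x + \<tau> y - \<tau> (x + y) = 0"
  proof (rule zero)
    fix z
    define d where "d = \<tau> x + \<tau> y - \<tau> (x + y)"
    define d' where "d' = \<tau> (x * z) + \<tau> (y * z) - \<tau> (x * z + y * z)"
    have "\<theta> ((x + y) * z) = \<theta> (x * z) + \<theta> (y * z) + cst d'"
      unfolding distrib_right d'_def by (rule \<theta>_add)
    moreover have "\<theta> (x + y) = \<theta> x + \<theta> y + cst d" unfolding d_def by (rule \<theta>_add)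
    ultimately have "sc d (\<theta> z) = cst d' \<or> sc d (\<theta> z) = cst (- d')"
      using mult
    proof (elim disjE)
      assume m: "\<forall>x y. \<theta> (x * y) = \<theta> x * \<theta> y" and 1: "\<theta> ((x + y) * z) = \<theta> (x * z) + \<theta> (y * z) + cst d'"
        and 2: "\<theta> (x + y) = \<theta> x + \<theta> y + cst d"
      have "(\<theta> x + \<theta> y + cst d) * \<theta> z = \<theta> x * \<theta> z + \<theta> y * \<theta> z + cst d'"
        using 1 m unfolding 2[symmetric] by metis
      then show ?thesis by (simp add: scalg)
    next
      assume m: "\<forall>x y. \<theta> (x * y) = - (\<theta> y * \<theta> x)" and 1: "\<theta> ((x + y) * z) = \<theta> (x * z) + \<theta> (y * z) + cst d'"
        and 2: "\<theta> (x + y) = \<theta> x + \<theta> y + cst d"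
      have "- (\<theta> z * (\<theta> x + \<theta> y + cst d)) = - (\<theta> z * \<theta> x) + - (\<theta> z * \<theta> y) + cst d'"
        using 1 m unfolding 2[symmetric] by metis
      then have "- sc d (\<theta> z) = cst d'" by (simp add: scalg)
      then show ?thesis by (simp add: sc_simps) (metis add.inverse_inverse)
    qed
    then show "\<exists>k. sc (\<tau> x + \<tau> y - \<tau> (x + y)) (\<theta> z) = cst k" unfolding d_def by blast
  qed
  then show "\<tau> (x + y) = \<tau> x + \<tau> y" by simp
  assume r: "\<And>y. \<Phi> (r * y) = sc c (\<Phi> y)"
  have \<theta>r: "\<theta> (r * y) = sc c (\<theta> y) + cst (c * \<tau> y - \<tau> (r * y))" for y
    unfolding \<theta> r by (simp add: sc_simps)
  have "c * \<tau> x - \<tau> (r * x) = 0"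
  proof (rule zero)
    fix z
    define d where "d = c * \<tau> x - \<tau> (r * x)"
    define d' where "d' = c * \<tau> (x * z) - \<tau> (r * (x * z))"
    have 1: "\<theta> (r * x * z) = sc c (\<theta> (x * z)) + cst d'"
      unfolding d'_def mult.assoc by (rule \<theta>r)
    have 2: "\<theta> (r * x) = sc c (\<theta> x) + cst d" unfolding d_def by (rule \<theta>r)
    from mult have "sc d (\<theta> z) = cst d' \<or> sc d (\<theta> z) = cst (- d')"
    proof (elim disjE)
      assume m: "\<forall>x y. \<theta> (x * y) = \<theta> x * \<theta> y"
      have "(sc c (\<theta> x) + cst d) * \<theta> z = sc c (\<theta> x * \<theta> z) + cst d'"
        using 1 m unfolding 2[symmetric] by metis
      then show ?thesis by (simp add: scalg)
    next
      assume m: "\<forall>x y. \<theta> (x * y) = - (\<theta> y * \<theta> x)"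
      have "- (\<theta> z * (sc c (\<theta> x) + cst d)) = sc c (- (\<theta> z * \<theta> x)) + cst d'"
        using 1 m unfolding 2[symmetric] by metis
      then have "- sc d (\<theta> z) = cst d'" by (simp add: scalg)
      then show ?thesis by (simp add: sc_simps) (metis add.inverse_inverse)
    qed
    then show "\<exists>k. sc (c * \<tau> x - \<tau> (r * x)) (\<theta> z) = cst k" unfolding d_def by blast
  qed
  then show "\<tau> (r * x) = c * \<tau> x" by simp
qed

lemma noncommutative_standard_form:
  assumes nc: "j t \<notin> spn [1]"
  obtains \<tau> where
    "hom_or_neg_antihom (\<lambda>x. \<Phi> x - cst (\<tau> x))"
proof -
  obtain p q a n where pq: "p - q = 1" "q = 0 \<or> (\<exists>t. j t * j t \<notin> spn [1, j t])"
    and prod: "\<And>x y. \<Phi> (x * y) = sc p (\<Phi> x * \<Phi> y) + sc q (\<Phi> y * \<Phi> x) + sc (a x) (\<Phi> y)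
      + sc (a y) (\<Phi> x) + cst (n x y)"
    by (rule product_form[OF nc]) blast
  have 0: "p * q = 0" using pq(2) product_one_sided[OF prod] by auto
  define \<epsilon> where "\<epsilon> x y = (p + q) * n x y + a (x * y) - a x * a y" for x y
  have \<epsilon>0: "\<epsilon> x y = 0" for x y
  proof (rule ccontr)
    assume ne: "\<epsilon> x y \<noteq> 0"
    \<comment> \<open>With pq = 0 associativity says that \<epsilon>(x,y)z - \<epsilon>(y,z)x is
      scalar; a z outside C + Cx separates the two terms.\<close>
    obtain z where z: "j z \<notin> spn [1, \<Phi> x]" by (rule not_spanned_by_two[OF nc])
    obtain z' where z': "\<Phi> z' = j z" by (rule \<Phi>_surj)
    obtain k where "sc (p * q) (cm (\<Phi> y) (cm (\<Phi> x) (\<Phi> z'))) + sc (\<epsilon> x y) (\<Phi> z')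
      - sc (\<epsilon> y z') (\<Phi> x) = cst k" by (rule associativity_defect[OF prod \<epsilon>_def])
    then have "sc (\<epsilon> x y) (j z) = cst k + sc (\<epsilon> y z') (\<Phi> x)"
      unfolding 0 z' by (simp add: algebra_simps)
    then have "sc (\<epsilon> x y) (j z) \<in> spn [1, \<Phi> x]" unfolding spn_2 by blast
    then show False using sc_cancel_spn ne z by blast
  qed
  from 0 consider "p = 0" | "q = 0" using center_domain by blast
  then show thesis
  proof cases
    case 1
    then have "- (- q) = - 1" using pq(1) by simp
    then have q: "q = - 1" by simp
    have n: "n x y = a (x * y) - a x * a y" for x y
      using \<epsilon>0[of x y] unfolding \<epsilon>_def 1 q by (simp add: algebra_simps)
    have "\<Phi> (x * y) - cst (a (x * y)) = - ((\<Phi> y - cst (a y)) * (\<Phi> x - cst (a x)))" for x y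
      unfolding prod[of x y] n 1 q by (simp add: scalg)
    then show thesis using that[of a] by blast
  next
    case 2
    then have p: "p = 1" using pq(1) by simp
    have n: "n x y = a x * a y - a (x * y)" for x y
      using \<epsilon>0[of x y] unfolding \<epsilon>_def 2 p by (simp add: algebra_simps)
    have "\<Phi> (x * y) - cst (- a (x * y)) = (\<Phi> x - cst (- a x)) * (\<Phi> y - cst (- a y))" for x y
      unfolding prod[of x y] n 2 p by (simp add: scalg)
    then show thesis using that[of "\<lambda>x. - a x"] by blast
  qed
qed

theorem standard_form:
  obtains \<tau> where
    "hom_or_neg_antihom (\<lambda>x. \<Phi> x - cst (\<tau> x))"
    "\<And>x y. \<tau> (x + y) = \<tau> x + \<tau> y"
    "\<And>r c x. (\<And>y. \<Phi> (r * y) = sc c (\<Phi> y)) \<Longrightarrow> \<tau> (r * x) = c * \<tau> x"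
proof (cases "\<exists>t. j t \<notin> spn [1]")
  case True
  then obtain t where nc: "j t \<notin> spn [1]" by blast
  obtain \<tau> where \<tau>: "hom_or_neg_antihom (\<lambda>x. \<Phi> x - cst (\<tau> x))"
    by (rule noncommutative_standard_form[OF nc])
  note lin = linear_correction[OF nc refl \<tau>]
  show thesis using that[OF \<tau> lin(1) lin(2)] by blast
next
  case False
  \<comment> \<open>Here A is commutative: all of \<Phi> goes into \<tau>, and \<theta> = 0
    serves.\<close>
  then have "\<forall>x. \<exists>c. \<Phi> x = cst c" unfolding \<Phi>_def spn_1 by blast
  then obtain \<tau> where \<tau>: "\<And>x. \<Phi> x = cst (\<tau> x)" by metis
  show thesis
  proof (rule that[of \<tau>])
    show "\<tau> (x + y) = \<tau> x + \<tau> y" for x y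
      using \<Phi>_add[of x y] unfolding \<tau> sc_simps(4)[symmetric] cst_cancel .
    show "\<tau> (r * x) = c * \<tau> x" if "\<And>y. \<Phi> (r * y) = sc c (\<Phi> y)" for r c x
      using that[of x] unfolding \<tau> sc_simps(7) cst_cancel .
  qed (simp add: \<tau>)
qed

end

section \<open>Peirce decompositions\<close>

definition corner :: "'r::ring_1 \<Rightarrow> 'r \<Rightarrow> 'r \<Rightarrow> bool" where
  "corner p q x \<longleftrightarrow> p * x = x \<and> x * q = x"

text \<open>The complements f and k are parameters of their own so that exchanging (e,g) with (f,k)
  gives another instance. Each result on the corner of g thereby yields one on the corner of
  k.\<close>

locale peirce_iso = quotients_half j for j :: "'a::ring_1 \<Rightarrow> 'q::ring_1" +
  fixes e f :: 'a and g k :: "'b::ring_1" and \<phi> :: "'b \<Rightarrow> 'a"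
  assumes e_f: "e + f = 1" "e * f = 0" "f * e = 0" "e \<noteq> 0" "f \<noteq> 0"
    and g_k: "g + k = 1" "g * k = 0" "k * g = 0"
    and surj: "surj \<phi>" and add: "\<phi> (x + y) = \<phi> x + \<phi> y"
    and off_diagonal: "corner g k x \<Longrightarrow> corner e f (\<phi> x)" "corner k g x \<Longrightarrow> corner f e (\<phi> x)"
    and diagonal: "corner g g b \<Longrightarrow> e * \<phi> b * f = 0" "corner g g b \<Longrightarrow> f * \<phi> b * e = 0"
      "corner k k b \<Longrightarrow> e * \<phi> b * f = 0" "corner k k b \<Longrightarrow> f * \<phi> b * e = 0"
    and bracket: "corner g g b \<Longrightarrow> \<phi> (b * x - x * b) = cm (\<phi> b) (\<phi> x)"
      "corner k k b \<Longrightarrow> \<phi> (b * x - x * b) = cm (\<phi> b) (\<phi> x)"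
    and odd_bracket: "corner g k x \<Longrightarrow> corner k g y \<Longrightarrow> \<phi> (x * y + y * x) = \<phi> x * \<phi> y + \<phi> y * \<phi> x"
begin

lemma swap: "peirce_iso j f e k g \<phi>"
proof
  show "f + e = 1" "k + g = 1" using e_f(1) g_k(1) by (simp_all add: add.commute)
  show "\<phi> (x * y + y * x) = \<phi> x * \<phi> y + \<phi> y * \<phi> x" if "corner k g x" "corner g k y" for x y
    using odd_bracket[OF that(2,1)] by (simp add: add.commute)
qed (use e_f g_k surj add off_diagonal diagonal bracket in blast)+

definition E :: 'q where "E = j e"
definition F :: 'q where "F = j f"
definition \<Phi> :: "'b \<Rightarrow> 'q" where "\<Phi> x = j (\<phi> x)"

lemma EF: "E + F = 1" "E * F = 0" "F * E = 0" "E * E = E" "F * F = F" "E \<noteq> 0" "F \<noteq> 0"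
proof -
  show 1: "E + F = 1" "E * F = 0" "F * E = 0" "E \<noteq> 0" "F \<noteq> 0"
    using e_f by (simp_all add: E_def F_def flip: j_add j_mult)
  have "E * E + E * F = E" "F * E + F * F = F" unfolding distrib_left[symmetric] 1(1) by simp_all
  then show "E * E = E" "F * F = F" using 1(2,3) by simp_all
qed

lemma swap_EF: "peirce_iso.E j f = F" "peirce_iso.F j e = E"
  using peirce_iso.E_def[OF swap] peirce_iso.F_def[OF swap] by (simp_all only: E_def F_def)

lemma gk: "g * g = g" "k * k = k"
proof -
  have "g * g + g * k = g" "k * g + k * k = k"
    unfolding distrib_left[symmetric] g_k(1) by simp_all
  then show "g * g = g" "k * k = k" using g_k(2,3) by simp_all
qed

lemma \<Phi>_add: "\<Phi> (x + y) = \<Phi> x + \<Phi> y"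
  by (simp add: \<Phi>_def add)

lemma \<Phi>_zero: "\<Phi> 0 = 0"
  using \<Phi>_add[of 0 0] by simp

lemma EF_assoc: "E * (E * x) = E * x" "E * (F * x) = 0" "F * (E * x) = 0" "F * (F * x) = F * x"
  using EF by (simp_all add: mult.assoc[symmetric])

lemma corner_g: "p \<in> {g, k} \<Longrightarrow> q \<in> {g, k} \<Longrightarrow> corner p q (p * x * q)"
  unfolding corner_def using gk by (auto simp: mult.assoc) (simp_all add: mult.assoc[symmetric])

lemma corner_decomp:
  "corner g g (g * x * g)" "corner g k (g * x * k)" "corner k g (k * x * g)" "corner k k (k * x * k)"
  by (auto intro: corner_g)

lemma corner_mult: "corner p q x \<Longrightarrow> corner q' r y \<Longrightarrow> corner p r (x * y)"
  unfolding corner_def by (metis mult.assoc)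

lemma corner_zero: "corner p q x \<Longrightarrow> corner r s y \<Longrightarrow> q * r = 0 \<Longrightarrow> x * y = 0"
  unfolding corner_def by (metis mult.assoc mult_zero_left mult_zero_right)

lemma decomp: "x = g * x * g + g * x * k + k * x * g + k * x * k"
proof -
  have "x = (g + k) * x * (g + k)" unfolding g_k(1) by simp
  then show ?thesis by (simp add: algebra_simps)
qed

lemma \<Phi>12: "corner g k x \<Longrightarrow> E * \<Phi> x = \<Phi> x" "corner g k x \<Longrightarrow> \<Phi> x * F = \<Phi> x"
    "corner g k x \<Longrightarrow> F * \<Phi> x = 0" "corner g k x \<Longrightarrow> \<Phi> x * E = 0"
  and \<Phi>21: "corner k g x \<Longrightarrow> F * \<Phi> x = \<Phi> x" "corner k g x \<Longrightarrow> \<Phi> x * E = \<Phi> x"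
    "corner k g x \<Longrightarrow> E * \<Phi> x = 0" "corner k g x \<Longrightarrow> \<Phi> x * F = 0"
proof -
  show 1: "E * \<Phi> x = \<Phi> x" "\<Phi> x * F = \<Phi> x" if "corner g k x"
    using off_diagonal(1)[OF that] by (simp_all add: corner_def E_def F_def \<Phi>_def flip: j_mult)
  show 2: "F * \<Phi> x = \<Phi> x" "\<Phi> x * E = \<Phi> x" if "corner k g x"
    using off_diagonal(2)[OF that] by (simp_all add: corner_def E_def F_def \<Phi>_def flip: j_mult)
  show "F * \<Phi> x = 0" "\<Phi> x * E = 0" if "corner g k x"
    using 1[OF that] EF EF_assoc by (metis mult.assoc mult_zero_right)+
  show "E * \<Phi> x = 0" "\<Phi> x * F = 0" if "corner k g x"
    using 2[OF that] EF EF_assoc by (metis mult.assoc mult_zero_right)+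
qed

definition P :: "'b \<Rightarrow> 'q" where "P b = E * \<Phi> b * E"
definition R :: "'b \<Rightarrow> 'q" where "R b = F * \<Phi> b * F"

lemma swap_PR: "peirce_iso.P j f \<phi> = R" "peirce_iso.R j e \<phi> = P"
  using peirce_iso.P_def[OF swap] peirce_iso.R_def[OF swap]
  by (intro ext, simp only: P_def R_def swap_EF)+

lemma PR_add: "P (x + y) = P x + P y" "R (x + y) = R x + R y"
  by (simp_all add: P_def R_def \<Phi>_add algebra_simps)

lemma PR_simps: "E * P b = P b" "P b * E = P b" "F * P b = 0" "P b * F = 0"
  "F * R b = R b" "R b * F = R b" "E * R b = 0" "R b * E = 0"
  by (simp_all add: P_def R_def mult.assoc EF_assoc EF)

lemma \<Phi>_diag: "corner g g b \<or> corner k k b \<Longrightarrow> \<Phi> b = P b + R b"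
proof -
  assume b: "corner g g b \<or> corner k k b"
  then have 0: "E * \<Phi> b * F = 0" "F * \<Phi> b * E = 0"
    using diagonal by (auto simp: E_def F_def \<Phi>_def simp flip: j_mult)
  have "\<Phi> b = (E + F) * \<Phi> b * (E + F)" unfolding EF by simp
  also have "\<dots> = P b + E * \<Phi> b * F + F * \<Phi> b * E + R b"
    by (simp add: P_def R_def algebra_simps)
  finally show ?thesis using 0 by simp
qed

lemma PR_diag: "corner g g b \<or> corner k k b \<Longrightarrow> E * \<Phi> b = P b" "corner g g b \<or> corner k k b \<Longrightarrow> \<Phi> b * F = R b"
  "corner g g b \<or> corner k k b \<Longrightarrow> F * \<Phi> b = R b" "corner g g b \<or> corner k k b \<Longrightarrow> \<Phi> b * E = P b"
  using \<Phi>_diag[of b] by (simp_all add: PR_simps algebra_simps)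

lemma surj12: obtains x where "corner g k x" "\<Phi> x = E * j z * F"
proof -
  obtain x where x: "\<phi> x = z" using surj by (metis surjD)
  have "E * j z * F = E * \<Phi> (g * x * g + g * x * k + k * x * g + k * x * k) * F"
    using decomp[of x] x by (simp add: \<Phi>_def)
  also have "\<dots> = E * \<Phi> (g * x * g) * F + E * \<Phi> (g * x * k) * F + E * \<Phi> (k * x * g) * F
     + E * \<Phi> (k * x * k) * F"
    unfolding \<Phi>_add by (simp add: algebra_simps)
  also have "\<dots> = \<Phi> (g * x * k)"
    using corner_decomp by (simp add: \<Phi>12 \<Phi>21 PR_diag PR_simps)
  finally show thesis using that corner_decomp(2) by metis
qed

text \<open>A priori both diagonal corners of B contribute to eAe.\<close>

lemma corner_diag_surj: "E * j z * E = P (g * x * g) + P (k * x * k)" if "\<phi> x = z"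
proof -
  have "E * j z * E = E * \<Phi> (g * x * g + g * x * k + k * x * g + k * x * k) * E"
    using decomp[of x] that by (simp add: \<Phi>_def)
  also have "\<dots> = E * \<Phi> (g * x * g) * E + E * \<Phi> (g * x * k) * E + E * \<Phi> (k * x * g) * E
     + E * \<Phi> (k * x * k) * E"
    unfolding \<Phi>_add by (simp add: algebra_simps)
  also have "\<dots> = P (g * x * g) + P (k * x * k)"
    using corner_decomp by (simp add: \<Phi>12 \<Phi>21 P_def)
  finally show ?thesis .
qed

text \<open>The images of the corner gBk fill eAf, so primeness applies with the nonzero f at the
  right end.\<close>

lemma cancel12:
  assumes "\<And>x. corner g k x \<Longrightarrow> q * \<Phi> x = 0" shows "q * E = 0"
proof (rule ccontr)
  assume "q * E \<noteq> 0"
  have "q * E * j z * F = 0" for z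
  proof -
    obtain x where "corner g k x" "\<Phi> x = E * j z * F" by (rule surj12)
    then show ?thesis using assms[of x] by (simp add: mult.assoc)
  qed
  then have "F = 0" using quotients_prime[of "q * E" F] \<open>q * E \<noteq> 0\<close> by blast
  then show False using EF by simp
qed

lemma cancel12':
  assumes "\<And>x. corner g k x \<Longrightarrow> \<Phi> x * q = 0" shows "F * q = 0"
proof (rule ccontr)
  assume "F * q \<noteq> 0"
  have "E * j z * (F * q) = 0" for z
  proof -
    obtain x where "corner g k x" "\<Phi> x = E * j z * F" by (rule surj12)
    then show ?thesis using assms[of x] by (simp add: mult.assoc)
  qed
  then have "F * q = 0" using quotients_prime[of E "F * q"] EF by blast
  then show False using \<open>F * q \<noteq> 0\<close> by simp
qed

text \<open>As xb = 0, the product bx is a commutator and is therefore respected; of \<Phi> b only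
  the two diagonal parts meet \<Phi> x.\<close>

lemma act:
  assumes b: "corner g g b" and x: "corner g k x"
  shows "\<Phi> (b * x) = P b * \<Phi> x - \<Phi> x * R b"
proof -
  have "x * b = 0" using corner_zero[OF x b] g_k by simp
  then have "\<Phi> (b * x) = \<Phi> b * \<Phi> x - \<Phi> x * \<Phi> b"
    using bracket(1)[OF b, of x] by (simp add: \<Phi>_def)
  also have "\<Phi> b * \<Phi> x = \<Phi> b * E * \<Phi> x" using \<Phi>12(1)[OF x] by (simp add: mult.assoc)
  also have "\<Phi> x * \<Phi> b = \<Phi> x * (F * \<Phi> b)" using \<Phi>12(2)[OF x] by (simp add: mult.assoc[symmetric])
  finally show ?thesis using b by (simp add: PR_diag)
qed

lemma act':
  assumes b: "corner g g b" and y: "corner k g y"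
  shows "\<Phi> (y * b) = \<Phi> y * P b - R b * \<Phi> y"
proof -
  have "b * y = 0" using corner_zero[OF b y] g_k by simp
  then have "\<Phi> (- (y * b)) = \<Phi> b * \<Phi> y - \<Phi> y * \<Phi> b"
    using bracket(1)[OF b, of y] by (simp add: \<Phi>_def)
  moreover have "\<Phi> (- (y * b)) + \<Phi> (y * b) = 0"
    unfolding \<Phi>_add[symmetric] by (simp add: \<Phi>_zero)
  ultimately have "\<Phi> (y * b) = \<Phi> y * \<Phi> b - \<Phi> b * \<Phi> y"
    by (simp add: add_eq_0_iff)
  moreover have "\<Phi> b * \<Phi> y = \<Phi> b * F * \<Phi> y" using \<Phi>21(1)[OF y] by (simp add: mult.assoc)
  moreover have "\<Phi> y * \<Phi> b = \<Phi> y * (E * \<Phi> b)" using \<Phi>21(2)[OF y] by (simp add: mult.assoc[symmetric])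
  ultimately show ?thesis using b by (simp add: PR_diag)
qed

end

context quotients_half
begin

lemma half_spn: "(u :: 'q) + u \<in> spn [v] \<Longrightarrow> u \<in> spn [v]"
proof -
  assume "u + u \<in> spn [v]"
  then obtain c where c: "u + u = sc c v" unfolding spn_1 by blast
  obtain h :: "'q center" where h: "h + h = 1" using half by blast
  have "u = sc h (u + u)" by (simp only: sc_simps(1) sc_simps(4)[symmetric] h sc_triv)
  then have "u = sc (h * c) v" unfolding c by (simp only: sc_simps)
  then show ?thesis unfolding spn_1 by blast
qed

lemma spn1_add: "(u :: 'q) \<in> spn [v] \<Longrightarrow> w \<in> spn [v] \<Longrightarrow> u + w \<in> spn [v]"
  and spn1_diff: "(u :: 'q) \<in> spn [v] \<Longrightarrow> w \<in> spn [v] \<Longrightarrow> u - w \<in> spn [v]"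
  unfolding spn_1 by (metis sc_simps(4), metis sc_simps(5))

end

section \<open>The action of the diagonal corners on the odd part\<close>

context peirce_iso
begin

text \<open>On eAf the element b acts by left multiplication with P(b) minus right multiplication
  with R(b). The square of this operator has to be of the same kind, since it is the action of bb;
  the obstruction is the cross term 2P(b) x R(b). With x = ezf it becomes an identity in z, where
  2P(b) outside Ce forces R(b) into Cf.\<close>

lemma scalar_alternative:
  assumes b: "corner g g b"
  shows "P b \<in> spn [E] \<or> R b \<in> spn [F]"
proof (rule ccontr)
  assume "\<not> ?thesis"
  then have nin: "P b + P b \<notin> spn [E]" and nR: "R b \<notin> spn [F]" using half_spn by blast+
  obtain c where c: "\<And>b' b1 ks. length ks = length [E] \<Longrightarrow>
    (\<And>z. (P b + P b) * j z * b' + lin [E] ks (j z) + (P (b * b) - P b * P b) * j z * b1 = 0)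
      \<Longrightarrow> b' = sc c b1"
    using martindale_1[OF nin, of "P (b * b) - P b * P b"] by blast
  have "R b = sc c F"
  proof (rule c[of "[- (R (b * b) + R b * R b)]"])
    fix z
    obtain x where x: "corner g k x" "\<Phi> x = E * j z * F" by (rule surj12)
    have bx: "corner g k (b * x)" and bb: "corner g g (b * b)"
      using corner_mult b x(1) by blast+
    have "P (b * b) * \<Phi> x - \<Phi> x * R (b * b) = \<Phi> (b * b * x)" using act[OF bb x(1)] by simp
    also have "\<dots> = P b * \<Phi> (b * x) - \<Phi> (b * x) * R b"
      using act[OF b bx] by (simp add: mult.assoc)
    also have "\<dots> = P b * (P b * \<Phi> x - \<Phi> x * R b) - (P b * \<Phi> x - \<Phi> x * R b) * R b"
      using act[OF b x(1)] by simp
    finally have "P (b * b) * \<Phi> x - \<Phi> x * R (b * b) -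
      (P b * (P b * \<Phi> x - \<Phi> x * R b) - (P b * \<Phi> x - \<Phi> x * R b) * R b) = 0" by simp
    moreover have "P d * (E * q) = P d * q" "F * (R d * q) = R d * q" for d q
      using PR_simps by (simp_all add: mult.assoc[symmetric])
    ultimately show "(P b + P b) * j z * R b + lin [E] [- (R (b * b) + R b * R b)] (j z)
        + (P (b * b) - P b * P b) * j z * F = 0"
      unfolding x(2) by (simp add: algebra_simps PR_simps)
  qed simp
  then show False using nR unfolding spn_1 by blast
qed

text \<open>A group is not the union of two proper subgroups.\<close>

lemma scalar_uniform:
  "(\<forall>b. corner g g b \<longrightarrow> P b \<in> spn [E]) \<or> (\<forall>b. corner g g b \<longrightarrow> R b \<in> spn [F])"
proof (rule ccontr)
  assume "\<not> ?thesis"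
  then obtain b c where b: "corner g g b" "P b \<notin> spn [E]" and c: "corner g g c" "R c \<notin> spn [F]"
    by blast
  have "R b \<in> spn [F]" "P c \<in> spn [E]" using scalar_alternative b c by blast+
  moreover have "corner g g (b + c)" using b c by (simp add: corner_def algebra_simps)
  then have "P b + P c \<in> spn [E] \<or> R b + R c \<in> spn [F]" using scalar_alternative PR_add by metis
  ultimately show False using b c spn1_diff[of "P b + P c" E "P c"] spn1_diff[of "R b + R c" F "R b"]
    by auto
qed

text \<open>When both diagonal corners of B act through e A e, the two actions commute and together
  with the scalars exhaust e A e; hence one of them is scalar.\<close>
lemma mixed_case:
  assumes R1: "\<And>b. corner g g b \<Longrightarrow> R b \<in> spn [F]" and R2: "\<And>b. corner k k b \<Longrightarrow> R b \<in> spn [F]"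
  shows "(\<forall>b. corner g g b \<longrightarrow> P b \<in> spn [E]) \<or> (\<forall>b. corner k k b \<longrightarrow> P b \<in> spn [E])"
proof (rule ccontr)
  interpret sw: peirce_iso j f e k g \<phi> by (rule swap)
  note swE = swap_EF
  note swP = swap_PR
  assume "\<not> ?thesis"
  then obtain b c where b: "corner g g b" "P b \<notin> spn [E]" and c: "corner k k c" "P c \<notin> spn [E]"
    by blast
  have "\<forall>b. \<exists>r. corner g g b \<or> corner k k b \<longrightarrow> R b = sc r F" using R1 R2 unfolding spn_1 by blast
  then obtain r where r: "\<And>b. corner g g b \<or> corner k k b \<Longrightarrow> R b = sc (r b) F" by metis
  define W where "W b = P b - sc (r b) E" for b
  have PW: "P b = W b + sc (r b) E" for b by (simp add: W_def)
  have WE: "W b * E = W b" "E * W b = W b" for b by (simp_all add: W_def PR_simps scalg EF)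
  have Wl: "\<Phi> (b * x) = W b * \<Phi> x" if "corner g g b" "corner g k x" for b x
    using act[OF that] r[of b] that \<Phi>12 by (simp add: W_def scalg)
  have Wr: "\<Phi> (x * b) = - (W b * \<Phi> x)" if "corner k k b" "corner g k x" for b x
    using sw.act'[OF that] r[of b] that \<Phi>12 by (simp add: W_def scalg swE swP)
  have comm: "W b * W c = W c * W b" if b: "corner g g b" and c: "corner k k c" for b c
  proof -
    have "(W b * W c - W c * W b) * E = 0"
    proof (rule cancel12)
      fix x assume x: "corner g k x"
      have "corner g k (x * c)" "corner g k (b * x)" using corner_mult b c x by blast+
      then have "- (W c * (W b * \<Phi> x)) = \<Phi> (b * x * c)" "W b * - (W c * \<Phi> x) = \<Phi> (b * (x * c))"
        using Wl Wr b c x by simp_all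
      then have "W b * - (W c * \<Phi> x) = - (W c * (W b * \<Phi> x))" by (simp only: mult.assoc)
      then have "W b * (W c * \<Phi> x) = W c * (W b * \<Phi> x)" by simp
      then show "(W b * W c - W c * W b) * \<Phi> x = 0" by (simp add: left_diff_distrib mult.assoc)
    qed
    then show ?thesis using WE by (simp add: left_diff_distrib mult.assoc)
  qed
  have exhaust: "\<exists>b c s. corner g g b \<and> corner k k c \<and> E * j z * E = W b + W c + sc s E" for z
  proof -
    obtain x where "\<phi> x = z" using surj by (metis surjD)
    from corner_diag_surj[OF this] have "E * j z * E = W (g * x * g) + W (k * x * k)
      + sc (r (g * x * g) + r (k * x * k)) E"
      unfolding PW by (simp add: scalg)
    then show ?thesis using corner_decomp(1,4) by blast
  qed
  define u v where "u = W b" and "v = W c"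
  have nu: "u \<notin> spn [E]" using b(2) spn1_add[of u E "sc (r b) E"] by (auto simp: u_def PW)
  have nv: "v \<notin> spn [E]" using c(2) spn1_add[of v E "sc (r c) E"] by (auto simp: v_def PW)
  have vE: "v * E = v" "E * v = v" and uE: "u * E = u" "E * u = u" by (simp_all add: u_def v_def WE)
  have vE': "v * (E * q) = v * q" "E * (v * q) = v * q" and uE': "u * (E * q) = u * q" "E * (u * q) = u * q"
    for q using vE uE by (simp_all add: mult.assoc[symmetric])
  have v_comm: "v * W b' = W b' * v" if "corner g g b'" for b'
    using comm[OF that c(1)] by (simp add: v_def)
  have u_comm: "u * W c' = W c' * u" if "corner k k c'" for c'
    using comm[OF b(1) that] by (simp add: u_def)
  have uv: "u * v = v * u" unfolding u_def v_def by (rule comm[OF b(1) c(1)])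
  \<comment> \<open>The commutator with u kills the part from the corner of k, the commutator with v
    kills the part from the corner of g, and v commutes with u. Together with the scalars these
    parts exhaust eAe.\<close>
  have gpi: "cm v (cm u (E * j z * E)) = 0" for z
  proof -
    obtain b' c' s where *: "corner g g b'" "corner k k c'" "E * j z * E = W b' + W c' + sc s E"
      using exhaust by blast
    have 1: "cm u (E * j z * E) = cm u (W b')"
      unfolding *(3) using u_comm[OF *(2)] uE by (simp add: scalg)
    have 2: "v * W b' = W b' * v" by (rule v_comm[OF *(1)])
    have "v * (u * W b') = u * W b' * v" "v * (W b' * u) = W b' * u * v"
      using 2 uv by (metis mult.assoc)+
    then show ?thesis unfolding 1 by (simp add: algebra_simps)
  qed
  have "v \<in> spn [u, E]"
  proof (rule ccontr)
    assume nin: "v \<notin> spn [u, E]"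
    obtain c where c: "\<And>b' b1 ks. length ks = length [u, E] \<Longrightarrow>
      (\<And>z. v * j z * b' + lin [u, E] ks (j z) + v * u * j z * b1 = 0) \<Longrightarrow> b' = sc c b1"
      using martindale_1[OF nin, of "v * u"] by blast
    have "- u = sc c E"
    proof (rule c[of "[- v, u * v]"])
      show "v * j z * - u + lin [u, E] [- v, u * v] (j z) + v * u * j z * E = 0" for z
        using gpi[of z] by (simp add: algebra_simps vE uE vE' uE')
    qed simp
    then have "- (- u) = - sc c E" by (simp only:)
    then have "u = sc (- c) E" by (simp add: sc_simps)
    then show False using nu unfolding spn_1 by blast
  qed
  \<comment> \<open>As a combination of u and e, v commutes with both families, hence with eAe, and
    this makes it scalar.\<close>
  then obtain s t where v: "v = sc s u + sc t E" unfolding spn_2 by blast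
  have v_comm': "v * W c' = W c' * v" if "corner k k c'" for c'
    unfolding v using u_comm[OF that] WE by (simp add: scalg)
  have "E = 0"
  proof (rule martindale_0[OF nv, of "[- v]"])
    fix z
    obtain b' c' s where *: "corner g g b'" "corner k k c'" "E * j z * E = W b' + W c' + sc s E"
      using exhaust by blast
    have "v * (E * j z * E) = E * j z * E * v"
      unfolding *(3) using v_comm[OF *(1)] v_comm'[OF *(2)] vE by (simp add: scalg)
    then show "v * j z * E + lin [E] [- v] (j z) = 0"
      by (simp add: mult.assoc vE vE')
  qed simp
  then show False using EF by simp
qed

end

section \<open>Recognizing 2x2 matrices over C\<close>

context quotients
begin

lemma sc_cancel_right: "sc c (q :: 'q) = sc d q \<Longrightarrow> q \<noteq> 0 \<Longrightarrow> c = d"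
  using sc_eq_0[of "c - d" q] by (simp add: sc_simps)

abbreviation closure_is_M2 :: bool where
  "closure_is_M2 \<equiv> \<exists>h. ring_iso_on (M2 (ring_center :: 'q set)) M2_add M2_mult (central_closure j) h"

text \<open>Primeness yields x and y with exfye nonzero, hence an invertible multiple of e. After
  rescaling, exf and fye complete e and f to a system of matrix units.\<close>

lemma two_by_two:
  assumes ef: "e + f = 1" "e * f = 0" "f * e = 0" "e \<noteq> 0" "f \<noteq> 0"
    and E: "\<And>x y. j (e * x * f * y * e) \<in> spn [j e]"
    and F: "\<And>x y. j (f * y * e * x * f) \<in> spn [j f]"
  shows "closure_is_M2"
proof -
  define A where "A = j e"
  define D where "D = j f"
  have AD: "A + D = 1" "A * D = 0" "D * A = 0" "A \<noteq> 0" "D \<noteq> 0"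
    using ef by (simp_all add: A_def D_def flip: j_add j_mult)
  have "A * A + A * D = A" "D * A + D * D = D" unfolding distrib_left[symmetric] AD(1) by simp_all
  then have idem: "A * A = A" "D * D = D" using AD by simp_all
  have idem': "A * (A * q) = A * q" "D * (D * q) = D * q" "A * (D * q) = 0" "D * (A * q) = 0" for q
    using idem AD by (simp_all add: mult.assoc[symmetric])
  obtain x where x: "e * x * f \<noteq> 0" using primeD[of e f] ef by blast
  obtain y where y: "e * x * f * y * e \<noteq> 0" using primeD[of "e * x * f" e] x ef by blast
  obtain c where c: "j (e * x * f * y * e) = sc c A" using E unfolding A_def spn_1 by blast
  have "c \<noteq> 0" using y c by (auto simp del: j_mult)
  then obtain d where d: "d * c = 1" using center_inverse by blast
  define X where "X = A * j x * D"
  define Y where "Y = sc d (D * j y * A)"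
  have X: "A * X = X" "X * D = X" "X * A = 0" "D * X = 0"
    by (simp_all add: X_def mult.assoc idem idem' AD)
  have Y: "D * Y = Y" "Y * A = Y" "Y * D = 0" "A * Y = 0"
    by (simp_all add: Y_def sc_simps mult.assoc idem idem' AD)
  have XY: "X * Y = A"
  proof -
    have "X * Y = sc d (j (e * x * f * y * e))"
      by (simp add: X_def Y_def sc_simps mult.assoc idem idem' flip: A_def D_def)
    then show ?thesis unfolding c by (simp add: sc_simps d)
  qed
  have YX: "Y * X = D"
  proof -
    have "Y * X = sc d (j (f * y * e * x * f))"
      by (simp add: X_def Y_def sc_simps mult.assoc idem idem' flip: A_def D_def)
    \<comment> \<open>A priori this is another scalar; X = XYX identifies it as 1.\<close>
    then obtain c' where c': "Y * X = sc c' D"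
      using F[of y x] unfolding D_def spn_1 by (auto simp: sc_simps)
    have "X = X * Y * X" using XY X by simp
    also have "\<dots> = sc c' X" using c' X by (simp add: mult.assoc sc_simps)
    finally have "sc (c' - 1) X = 0" by (simp add: sc_simps)
    moreover have "X \<noteq> 0" using XY AD by auto
    ultimately have "c' = 1" using sc_eq_0[of "c' - 1" X] by simp
    then show ?thesis using c' by simp
  qed
  have assoc: "A * (X * q) = X * q" "X * (D * q) = X * q" "X * (A * q) = 0" "D * (X * q) = 0"
    "D * (Y * q) = Y * q" "Y * (A * q) = Y * q" "Y * (D * q) = 0" "A * (Y * q) = 0"
    "X * (Y * q) = A * q" "Y * (X * q) = D * q" for q
    using X Y XY YX by (simp_all add: mult.assoc[symmetric])
  have XX: "X * X = 0" "Y * Y = 0" "X * (X * q) = 0" "Y * (Y * q) = 0" for q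
    using X Y by (metis mult.assoc mult_zero_left mult_zero_right)+
  define m where "m = (\<lambda>(a, b, c, d). sc a A + sc b X + sc c Y + sc d D)"
  have m_add: "m (a, b, c, d) + m (a', b', c', d') = m (a + a', b + b', c + c', d + d')" for a b c d a' b' c' d'
    by (simp add: m_def scalg)
  have m_mult: "m (a, b, c, d) * m (a', b', c', d') =
      m (a * a' + b * c', a * b' + b * d', c * a' + d * c', c * b' + d * d')" for a b c d a' b' c' d'
    by (simp add: m_def scalg X Y XY YX XX idem AD)
  \<comment> \<open>Multiplying by A or X from the left and by A or Y from the right moves each
    entry into the corner of A, where it can be read off.\<close>
  have coords: "A * m (a, b, c, d) * A = sc a A" "A * m (a, b, c, d) * Y = sc b A"
    "X * m (a, b, c, d) * A = sc c A" "X * m (a, b, c, d) * Y = sc d A" for a b c d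
    by (simp_all add: m_def scalg X Y XY YX XX idem AD assoc)
  have m_inj: "p = q" if "m p = m q" for p q
  proof -
    obtain a b c d where p: "p = (a, b, c, d)" by (cases p)
    obtain a' b' c' d' where q: "q = (a', b', c', d')" by (cases q)
    note eq = that[unfolded p q]
    have "sc a A = sc a' A" "sc b A = sc b' A" "sc c A = sc c' A" "sc d A = sc d' A"
      using coords[of a b c d] coords[of a' b' c' d'] unfolding eq by simp_all
    then show ?thesis using sc_cancel_right AD p q by blast
  qed
  have cls_sc: "sc a z \<in> central_closure j" if "z \<in> central_closure j" for a z
    unfolding sc_def by (intro central_closure.mult central_closure.cen that Rep_center)
  have in_cls: "A \<in> central_closure j" "D \<in> central_closure j" "X \<in> central_closure j"
    "Y \<in> central_closure j"
    unfolding X_def Y_def A_def D_def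
    by (intro central_closure.mult central_closure.emb cls_sc)+
  have m_cls: "m p \<in> central_closure j" for p
    unfolding m_def using in_cls cls_sc
    by (cases p) (simp add: central_closure.add)
  have m_j: "\<exists>p. m p = j z" for z
  proof -
    have 1: "\<exists>a. A * j z * A = sc a A" for z
    proof -
      obtain a where a: "j (e * (z * e * x) * f * y * e) = sc a A" using E unfolding A_def spn_1 by blast
      have "A * j z * A = A * j z * (X * Y)" using XY by simp
      also have "\<dots> = sc d (j (e * (z * e * x) * f * y * e))"
        by (simp add: X_def Y_def sc_simps mult.assoc idem idem' flip: A_def D_def)
      finally show ?thesis unfolding a sc_simps by blast
    qed
    have 2: "X * j z * Y = sc d (j (e * x * f * (z * f * y) * e))"
        by (simp add: X_def Y_def sc_simps mult.assoc idem idem' flip: A_def D_def)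
    have 3: "A * j z * Y = sc d (j (e * z * f * y * e))"
        by (simp add: X_def Y_def sc_simps mult.assoc idem idem' flip: A_def D_def)
    have 4: "X * j z * A = j (e * x * f * z * e)"
        by (simp add: X_def Y_def sc_simps mult.assoc idem idem' flip: A_def D_def)
    obtain p q r s where pqrs: "A * j z * A = sc p A" "A * j z * Y = sc q A" "X * j z * A = sc r A"
      "X * j z * Y = sc s A"
      using 1[of z] 2 3 4 E unfolding A_def[symmetric] spn_1 by (metis sc_simps(7))
    have "j z = (A + D) * j z * (A + D)" unfolding AD by simp
    also have "\<dots> = A * j z * A + (A * j z * Y) * X + Y * (X * j z * A) + Y * (X * j z * Y) * X"
      by (simp add: algebra_simps XY YX assoc)
    also have "\<dots> = m (p, q, r, s)"
      unfolding pqrs by (simp add: m_def scalg assoc X Y XY YX)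
    finally show ?thesis by metis
  qed
  have m_surj: "\<exists>p. m p = z" if "z \<in> central_closure j" for z
    using that
  proof induction
    case (emb a)
    then show ?case by (rule m_j)
  next
    case (cen c)
    then obtain s where "c = cst s" using ring_center_cst by blast
    then have "m (s, 0, 0, s) = c" using AD(1) by (simp add: m_def flip: sc_simps(1))
    then show ?case by blast
  next
    case (add x y)
    then show ?case using m_add by (metis prod_cases4)
  next
    case (neg x)
    then obtain a b c d where "m (a, b, c, d) = x" by (metis prod_cases4)
    then have "m (- a, - b, - c, - d) = - x" by (auto simp: m_def sc_simps)
    then show ?case by blast
  next
    case (mult x y)
    then show ?case using m_mult by (metis prod_cases4)
  qed
  \<comment> \<open>The entries of \<open>M2\<close> are elements of Q; r carries them to the type
    of scalars, on which m is defined.\<close>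
  define r where "r = (\<lambda>(a, b, c, d). (Abs_center a :: 'q center, Abs_center b :: 'q center, Abs_center c :: 'q center,
      Abs_center d :: 'q center))"
  define h where "h = m \<circ> r"
  have r_add: "r (M2_add p q) = (case (r p, r q) of ((a, b, c, d), (a', b', c', d')) \<Rightarrow>
      (a + a', b + b', c + c', d + d'))" if "p \<in> M2 ring_center" "q \<in> M2 ring_center" for p q
    using that by (auto simp: r_def M2_def M2_add_def plus_center_def Abs_center_inverse)
  have r_mult: "r (M2_mult p q) = (case (r p, r q) of ((a, b, c, d), (a', b', c', d')) \<Rightarrow>
      (a * a' + b * c', a * b' + b * d', c * a' + d * c', c * b' + d * d'))"
    if "p \<in> M2 ring_center" "q \<in> M2 ring_center" for p q
  proof -
    have 1: "Abs_center (a * a' + b * b' :: 'q) = Abs_center a * Abs_center a' + Abs_center b * Abs_center b'"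
      if "a \<in> ring_center" "b \<in> ring_center" "a' \<in> ring_center" "b' \<in> ring_center" for a b a' b'
      using that by (simp add: plus_center_def[of "_ * _"] Abs_center_inverse flip: Rep_center_inject)
    show ?thesis using that by (auto simp: r_def M2_def M2_mult_def 1)
  qed
  have "bij_betw h (M2 ring_center) (central_closure j)"
  proof (rule bij_betw_imageI)
    show "inj_on h (M2 ring_center)"
    proof (rule inj_onI)
      fix p q assume pq: "p \<in> M2 (ring_center :: 'q set)" "q \<in> M2 ring_center" "h p = h q"
      then have "r p = r q" using m_inj by (simp add: h_def)
      then show "p = q" using pq by (auto simp: r_def M2_def Abs_center_inject)
    qed
    show "h ` M2 ring_center = central_closure j"
    proof (intro equalityI subsetI)
      fix z assume "z \<in> central_closure j"
      then obtain a b c d where "m (a, b, c, d) = z" using m_surj by (metis prod_cases4)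
      then have "h (Rep_center a, Rep_center b, Rep_center c, Rep_center d) = z"
        by (simp add: h_def r_def Rep_center_inverse)
      moreover have "(Rep_center a, Rep_center b, Rep_center c, Rep_center d) \<in> M2 ring_center"
        by (simp add: M2_def Rep_center)
      ultimately show "z \<in> h ` M2 ring_center" by blast
    qed (auto simp: h_def m_cls)
  qed
  moreover have "h (M2_add p q) = h p + h q" "h (M2_mult p q) = h p * h q"
    if "p \<in> M2 ring_center" "q \<in> M2 ring_center" for p q
    using r_add[OF that] r_mult[OF that] m_add m_mult by (auto simp: h_def split: prod.splits)
  ultimately show ?thesis unfolding ring_iso_on_def by blast
qed

end

context peirce_iso
begin

lemma odd_products_central:
  assumes "\<And>x y. corner g k x \<Longrightarrow> corner k g y \<Longrightarrow> \<Phi> x * \<Phi> y \<in> spn [E] \<and> \<Phi> y * \<Phi> x \<in> spn [F]"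
  shows "closure_is_M2"
proof (rule two_by_two[OF e_f])
  interpret sw: peirce_iso j f e k g \<phi> by (rule swap)
  note swE = swap_EF
  fix a b
  obtain x where x: "corner g k x" "\<Phi> x = E * j a * F" by (rule surj12)
  obtain y where y: "corner k g y" "\<Phi> y = F * j b * E" using sw.surj12[unfolded swE] by metis
  have "\<Phi> x * \<Phi> y = j (e * a * f * b * e)" "\<Phi> y * \<Phi> x = j (f * b * e * a * f)"
    unfolding x(2) y(2) by (simp_all add: mult.assoc EF_assoc flip: E_def F_def)
  then show "j (e * a * f * b * e) \<in> spn [j e]" "j (f * b * e * a * f) \<in> spn [j f]"
    using assms[OF x(1) y(1)] by (simp_all only: E_def F_def)
qed

end

section \<open>The homomorphism case\<close>

locale peirce_hom = peirce_iso j e f g k \<phi>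
  for j :: "'a::ring_1 \<Rightarrow> 'q::ring_1" and e f :: 'a and g k :: "'b::ring_1" and \<phi> +
  fixes r s :: "'b \<Rightarrow> 'q center"
  assumes r: "corner g g b \<Longrightarrow> F * \<Phi> b * F = sc (r b) F"
    and s: "corner k k b \<Longrightarrow> E * \<Phi> b * E = sc (s b) E"
begin

lemma hom_swap: "peirce_hom j f e k g \<phi> s r"
proof -
  interpret sw: peirce_iso j f e k g \<phi> by (rule swap)
  note swE = swap_EF
  show ?thesis by unfold_locales (simp_all only: swE r s)
qed

lemma \<theta>_P: "corner g g b \<Longrightarrow> \<Phi> b - cst (r b) = P b - sc (r b) E"
proof -
  assume b: "corner g g b"
  have "R b = sc (r b) F" using r[OF b] by (simp add: R_def)
  then show ?thesis using \<Phi>_diag[of b] b EF(1) by (simp add: algebra_simps flip: sc_simps(1))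
qed

lemma act_hom:
  assumes b: "corner g g b"
  shows "corner g k x \<Longrightarrow> \<Phi> (b * x) = (\<Phi> b - cst (r b)) * \<Phi> x"
    and "corner k g y \<Longrightarrow> \<Phi> (y * b) = \<Phi> y * (\<Phi> b - cst (r b))"
proof -
  have R: "R b = sc (r b) F" using r[OF b] by (simp add: R_def)
  show "\<Phi> (b * x) = (\<Phi> b - cst (r b)) * \<Phi> x" if "corner g k x"
    unfolding \<theta>_P[OF b] using act[OF b that] \<Phi>12[OF that] R by (simp add: scalg)
  show "\<Phi> (y * b) = \<Phi> y * (\<Phi> b - cst (r b))" if "corner k g y"
    unfolding \<theta>_P[OF b] using act'[OF b that] \<Phi>21[OF that] R by (simp add: scalg)
qed

lemma E_hom: "corner g g b \<Longrightarrow> (\<Phi> b - cst (r b)) * E = \<Phi> b - cst (r b)"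
  "corner g g b \<Longrightarrow> E * (\<Phi> b - cst (r b)) = \<Phi> b - cst (r b)"
  "corner g g b \<Longrightarrow> F * (\<Phi> b - cst (r b)) = 0"
  "corner g g b \<Longrightarrow> (\<Phi> b - cst (r b)) * F = 0"
  by (simp_all only: \<theta>_P) (simp_all add: scalg PR_simps EF)

text \<open>Both sides act in the same way on eAf, because (bc)x = b(cx), and the action of eQe on
  eAf is faithful.\<close>

lemma mult_hom:
  assumes b: "corner g g b" and c: "corner g g c"
  shows "\<Phi> (b * c) - cst (r (b * c)) = (\<Phi> b - cst (r b)) * (\<Phi> c - cst (r c))"
proof -
  have bc: "corner g g (b * c)" using corner_mult b c by blast
  define \<theta> where "\<theta> b = \<Phi> b - cst (r b)" for b
  have "(\<theta> (b * c) - \<theta> b * \<theta> c) * E = 0"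
  proof (rule cancel12)
    fix x assume x: "corner g k x"
    have cx: "corner g k (c * x)" using corner_mult c x by blast
    have "\<theta> (b * c) * \<Phi> x = \<Phi> (b * c * x)" using act_hom(1)[OF bc x] by (simp add: \<theta>_def)
    also have "\<dots> = \<theta> b * (\<theta> c * \<Phi> x)"
      using act_hom(1)[OF b cx] act_hom(1)[OF c x] by (simp add: mult.assoc \<theta>_def)
    finally show "(\<theta> (b * c) - \<theta> b * \<theta> c) * \<Phi> x = 0"
      by (simp add: left_diff_distrib mult.assoc)
  qed
  then have "\<theta> (b * c) * E = \<theta> b * (\<theta> c * E)"
    by (simp add: left_diff_distrib mult.assoc)
  then show ?thesis unfolding \<theta>_def E_hom[OF bc] E_hom[OF c] .
qed

text \<open>The obstruction to multiplicativity on odd elements.\<close>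
definition w :: "'b \<Rightarrow> 'b \<Rightarrow> 'q center" where "w x y = r (x * y) + s (y * x)"

text \<open>The superbracket determines the image of xy + yx. After the scalar shifts xy goes to the
  corner of e and yx to that of f, so multiplying by e or f separates them, and the same scalar is
  missing from both.\<close>

lemma odd_defect:
  assumes x: "corner g k x" and y: "corner k g y"
  shows "\<Phi> (x * y) - cst (r (x * y)) = \<Phi> x * \<Phi> y - sc (w x y) E"
    "\<Phi> (y * x) - cst (s (y * x)) = \<Phi> y * \<Phi> x - sc (w x y) F"
proof -
  interpret sw: peirce_hom j f e k g \<phi> s r by (rule hom_swap)
  note swE = swap_EF
  have xy: "corner g g (x * y)" and yx: "corner k k (y * x)" using corner_mult x y by blast+
  have sum: "(\<Phi> (x * y) - cst (r (x * y))) + (\<Phi> (y * x) - cst (s (y * x))) + cst (w x y) =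
    \<Phi> x * \<Phi> y + \<Phi> y * \<Phi> x"
    using odd_bracket[OF x y] \<Phi>_add[of "x * y" "y * x"]
    by (simp add: w_def sc_simps) (simp add: \<Phi>_def)
  have "E * ((\<Phi> (x * y) - cst (r (x * y))) + (\<Phi> (y * x) - cst (s (y * x))) + cst (w x y)) =
    (\<Phi> (x * y) - cst (r (x * y))) + sc (w x y) E"
    using E_hom[OF xy] sw.E_hom[OF yx] unfolding swE by (simp add: distrib_left sc_simps)
  moreover have "E * (\<Phi> x * \<Phi> y + \<Phi> y * \<Phi> x) = \<Phi> x * \<Phi> y"
    using \<Phi>12[OF x] \<Phi>21[OF y] by (simp add: distrib_left mult.assoc[symmetric])
  ultimately show "\<Phi> (x * y) - cst (r (x * y)) = \<Phi> x * \<Phi> y - sc (w x y) E"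
    unfolding sum by (simp add: eq_diff_eq)
  have "F * ((\<Phi> (x * y) - cst (r (x * y))) + (\<Phi> (y * x) - cst (s (y * x))) + cst (w x y)) =
    (\<Phi> (y * x) - cst (s (y * x))) + sc (w x y) F"
    using E_hom[OF xy] sw.E_hom[OF yx] unfolding swE by (simp add: distrib_left sc_simps)
  moreover have "F * (\<Phi> x * \<Phi> y + \<Phi> y * \<Phi> x) = \<Phi> y * \<Phi> x"
    using \<Phi>12[OF x] \<Phi>21[OF y] by (simp add: distrib_left mult.assoc[symmetric])
  ultimately show "\<Phi> (y * x) - cst (s (y * x)) = \<Phi> y * \<Phi> x - sc (w x y) F"
    unfolding sum by (simp add: eq_diff_eq)
qed

text \<open>Group xyx'y' as (xy)(x'y') and as (xyx')y'. Comparing the defects gives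
  w(x',y')\<theta>(xy) = w(xyx',y')e, so a single nonzero defect makes all these products of odd
  elements scalar.\<close>

lemma defect_scalar:
  assumes x': "corner g k x'" and y': "corner k g y'" and ne: "w x' y' \<noteq> 0"
    and x: "corner g k x" and y: "corner k g y"
  shows "\<Phi> x * \<Phi> y \<in> spn [E]"
proof -
  define \<theta> where "\<theta> b = \<Phi> b - cst (r b)" for b
  have xy: "corner g g (x * y)" and xy': "corner g g (x' * y')" and xyx: "corner g k (x * y * x')"
    using corner_mult x y x' y' by blast+
  have "\<theta> (x * y) * \<theta> (x' * y') = \<theta> (x * y * x' * y')"
    using mult_hom[OF xy xy'] by (simp add: \<theta>_def mult.assoc)
  also have "\<dots> = \<theta> (x * y) * \<Phi> x' * \<Phi> y' - sc (w (x * y * x') y') E"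
    using odd_defect(1)[OF xyx y'] act_hom(1)[OF xy x'] by (simp add: \<theta>_def)
  also have "\<theta> (x' * y') = \<Phi> x' * \<Phi> y' - sc (w x' y') E"
    unfolding \<theta>_def by (rule odd_defect(1)[OF x' y'])
  finally have "\<theta> (x * y) * (sc (w x' y') E) = sc (w (x * y * x') y') E"
    by (simp add: right_diff_distrib mult.assoc)
  moreover have "\<theta> (x * y) * (sc (w x' y') E) = sc (w x' y') (\<theta> (x * y))"
    using E_hom[OF xy] by (simp add: sc_simps \<theta>_def)
  ultimately have "sc (w x' y') (\<theta> (x * y)) \<in> spn [E]" unfolding spn_1 by metis
  then have "\<theta> (x * y) \<in> spn [E]" using sc_cancel_spn ne by blast
  then have "\<theta> (x * y) + sc (w x y) E \<in> spn [E]" by (rule spn1_add) (auto simp: spn_1)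
  then show ?thesis using odd_defect(1)[OF x y] by (simp add: \<theta>_def)
qed

lemma defect_zero:
  assumes notM2: "\<not> closure_is_M2"
    and x: "corner g k x" and y: "corner k g y"
  shows "w x y = 0"
proof (rule ccontr)
  interpret sw: peirce_hom j f e k g \<phi> s r by (rule hom_swap)
  note swE = swap_EF
  assume ne: "w x y \<noteq> 0"
  then have "sw.w y x \<noteq> 0" by (simp add: w_def sw.w_def add.commute)
  then have "closure_is_M2"
    using odd_products_central defect_scalar[OF x y ne] sw.defect_scalar[OF y x, unfolded swE] by blast
  then show False using notM2 by blast
qed

end

text \<open>The second alternative is the superantihomomorphism law of -\<theta>, written for
  \<theta>: negation moves the sign from the odd pairs to all others.\<close>

definition twisted :: "'b::ring_1 \<Rightarrow> ('b \<Rightarrow> 'q::ring_1) \<Rightarrow> bool" where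
  "twisted g \<theta> \<longleftrightarrow> (\<forall>x y. \<theta> (x * y) = \<theta> x * \<theta> y) \<or>
    (\<forall>x y. (is_even g x \<or> is_odd g x) \<and> (is_even g y \<or> is_odd g y) \<longrightarrow>
       \<theta> (x * y) = (if is_odd g x \<and> is_odd g y then \<theta> y * \<theta> x else - (\<theta> y * \<theta> x)))"

section \<open>The antihomomorphism case\<close>

locale peirce_antihom = peirce_iso j e f g k \<phi>
  for j :: "'a::ring_1 \<Rightarrow> 'q::ring_1" and e f :: 'a and g k :: "'b::ring_1" and \<phi> +
  fixes r s :: "'b \<Rightarrow> 'q center"
  assumes r: "corner g g b \<Longrightarrow> E * \<Phi> b * E = sc (r b) E"
    and s: "corner k k b \<Longrightarrow> F * \<Phi> b * F = sc (s b) F"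
begin

lemma antihom_swap: "peirce_antihom j f e k g \<phi> s r"
proof -
  interpret sw: peirce_iso j f e k g \<phi> by (rule swap)
  note swE = swap_EF
  show ?thesis by unfold_locales (simp_all only: swE r s)
qed

lemma \<theta>_R: "corner g g b \<Longrightarrow> \<Phi> b - cst (r b) = R b - sc (r b) F"
proof -
  assume b: "corner g g b"
  have "P b = sc (r b) E" using r[OF b] by (simp add: P_def)
  then show ?thesis using \<Phi>_diag[of b] b EF(1) by (simp add: algebra_simps flip: sc_simps(1))
qed

text \<open>Now P(b) is the scalar part, so b acts through the corner of f, from the opposite side.
  This reverses products and brings in the sign.\<close>

lemma act_antihom:
  assumes b: "corner g g b"
  shows "corner g k x \<Longrightarrow> \<Phi> (b * x) = - (\<Phi> x * (\<Phi> b - cst (r b)))"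
    and "corner k g y \<Longrightarrow> \<Phi> (y * b) = - ((\<Phi> b - cst (r b)) * \<Phi> y)"
proof -
  have P: "P b = sc (r b) E" using r[OF b] by (simp add: P_def)
  show "\<Phi> (b * x) = - (\<Phi> x * (\<Phi> b - cst (r b)))" if "corner g k x"
    unfolding \<theta>_R[OF b] using act[OF b that] \<Phi>12[OF that] P by (simp add: scalg)
  show "\<Phi> (y * b) = - ((\<Phi> b - cst (r b)) * \<Phi> y)" if "corner k g y"
    unfolding \<theta>_R[OF b] using act'[OF b that] \<Phi>21[OF that] P by (simp add: scalg)
qed

lemma F_antihom: "corner g g b \<Longrightarrow> (\<Phi> b - cst (r b)) * F = \<Phi> b - cst (r b)"
  "corner g g b \<Longrightarrow> F * (\<Phi> b - cst (r b)) = \<Phi> b - cst (r b)"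
  "corner g g b \<Longrightarrow> E * (\<Phi> b - cst (r b)) = 0"
  "corner g g b \<Longrightarrow> (\<Phi> b - cst (r b)) * E = 0"
  by (simp_all only: \<theta>_R) (simp_all add: scalg PR_simps EF)

lemma mult_antihom:
  assumes b: "corner g g b" and c: "corner g g c"
  shows "\<Phi> (b * c) - cst (r (b * c)) = - ((\<Phi> c - cst (r c)) * (\<Phi> b - cst (r b)))"
proof -
  have bc: "corner g g (b * c)" using corner_mult b c by blast
  define \<theta> where "\<theta> b = \<Phi> b - cst (r b)" for b
  have "F * (\<theta> (b * c) + \<theta> c * \<theta> b) = 0"
  proof (rule cancel12')
    fix x assume x: "corner g k x"
    have cx: "corner g k (c * x)" using corner_mult c x by blast
    have "- (\<Phi> x * \<theta> (b * c)) = \<Phi> (b * c * x)" using act_antihom(1)[OF bc x] by (simp add: \<theta>_def)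
    also have "\<dots> = \<Phi> x * \<theta> c * \<theta> b"
      using act_antihom(1)[OF b cx] act_antihom(1)[OF c x] by (simp add: mult.assoc \<theta>_def)
    finally show "\<Phi> x * (\<theta> (b * c) + \<theta> c * \<theta> b) = 0"
      by (simp add: distrib_left mult.assoc neg_eq_iff_add_eq_0)
  qed
  moreover have "F * \<theta> (b * c) = \<theta> (b * c)" "F * \<theta> c = \<theta> c"
    unfolding \<theta>_def using F_antihom bc c by blast+
  ultimately have "\<theta> (b * c) + \<theta> c * \<theta> b = 0"
    by (simp add: distrib_left mult.assoc[symmetric])
  then show ?thesis unfolding \<theta>_def by (simp add: eq_neg_iff_add_eq_0)
qed

definition w :: "'b \<Rightarrow> 'b \<Rightarrow> 'q center" where "w x y = r (x * y) + s (y * x)"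

lemma odd_defect:
  assumes x: "corner g k x" and y: "corner k g y"
  shows "\<Phi> (x * y) - cst (r (x * y)) = \<Phi> y * \<Phi> x - sc (w x y) F"
    "\<Phi> (y * x) - cst (s (y * x)) = \<Phi> x * \<Phi> y - sc (w x y) E"
proof -
  interpret sw: peirce_antihom j f e k g \<phi> s r by (rule antihom_swap)
  note swE = swap_EF
  have xy: "corner g g (x * y)" and yx: "corner k k (y * x)" using corner_mult x y by blast+
  have sum: "(\<Phi> (x * y) - cst (r (x * y))) + (\<Phi> (y * x) - cst (s (y * x))) + cst (w x y) =
    \<Phi> x * \<Phi> y + \<Phi> y * \<Phi> x"
    using odd_bracket[OF x y] \<Phi>_add[of "x * y" "y * x"]
    by (simp add: w_def sc_simps) (simp add: \<Phi>_def)
  have "E * ((\<Phi> (x * y) - cst (r (x * y))) + (\<Phi> (y * x) - cst (s (y * x))) + cst (w x y)) =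
    (\<Phi> (y * x) - cst (s (y * x))) + sc (w x y) E"
    using F_antihom[OF xy] sw.F_antihom[OF yx] unfolding swE by (simp add: distrib_left sc_simps)
  moreover have "E * (\<Phi> x * \<Phi> y + \<Phi> y * \<Phi> x) = \<Phi> x * \<Phi> y"
    using \<Phi>12[OF x] \<Phi>21[OF y] by (simp add: distrib_left mult.assoc[symmetric])
  ultimately show "\<Phi> (y * x) - cst (s (y * x)) = \<Phi> x * \<Phi> y - sc (w x y) E"
    unfolding sum by (simp add: eq_diff_eq)
  have "F * ((\<Phi> (x * y) - cst (r (x * y))) + (\<Phi> (y * x) - cst (s (y * x))) + cst (w x y)) =
    (\<Phi> (x * y) - cst (r (x * y))) + sc (w x y) F"
    using F_antihom[OF xy] sw.F_antihom[OF yx] unfolding swE by (simp add: distrib_left sc_simps)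
  moreover have "F * (\<Phi> x * \<Phi> y + \<Phi> y * \<Phi> x) = \<Phi> y * \<Phi> x"
    using \<Phi>12[OF x] \<Phi>21[OF y] by (simp add: distrib_left mult.assoc[symmetric])
  ultimately show "\<Phi> (x * y) - cst (r (x * y)) = \<Phi> y * \<Phi> x - sc (w x y) F"
    unfolding sum by (simp add: eq_diff_eq)
qed

text \<open>The grouping (xy)(x'y') = (xyx')y' decides again. As the order of factors is reversed,
  the products that become scalar are those in the corner of f.\<close>

lemma defect_scalar:
  assumes x': "corner g k x'" and y': "corner k g y'" and ne: "w x' y' \<noteq> 0"
    and x: "corner g k x" and y: "corner k g y"
  shows "\<Phi> y * \<Phi> x \<in> spn [F]"
proof -
  define \<theta> where "\<theta> b = \<Phi> b - cst (r b)" for b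
  have xy: "corner g g (x * y)" and xy': "corner g g (x' * y')" and xyx: "corner g k (x * y * x')"
    using corner_mult x y x' y' by blast+
  have "- (\<theta> (x' * y') * \<theta> (x * y)) = \<theta> (x * y * x' * y')"
    using mult_antihom[OF xy xy'] by (simp add: \<theta>_def mult.assoc)
  also have "\<dots> = - (\<Phi> y' * \<Phi> x' * \<theta> (x * y)) - sc (w (x * y * x') y') F"
    using odd_defect(1)[OF xyx y'] act_antihom(1)[OF xy x'] by (simp add: \<theta>_def mult.assoc)
  also have "\<theta> (x' * y') = \<Phi> y' * \<Phi> x' - sc (w x' y') F"
    unfolding \<theta>_def by (rule odd_defect(1)[OF x' y'])
  finally have "sc (w x' y') F * \<theta> (x * y) = - sc (w (x * y * x') y') F"
    by (simp add: left_diff_distrib mult.assoc)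
  moreover have "sc (w x' y') F * \<theta> (x * y) = sc (w x' y') (\<theta> (x * y))"
    using F_antihom[OF xy] by (simp add: sc_simps \<theta>_def)
  ultimately have "sc (w x' y') (\<theta> (x * y)) \<in> spn [F]" unfolding spn_1 by (metis sc_simps(6))
  then have "\<theta> (x * y) \<in> spn [F]" using sc_cancel_spn ne by blast
  then have "\<theta> (x * y) + sc (w x y) F \<in> spn [F]" by (rule spn1_add) (auto simp: spn_1)
  then show ?thesis using odd_defect(1)[OF x y] by (simp add: \<theta>_def)
qed

lemma defect_zero:
  assumes notM2: "\<not> closure_is_M2"
    and x: "corner g k x" and y: "corner k g y"
  shows "w x y = 0"
proof (rule ccontr)
  interpret sw: peirce_antihom j f e k g \<phi> s r by (rule antihom_swap)
  note swE = swap_EF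
  assume ne: "w x y \<noteq> 0"
  then have "sw.w y x \<noteq> 0" by (simp add: w_def sw.w_def add.commute)
  then have "closure_is_M2"
    using odd_products_central defect_scalar[OF x y ne] sw.defect_scalar[OF y x, unfolded swE] by blast
  then show False using notM2 by blast
qed

end

section \<open>Assembling the Peirce components\<close>

context peirce_iso
begin

lemma corner_products_zero:
  "(g * x * g) * (k * y * g) = 0" "(g * x * g) * (k * y * k) = 0"
    "(g * x * k) * (g * y * g) = 0" "(g * x * k) * (g * y * k) = 0"
    "(k * x * g) * (k * y * g) = 0" "(k * x * g) * (k * y * k) = 0"
    "(k * x * k) * (g * y * g) = 0" "(k * x * k) * (g * y * k) = 0"
  by (rule corner_zero; (rule corner_decomp g_k)+)+

lemma product_decomp:
  "x * y = (g * x * g) * (g * y * g) + (g * x * g) * (g * y * k) + (g * x * k) * (k * y * g)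
    + (g * x * k) * (k * y * k) + (k * x * g) * (g * y * g) + (k * x * g) * (g * y * k)
    + (k * x * k) * (k * y * g) + (k * x * k) * (k * y * k)"
proof -
  have "x * y = (g * x * g + g * x * k + k * x * g + k * x * k)
    * (g * y * g + g * y * k + k * y * g + k * y * k)"
    by (rule arg_cong2[OF decomp decomp])
  then show ?thesis by (simp only: distrib_left distrib_right corner_products_zero add_0_left add_0_right add_ac)
qed

text \<open>The functional that assembles the scalar parts r and s found on the two diagonal corners;
  the idempotents U and V are those at which these scalar parts live.\<close>
lemma diagonal_functional:
  assumes U: "U \<noteq> 0" "\<forall>b. corner g g b \<longrightarrow> U * \<Phi> b * U = sc (r b) U"
    and V: "V \<noteq> 0" "\<forall>b. corner k k b \<longrightarrow> V * \<Phi> b * V = sc (s b) V"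
    and \<tau>: "\<And>x. \<tau> x = r (g * x * g) + s (k * x * k)"
  shows "\<tau> (x + y) = \<tau> x + \<tau> y"
    and "(\<And>y. \<Phi> (b * y) = sc c (\<Phi> y)) \<Longrightarrow> (\<And>y. b * y = y * b) \<Longrightarrow> \<tau> (b * x) = c * \<tau> x"
    and "corner g g x \<Longrightarrow> \<tau> x = r x" "corner k k x \<Longrightarrow> \<tau> x = s x"
    and "corner g k x \<Longrightarrow> \<tau> x = 0" "corner k g x \<Longrightarrow> \<tau> x = 0"
proof -
  have r: "r b = c" if "corner g g b" "U * \<Phi> b * U = sc c U" for b c
    using sc_cancel_right[of "r b" U c] U that by metis
  have s: "s b = c" if "corner k k b" "V * \<Phi> b * V = sc c V" for b c
    using sc_cancel_right[of "s b" V c] V that by metis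
  have 0: "r 0 = 0" "s 0 = 0" by (rule r s; simp add: corner_def \<Phi>_zero)+
  have r_add: "r (g * (x + y) * g) = r (g * x * g) + r (g * y * g)" for x y
    by (rule r) (simp_all add: corner_decomp,
        simp add: distrib_left distrib_right \<Phi>_add U(2) corner_decomp sc_simps)
  have s_add: "s (k * (x + y) * k) = s (k * x * k) + s (k * y * k)" for x y
    by (rule s) (simp_all add: corner_decomp,
        simp add: distrib_left distrib_right \<Phi>_add V(2) corner_decomp sc_simps)
  show "\<tau> (x + y) = \<tau> x + \<tau> y" unfolding \<tau> r_add s_add by (simp add: add_ac)
  show "\<tau> (b * x) = c * \<tau> x" if b: "\<And>y. \<Phi> (b * y) = sc c (\<Phi> y)" "\<And>y. b * y = y * b"
  proof -
    have eq: "p * (b * x) * p = b * (p * x * p)" for p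
      using b(2)[of p] by (metis mult.assoc)
    have "r (g * (b * x) * g) = c * r (g * x * g)"
    proof (rule r)
      show "U * \<Phi> (g * (b * x) * g) * U = sc (c * r (g * x * g)) U"
        unfolding eq b(1) using U(2) corner_decomp(1)[of x] by (simp add: sc_simps flip: sc_simps(7))
    qed (rule corner_decomp)
    moreover have "s (k * (b * x) * k) = c * s (k * x * k)"
    proof (rule s)
      show "V * \<Phi> (k * (b * x) * k) * V = sc (c * s (k * x * k)) V"
        unfolding eq b(1) using V(2) corner_decomp(4)[of x] by (simp add: sc_simps flip: sc_simps(7))
    qed (rule corner_decomp)
    ultimately show ?thesis unfolding \<tau> by (simp add: distrib_left)
  qed
  have c: "p' * x * q' = 0" if "corner p q x" "p' * p = 0 \<or> q * q' = 0" for p q p' q' x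
    using that unfolding corner_def by (metis mult.assoc mult_zero_left mult_zero_right)
  have d: "p * x * q = x" if "corner p q x" for p q x using that by (simp add: corner_def)
  show "\<tau> x = r x" if "corner g g x" unfolding \<tau> using c[OF that] d[OF that] 0 g_k by simp
  show "\<tau> x = s x" if "corner k k x" unfolding \<tau> using c[OF that] d[OF that] 0 g_k by simp
  show "\<tau> x = 0" if "corner g k x" unfolding \<tau> using c[OF that] 0 g_k by simp
  show "\<tau> x = 0" if "corner k g x" unfolding \<tau> using c[OF that] 0 g_k by simp
qed

text \<open>Of the sixteen products of Peirce components eight vanish in B. Since \<theta> maps each
  corner into the corresponding one, the same eight vanish in Q, and the others have been treated
  one by one.\<close>

lemma hom_case:
  assumes notM2: "\<not> closure_is_M2"
    and r: "\<forall>b. corner g g b \<longrightarrow> F * \<Phi> b * F = sc (r b) F"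
    and s: "\<forall>b. corner k k b \<longrightarrow> E * \<Phi> b * E = sc (s b) E"
    and \<tau>: "\<And>x. \<tau> x = r (g * x * g) + s (k * x * k)"
  shows "\<Phi> (x * y) - cst (\<tau> (x * y)) = (\<Phi> x - cst (\<tau> x)) * (\<Phi> y - cst (\<tau> y))"
proof -
  interpret h: peirce_hom j e f g k \<phi> r s by unfold_locales (use r s in blast)+
  interpret sw: peirce_hom j f e k g \<phi> s r by (rule h.hom_swap)
  note swE = swap_EF
  note T = diagonal_functional[OF EF(7) r EF(6) s \<tau>]
  define \<theta> where "\<theta> x = \<Phi> x - cst (\<tau> x)" for x
  have \<theta>_add: "\<theta> (x + y) = \<theta> x + \<theta> y" for x y
    by (simp add: \<theta>_def \<Phi>_add T(1) sc_simps)
  have \<theta>gg: "\<theta> b = \<Phi> b - cst (r b)" if "corner g g b" for b by (simp add: \<theta>_def T(3)[OF that])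
  have \<theta>kk: "\<theta> b = \<Phi> b - cst (s b)" if "corner k k b" for b by (simp add: \<theta>_def T(4)[OF that])
  have \<theta>gk: "\<theta> x = \<Phi> x" if "corner g k x" for x by (simp add: \<theta>_def T(5)[OF that])
  have \<theta>kg: "\<theta> x = \<Phi> x" if "corner k g x" for x by (simp add: \<theta>_def T(6)[OF that])
  have w: "h.w x y = 0" if "corner g k x" "corner k g y" for x y by (rule h.defect_zero[OF notM2 that])
  have gg: "\<theta> (b * c) = \<theta> b * \<theta> c" if "corner g g b" "corner g g c" for b c
    using h.mult_hom[OF that] corner_mult that by (metis \<theta>gg)
  have kk: "\<theta> (b * c) = \<theta> b * \<theta> c" if "corner k k b" "corner k k c" for b c
    using sw.mult_hom[OF that] corner_mult that by (metis \<theta>kk)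
  have ggk: "\<theta> (b * x) = \<theta> b * \<theta> x" if "corner g g b" "corner g k x" for b x
    using h.act_hom(1)[OF that] corner_mult that by (metis \<theta>gg \<theta>gk)
  have kgg: "\<theta> (x * b) = \<theta> x * \<theta> b" if "corner k g x" "corner g g b" for b x
    using h.act_hom(2)[OF that(2,1)] corner_mult that by (metis \<theta>gg \<theta>kg)
  have kkg: "\<theta> (b * x) = \<theta> b * \<theta> x" if "corner k k b" "corner k g x" for b x
    using sw.act_hom(1)[OF that] corner_mult that by (metis \<theta>kk \<theta>kg)
  have gkk: "\<theta> (x * b) = \<theta> x * \<theta> b" if "corner g k x" "corner k k b" for b x
    using sw.act_hom(2)[OF that(2,1)] corner_mult that by (metis \<theta>kk \<theta>gk)
  have gkg: "\<theta> (x * y) = \<theta> x * \<theta> y" if xy: "corner g k x" "corner k g y" for x y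
    using h.odd_defect(1)[OF xy] w[OF xy] corner_mult[OF xy]
    by (simp add: \<theta>gg \<theta>gk[OF xy(1)] \<theta>kg[OF xy(2)])
  have kgk: "\<theta> (y * x) = \<theta> y * \<theta> x" if xy: "corner g k x" "corner k g y" for x y
    using h.odd_defect(2)[OF xy] w[OF xy] corner_mult[OF xy(2,1)]
    by (simp add: \<theta>kk \<theta>gk[OF xy(1)] \<theta>kg[OF xy(2)])
  have cgg: "corner E E (\<theta> b)" if "corner g g b" for b
    using h.E_hom[OF that] by (simp add: corner_def \<theta>gg[OF that])
  have ckk: "corner F F (\<theta> b)" if "corner k k b" for b
    using sw.E_hom[OF that] by (simp add: corner_def \<theta>kk[OF that] swE)
  have cgk: "corner E F (\<theta> x)" if "corner g k x" for x
    using \<Phi>12[OF that] by (simp add: corner_def \<theta>gk[OF that])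
  have ckg: "corner F E (\<theta> x)" if "corner k g x" for x
    using \<Phi>21[OF that] by (simp add: corner_def \<theta>kg[OF that])
  note c = corner_decomp
  have zero: "\<theta> (g * x * g) * \<theta> (k * y * g) = 0" "\<theta> (g * x * g) * \<theta> (k * y * k) = 0"
    "\<theta> (g * x * k) * \<theta> (g * y * g) = 0" "\<theta> (g * x * k) * \<theta> (g * y * k) = 0"
    "\<theta> (k * x * g) * \<theta> (k * y * g) = 0" "\<theta> (k * x * g) * \<theta> (k * y * k) = 0"
    "\<theta> (k * x * k) * \<theta> (g * y * g) = 0" "\<theta> (k * x * k) * \<theta> (g * y * k) = 0" for x y
    by (rule corner_zero; (rule cgg ckk cgk ckg c EF)+)+
  have "\<theta> (x * y) = \<theta> ((g * x * g) * (g * y * g)) + \<theta> ((g * x * g) * (g * y * k))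
    + \<theta> ((g * x * k) * (k * y * g)) + \<theta> ((g * x * k) * (k * y * k))
    + \<theta> ((k * x * g) * (g * y * g)) + \<theta> ((k * x * g) * (g * y * k))
    + \<theta> ((k * x * k) * (k * y * g)) + \<theta> ((k * x * k) * (k * y * k))"
    by (subst product_decomp) (simp only: \<theta>_add)
  also have "\<dots> = (\<theta> (g * x * g) + \<theta> (g * x * k) + \<theta> (k * x * g) + \<theta> (k * x * k)) *
     (\<theta> (g * y * g) + \<theta> (g * y * k) + \<theta> (k * y * g) + \<theta> (k * y * k))"
    by (simp only: gg[OF c(1) c(1)] kk[OF c(4) c(4)] ggk[OF c(1) c(2)] kgg[OF c(3) c(1)]
       kkg[OF c(4) c(3)] gkk[OF c(2) c(4)] gkg[OF c(2) c(3)] kgk[OF c(2) c(3)]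
       distrib_left distrib_right zero add_0_left add_0_right add_ac)
  also have "\<theta> (g * x * g) + \<theta> (g * x * k) + \<theta> (k * x * g) + \<theta> (k * x * k) = \<theta> x"
    by (subst (5) decomp[of x]) (simp only: \<theta>_add)
  also have "\<theta> (g * y * g) + \<theta> (g * y * k) + \<theta> (k * y * g) + \<theta> (k * y * k) = \<theta> y"
    by (subst (5) decomp[of y]) (simp only: \<theta>_add)
  finally show ?thesis unfolding \<theta>_def .
qed

text \<open>Here \<theta> interchanges the two diagonal corners and keeps the off-diagonal ones in
  place. The statement is split by degree because the minus sign of the corner actions is absent for
  two odd factors.\<close>

lemma antihom_case:
  assumes notM2: "\<not> closure_is_M2"
    and r: "\<forall>b. corner g g b \<longrightarrow> E * \<Phi> b * E = sc (r b) E"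
    and s: "\<forall>b. corner k k b \<longrightarrow> F * \<Phi> b * F = sc (s b) F"
    and \<tau>: "\<And>x. \<tau> x = r (g * x * g) + s (k * x * k)"
    and \<theta>: "\<And>x. \<theta> x = \<Phi> x - cst (\<tau> x)"
    and ev: "\<And>x. ev x = g * x * g + k * x * k" and od: "\<And>x. od x = g * x * k + k * x * g"
  shows "\<theta> (ev x * ev y) = - (\<theta> (ev y) * \<theta> (ev x))" "\<theta> (ev x * od y) = - (\<theta> (od y) * \<theta> (ev x))"
    "\<theta> (od x * ev y) = - (\<theta> (ev y) * \<theta> (od x))" "\<theta> (od x * od y) = \<theta> (od y) * \<theta> (od x)"
proof -
  interpret h: peirce_antihom j e f g k \<phi> r s by unfold_locales (use r s in blast)+
  interpret sw: peirce_antihom j f e k g \<phi> s r by (rule h.antihom_swap)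
  note swE = swap_EF
  note T = diagonal_functional[OF EF(6) r EF(7) s \<tau>]
  have \<theta>_add: "\<theta> (x + y) = \<theta> x + \<theta> y" for x y
    by (simp add: \<theta> \<Phi>_add T(1) sc_simps)
  have \<theta>gg: "\<theta> b = \<Phi> b - cst (r b)" if "corner g g b" for b by (simp add: \<theta> T(3)[OF that])
  have \<theta>kk: "\<theta> b = \<Phi> b - cst (s b)" if "corner k k b" for b by (simp add: \<theta> T(4)[OF that])
  have \<theta>gk: "\<theta> x = \<Phi> x" if "corner g k x" for x by (simp add: \<theta> T(5)[OF that])
  have \<theta>kg: "\<theta> x = \<Phi> x" if "corner k g x" for x by (simp add: \<theta> T(6)[OF that])
  have \<theta>0: "\<theta> 0 = 0" using \<theta>_add[of 0 0] by simp
  have w: "h.w x y = 0" if "corner g k x" "corner k g y" for x y by (rule h.defect_zero[OF notM2 that])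
  have gg: "\<theta> (b * c) = - (\<theta> c * \<theta> b)" if "corner g g b" "corner g g c" for b c
    using h.mult_antihom[OF that] corner_mult that by (metis \<theta>gg)
  have kk: "\<theta> (b * c) = - (\<theta> c * \<theta> b)" if "corner k k b" "corner k k c" for b c
    using sw.mult_antihom[OF that] corner_mult that by (metis \<theta>kk)
  have ggk: "\<theta> (b * x) = - (\<theta> x * \<theta> b)" if "corner g g b" "corner g k x" for b x
    using h.act_antihom(1)[OF that] corner_mult that by (metis \<theta>gg \<theta>gk)
  have kgg: "\<theta> (x * b) = - (\<theta> b * \<theta> x)" if "corner k g x" "corner g g b" for b x
    using h.act_antihom(2)[OF that(2,1)] corner_mult that by (metis \<theta>gg \<theta>kg)
  have kkg: "\<theta> (b * x) = - (\<theta> x * \<theta> b)" if "corner k k b" "corner k g x" for b x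
    using sw.act_antihom(1)[OF that] corner_mult that by (metis \<theta>kk \<theta>kg)
  have gkk: "\<theta> (x * b) = - (\<theta> b * \<theta> x)" if "corner g k x" "corner k k b" for b x
    using sw.act_antihom(2)[OF that(2,1)] corner_mult that by (metis \<theta>kk \<theta>gk)
  have gkg: "\<theta> (x * y) = \<theta> y * \<theta> x" if xy: "corner g k x" "corner k g y" for x y
    using h.odd_defect(1)[OF xy] w[OF xy] corner_mult[OF xy]
    by (simp add: \<theta>gg \<theta>gk[OF xy(1)] \<theta>kg[OF xy(2)])
  have kgk: "\<theta> (y * x) = \<theta> x * \<theta> y" if xy: "corner g k x" "corner k g y" for x y
    using h.odd_defect(2)[OF xy] w[OF xy] corner_mult[OF xy(2,1)]
    by (simp add: \<theta>kk \<theta>gk[OF xy(1)] \<theta>kg[OF xy(2)])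
  have cgg: "corner F F (\<theta> b)" if "corner g g b" for b
    using h.F_antihom[OF that] by (simp add: corner_def \<theta>gg[OF that])
  have ckk: "corner E E (\<theta> b)" if "corner k k b" for b
    using sw.F_antihom[OF that] by (simp add: corner_def \<theta>kk[OF that] swE)
  have cgk: "corner E F (\<theta> x)" if "corner g k x" for x
    using \<Phi>12[OF that] by (simp add: corner_def \<theta>gk[OF that])
  have ckg: "corner F E (\<theta> x)" if "corner k g x" for x
    using \<Phi>21[OF that] by (simp add: corner_def \<theta>kg[OF that])
  note c = corner_decomp
  have zero: "\<theta> (k * y * g) * \<theta> (g * x * g) = 0" "\<theta> (k * y * k) * \<theta> (g * x * g) = 0"
    "\<theta> (g * y * g) * \<theta> (g * x * k) = 0" "\<theta> (g * y * k) * \<theta> (g * x * k) = 0"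
    "\<theta> (k * y * g) * \<theta> (k * x * g) = 0" "\<theta> (k * y * k) * \<theta> (k * x * g) = 0"
    "\<theta> (g * y * g) * \<theta> (k * x * k) = 0" "\<theta> (g * y * k) * \<theta> (k * x * k) = 0" for x y
    by (rule corner_zero; (rule cgg ckk cgk ckg c EF)+)+
  note zero' = corner_products_zero
  have prods: "ev x * ev y = (g * x * g) * (g * y * g) + (k * x * k) * (k * y * k)"
    "ev x * od y = (g * x * g) * (g * y * k) + (k * x * k) * (k * y * g)"
    "od x * ev y = (g * x * k) * (k * y * k) + (k * x * g) * (g * y * g)"
    "od x * od y = (g * x * k) * (k * y * g) + (k * x * g) * (g * y * k)"
    unfolding ev od by (simp_all add: distrib_left distrib_right zero')
  have prods': "\<theta> (ev y) * \<theta> (ev x) = \<theta> (g * y * g) * \<theta> (g * x * g) + \<theta> (k * y * k) * \<theta> (k * x * k)"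
    "\<theta> (od y) * \<theta> (ev x) = \<theta> (g * y * k) * \<theta> (g * x * g) + \<theta> (k * y * g) * \<theta> (k * x * k)"
    "\<theta> (ev y) * \<theta> (od x) = \<theta> (k * y * k) * \<theta> (g * x * k) + \<theta> (g * y * g) * \<theta> (k * x * g)"
    "\<theta> (od y) * \<theta> (od x) = \<theta> (k * y * g) * \<theta> (g * x * k) + \<theta> (g * y * k) * \<theta> (k * x * g)"
    unfolding ev od \<theta>_add by (simp_all add: distrib_left distrib_right zero)
  show "\<theta> (ev x * ev y) = - (\<theta> (ev y) * \<theta> (ev x))"
    unfolding prods prods' \<theta>_add gg[OF c(1) c(1)] kk[OF c(4) c(4)] by simp
  show "\<theta> (ev x * od y) = - (\<theta> (od y) * \<theta> (ev x))"
    unfolding prods prods' \<theta>_add ggk[OF c(1) c(2)] kkg[OF c(4) c(3)] by simp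
  show "\<theta> (od x * ev y) = - (\<theta> (ev y) * \<theta> (od x))"
    unfolding prods prods' \<theta>_add kgg[OF c(3) c(1)] gkk[OF c(2) c(4)] by simp
  show "\<theta> (od x * od y) = \<theta> (od y) * \<theta> (od x)"
    unfolding prods prods' \<theta>_add gkg[OF c(2) c(3)] kgk[OF c(2) c(3)] ..
qed

theorem peirce_standard_form:
  assumes notM2: "\<not> closure_is_M2"
  obtains \<tau> where
    "\<And>x y. \<tau> (x + y) = \<tau> x + \<tau> y"
    "\<And>b c x. (\<And>y. \<Phi> (b * y) = sc c (\<Phi> y)) \<Longrightarrow> (\<And>y. b * y = y * b) \<Longrightarrow> \<tau> (b * x) = c * \<tau> x"
    "\<And>x. is_odd g x \<Longrightarrow> \<tau> x = 0"
    "twisted g (\<lambda>x. \<Phi> x - cst (\<tau> x))"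
proof -
  interpret sw: peirce_iso j f e k g \<phi> by (rule swap)
  note swE = swap_EF
  note swP = swap_PR
  have k: "k = 1 - g" using g_k(1) by (simp add: eq_diff_eq add.commute)
  have ev: "is_even g x \<longleftrightarrow> x = g * x * g + k * x * k" for x by (simp add: is_even_def pr0_def k)
  have od: "is_odd g x \<longleftrightarrow> x = g * x * k + k * x * g" for x by (simp add: is_odd_def pr1_def k)
  have "(\<forall>b. corner g g b \<longrightarrow> P b \<in> spn [E]) \<or> (\<forall>b. corner g g b \<longrightarrow> R b \<in> spn [F])"
    by (rule scalar_uniform)
  moreover have "(\<forall>b. corner k k b \<longrightarrow> R b \<in> spn [F]) \<or> (\<forall>b. corner k k b \<longrightarrow> P b \<in> spn [E])"
    using sw.scalar_uniform unfolding swP swE .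
  \<comment> \<open>If the same one of P and R is scalar on both diagonal corners,
    \<open>mixed_case\<close> makes the other one scalar on one of them, and a pure case
    results.\<close>
  ultimately consider
    (hom) "\<And>b. corner g g b \<Longrightarrow> R b \<in> spn [F]" "\<And>b. corner k k b \<Longrightarrow> P b \<in> spn [E]" |
    (anti) "\<And>b. corner g g b \<Longrightarrow> P b \<in> spn [E]" "\<And>b. corner k k b \<Longrightarrow> R b \<in> spn [F]"
    using mixed_case sw.mixed_case[unfolded swP swE] by blast
  then show thesis
  proof cases
    case hom
    have "\<forall>b. \<exists>r. corner g g b \<longrightarrow> R b = sc r F" "\<forall>b. \<exists>r. corner k k b \<longrightarrow> P b = sc r E"
      using hom unfolding spn_1 by blast+
    then obtain r s where r: "\<forall>b. corner g g b \<longrightarrow> F * \<Phi> b * F = sc (r b) F"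
      and s: "\<forall>b. corner k k b \<longrightarrow> E * \<Phi> b * E = sc (s b) E"
      unfolding P_def R_def by metis
    define \<tau> where "\<tau> x = r (g * x * g) + s (k * x * k)" for x
    note T = diagonal_functional[OF EF(7) r EF(6) s \<tau>_def]
    show thesis
    proof (rule that[of \<tau>])
      show "\<tau> x = 0" if "is_odd g x" for x
        using arg_cong[OF iffD1[OF od that], of \<tau>] T(1)[of "g * x * k" "k * x * g"]
          T(5)[OF corner_decomp(2)] T(6)[OF corner_decomp(3)] by simp
    qed (use T(1,2) hom_case[OF notM2 r s \<tau>_def] in \<open>auto simp: twisted_def\<close>)
  next
    case anti
    have "\<forall>b. \<exists>r. corner g g b \<longrightarrow> P b = sc r E" "\<forall>b. \<exists>r. corner k k b \<longrightarrow> R b = sc r F"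
      using anti unfolding spn_1 by blast+
    then obtain r s where r: "\<forall>b. corner g g b \<longrightarrow> E * \<Phi> b * E = sc (r b) E"
      and s: "\<forall>b. corner k k b \<longrightarrow> F * \<Phi> b * F = sc (s b) F"
      unfolding P_def R_def by metis
    define \<tau> where "\<tau> x = r (g * x * g) + s (k * x * k)" for x
    note T = diagonal_functional[OF EF(6) r EF(7) s \<tau>_def]
    define \<theta> where "\<theta> x = \<Phi> x - cst (\<tau> x)" for x
    note A = antihom_case[OF notM2 r s \<tau>_def \<theta>_def refl refl]
    have zero: "x = 0" if "is_even g x" "is_odd g x" for x
    proof -
      have "x = g * x * k + k * x * g" using that(2) by (simp only: od)
      moreover have "g * x * k = g * (g * x * g + k * x * k) * k" "k * x * g = k * (g * x * g + k * x * k) * g"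
        using that(1) unfolding ev by metis+
      moreover have "g * (g * x * g + k * x * k) * k = 0" "k * (g * x * g + k * x * k) * g = 0"
        using g_k by (simp_all add: distrib_left distrib_right mult.assoc)
          (simp_all add: mult.assoc[symmetric])
      ultimately show ?thesis by simp
    qed
    have \<theta>0: "\<theta> 0 = 0" using T(1)[of 0 0] by (simp add: \<theta>_def \<Phi>_zero)
    have evE: "g * x * g + k * x * k = x" if "is_even g x" for x
      by (rule iffD1[OF ev that, symmetric])
    have odE: "g * x * k + k * x * g = x" if "is_odd g x" for x
      by (rule iffD1[OF od that, symmetric])
    show thesis
    proof (rule that[of \<tau>])
      show "\<tau> x = 0" if "is_odd g x" for x
        using arg_cong[OF iffD1[OF od that], of \<tau>] T(1)[of "g * x * k" "k * x * g"]
          T(5)[OF corner_decomp(2)] T(6)[OF corner_decomp(3)] by simp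
      have "\<theta> (x * y) = (if is_odd g x \<and> is_odd g y then \<theta> y * \<theta> x else - (\<theta> y * \<theta> x))"
        if x: "is_even g x \<or> is_odd g x" and y: "is_even g y \<or> is_odd g y" for x y
      proof -
        consider "is_odd g x" "is_odd g y" | "is_even g x" "is_odd g y" "\<not> is_odd g x"
          | "is_odd g x" "is_even g y" "\<not> is_odd g y"
          | "is_even g x" "is_even g y" "\<not> is_odd g x"
          using x y by blast
        then show ?thesis
        proof cases
          case 1
          show ?thesis using A(4)[of x y] 1 unfolding odE[OF 1(1)] odE[OF 1(2)] by simp
        next
          case 2
          show ?thesis using A(2)[of x y] 2 unfolding evE[OF 2(1)] odE[OF 2(2)] by simp
        next
          case 3
          show ?thesis using A(3)[of x y] 3 unfolding odE[OF 3(1)] evE[OF 3(2)] by simp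
        next
          case 4
          show ?thesis using A(1)[of x y] 4 unfolding evE[OF 4(1)] evE[OF 4(2)] by simp
        qed
      qed
      then show "twisted g (\<lambda>x. \<Phi> x - cst (\<tau> x))"
        unfolding twisted_def \<theta>_def by blast
    qed (use T(1,2) in blast)+
  qed
qed

end

section \<open>Superisomorphisms\<close>

lemma pr0_add_pr1: "pr0 e x + pr1 e x = x"
  by (simp add: pr0_def pr1_def algebra_simps)

lemma pr_pr:
  assumes "idem e"
  shows "pr0 e (pr0 e x) = pr0 e x" "pr0 e (pr1 e x) = 0" "pr1 e (pr1 e x) = pr1 e x"
    "pr1 e (pr0 e x) = 0"
proof -
  have "e * e = e" using assms by (simp add: idem_def)
  then have "e * (e * z) = e * z" for z by (metis mult.assoc)
  with \<open>e * e = e\<close> show "pr0 e (pr0 e x) = pr0 e x" "pr0 e (pr1 e x) = 0" "pr1 e (pr1 e x) = pr1 e x"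
    "pr1 e (pr0 e x) = 0"
    by (simp_all add: pr0_def pr1_def algebra_simps)
qed

lemma even_odd_zero: "idem e \<Longrightarrow> is_even e x \<Longrightarrow> is_odd e x \<Longrightarrow> x = 0"
  using pr_pr(2)[of e x] unfolding is_even_def is_odd_def by metis

lemma is_even_pr0: "idem e \<Longrightarrow> is_even e (pr0 e x)" and is_odd_pr1: "idem e \<Longrightarrow> is_odd e (pr1 e x)"
  by (simp_all add: is_even_def is_odd_def pr_pr)

lemma pr_even: "idem e \<Longrightarrow> is_even e x \<Longrightarrow> pr0 e x = x" "idem e \<Longrightarrow> is_even e x \<Longrightarrow> pr1 e x = 0"
  and pr_odd: "idem e \<Longrightarrow> is_odd e x \<Longrightarrow> pr1 e x = x" "idem e \<Longrightarrow> is_odd e x \<Longrightarrow> pr0 e x = 0"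
  using pr_pr[of e x] unfolding is_even_def is_odd_def by metis+

lemma scomm_even:
  assumes "idem e" "is_even e x"
  shows "scomm e x y = x * y - y * x"
proof -
  have "scomm e x y = x * (pr0 e y + pr1 e y) - (pr0 e y + pr1 e y) * x"
    unfolding scomm_def pr_even[OF assms] by (simp add: algebra_simps)
  then show ?thesis by (simp only: pr0_add_pr1)
qed

lemma scomm_odd: "idem e \<Longrightarrow> is_odd e x \<Longrightarrow> is_odd e y \<Longrightarrow> scomm e x y = x * y + y * x"
  unfolding scomm_def by (simp add: pr_odd)

lemma is_even_add: "is_even e x \<Longrightarrow> is_even e y \<Longrightarrow> is_even e (x + y)"
  and is_odd_add: "is_odd e x \<Longrightarrow> is_odd e y \<Longrightarrow> is_odd e (x + y)"
  and is_even_minus: "is_even e x \<Longrightarrow> is_even e (- x)"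
  and is_odd_minus: "is_odd e x \<Longrightarrow> is_odd e (- x)"
proof -
  have "pr0 e (x + y) = pr0 e x + pr0 e y" "pr1 e (x + y) = pr1 e x + pr1 e y"
    "pr0 e (- x) = - pr0 e x" "pr1 e (- x) = - pr1 e x"
    by (simp_all add: pr0_def pr1_def algebra_simps)
  then show "is_even e x \<Longrightarrow> is_even e y \<Longrightarrow> is_even e (x + y)"
    "is_odd e x \<Longrightarrow> is_odd e y \<Longrightarrow> is_odd e (x + y)"
    "is_even e x \<Longrightarrow> is_even e (- x)" "is_odd e x \<Longrightarrow> is_odd e (- x)"
    by (simp_all add: is_even_def is_odd_def)
qed

locale superiso = quotients_half j for j :: "'a::ring_1 \<Rightarrow> 'q::ring_1" +
  fixes \<iota>A :: "'f::field \<Rightarrow> 'a" and \<iota>B :: "'f \<Rightarrow> 'b::ring_1" and eA :: 'a and eB :: 'b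
    and \<phi> :: "'b \<Rightarrow> 'a"
  assumes algA: "F_alg \<iota>A" and algB: "F_alg \<iota>B" and idA: "idem eA" and idB: "idem eB"
    and lie: "lie_superiso \<iota>B eB \<iota>A eA \<phi>"
begin

lemma \<phi>_bij: "bij \<phi>" and \<phi>_add: "\<phi> (x + y) = \<phi> x + \<phi> y"
  and \<phi>_smult: "\<phi> (\<iota>B c * x) = \<iota>A c * \<phi> x"
  and \<phi>_even: "is_even eB x \<Longrightarrow> is_even eA (\<phi> x)"
  and \<phi>_odd: "is_odd eB x \<Longrightarrow> is_odd eA (\<phi> x)"
  and \<phi>_scomm: "\<phi> (scomm eB x y) = scomm eA (\<phi> x) (\<phi> y)"
  using lie by (simp_all add: lie_superiso_def F_lin_def graded_def)

lemma \<phi>_zero: "\<phi> 0 = 0"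
  using \<phi>_add[of 0 0] by simp

lemma \<phi>_minus: "\<phi> (- x) = - \<phi> x"
  using \<phi>_add[of x "- x"] \<phi>_zero by (simp add: eq_neg_iff_add_eq_0 add.commute)

lemma \<phi>_bracket_even: "is_even eB x \<Longrightarrow> \<phi> (x * y - y * x) = \<phi> x * \<phi> y - \<phi> y * \<phi> x"
  using \<phi>_scomm[of x y] by (simp add: scomm_even idA idB \<phi>_even)

lemma \<phi>_bracket_odd: "is_odd eB x \<Longrightarrow> is_odd eB y \<Longrightarrow> \<phi> (x * y + y * x) = \<phi> x * \<phi> y + \<phi> y * \<phi> x"
  using \<phi>_scomm[of x y] by (simp add: scomm_odd idA idB \<phi>_odd)

text \<open>The component of the wrong degree has an image that is both even and odd, hence 0, and
  \<phi> is injective.\<close>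

lemma \<phi>_reflects:
  shows "is_even eA (\<phi> x) \<Longrightarrow> is_even eB x" and "is_odd eA (\<phi> x) \<Longrightarrow> is_odd eB x"
proof -
  have inj: "y = 0" if "\<phi> y = 0" for y
    using \<phi>_bij \<phi>_zero that by (metis bij_pointE)
  have x: "\<phi> x = \<phi> (pr0 eB x) + \<phi> (pr1 eB x)" unfolding \<phi>_add[symmetric] pr0_add_pr1 ..
  have even: "is_even eA (\<phi> (pr0 eB x))" and odd: "is_odd eA (\<phi> (pr1 eB x))"
    by (simp_all add: \<phi>_even \<phi>_odd is_even_pr0 is_odd_pr1 idB)
  show "is_even eB x" if "is_even eA (\<phi> x)"
  proof -
    have "\<phi> (pr1 eB x) = \<phi> x + - \<phi> (pr0 eB x)" using x by simp
    then have "is_even eA (\<phi> (pr1 eB x))" using is_even_add[OF that is_even_minus[OF even]] by simp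
    then have "pr1 eB x = 0" using even_odd_zero[OF idA _ odd] inj by blast
    then show ?thesis using pr0_add_pr1[of eB x] by (simp add: is_even_def)
  qed
  show "is_odd eB x" if "is_odd eA (\<phi> x)"
  proof -
    have "\<phi> (pr0 eB x) = \<phi> x + - \<phi> (pr1 eB x)" using x by simp
    then have "is_odd eA (\<phi> (pr0 eB x))" using is_odd_add[OF that is_odd_minus[OF odd]] by simp
    then have "pr0 eB x = 0" using even_odd_zero[OF idA even] inj by blast
    then show ?thesis using pr0_add_pr1[of eB x] by (simp add: is_odd_def)
  qed
qed

lemma j_even: "is_even eA x \<Longrightarrow> is_even (j eA) (j x)" and j_odd: "is_odd eA x \<Longrightarrow> is_odd (j eA) (j x)"
  unfolding is_even_def is_odd_def pr0_def pr1_def by (metis j_add j_diff j_mult j_one)+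

lemma cst_even: "is_even (j eA) (cst c)"
proof -
  have "j eA * j eA = j eA" using idA unfolding idem_def by (metis j_mult)
  then show ?thesis by (simp add: is_even_def pr0_def scalg)
qed

text \<open>\<phi> and \<theta> agree on supercommutators: \<theta> obeys the same bracket law, and
  the scalar parts drop out of the right-hand side, by centrality in commutators and because \<tau>
  is 0 on odd elements in the remaining case.\<close>

lemma scalar_part_vanishes:
  assumes add: "\<And>x y. \<tau> (x + y) = \<tau> x + \<tau> y"
    and smult: "\<And>c x. j (\<iota>A c) * cst (\<tau> x) = cst (\<tau> (\<iota>B c * x))"
    and odd: "\<And>x. is_odd eB x \<Longrightarrow> \<tau> x = 0"
    and tw: "twisted eB (\<lambda>x. j (\<phi> x) - cst (\<tau> x))"
    and mem: "x \<in> scomm_span \<iota>B eB"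
  shows "\<tau> x = 0"
proof -
  define \<theta> where "\<theta> x = j (\<phi> x) - cst (\<tau> x)" for x
  have \<theta>_add: "\<theta> (x + y) = \<theta> x + \<theta> y" for x y
    by (simp add: \<theta>_def \<phi>_add add sc_simps)
  have \<tau>0: "\<tau> 0 = 0" using add[of 0 0] by simp
  have \<theta>0: "\<theta> 0 = 0" by (simp add: \<theta>_def \<phi>_zero \<tau>0)
  have \<theta>_minus: "\<theta> (- x) = - \<theta> x" for x
    using \<theta>_add[of x "- x"] \<theta>0 by (simp add: eq_neg_iff_add_eq_0 add.commute)
  have kill: "\<tau> x = 0" if "\<theta> x = j (\<phi> x)" for x
  proof -
    have "cst (\<tau> x) = cst 0" using that by (simp add: \<theta>_def)
    then show ?thesis by (simp only: cst_cancel)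
  qed
  note tw' = tw[unfolded twisted_def, folded \<theta>_def]
  have even: "\<tau> (x * y - y * x) = 0" if x: "is_even eB x" and y: "is_even eB y \<or> is_odd eB y" for x y
  proof (rule kill)
    have "\<theta> (x * y) - \<theta> (y * x) = \<theta> x * \<theta> y - \<theta> y * \<theta> x"
      using tw'
    proof
      assume *: "\<forall>x y. (is_even eB x \<or> is_odd eB x) \<and> (is_even eB y \<or> is_odd eB y) \<longrightarrow>
       \<theta> (x * y) = (if is_odd eB x \<and> is_odd eB y then \<theta> y * \<theta> x else - (\<theta> y * \<theta> x))"
      \<comment> \<open>The sign in \<open>twisted\<close> is decided by oddness alone. Only x = 0
        is both even and odd, and there both sides vanish.\<close>
      show ?thesis
      proof (cases "is_odd eB x")
        case True
        then have "x = 0" using even_odd_zero[OF idB x] by blast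
        then show ?thesis by (simp add: \<theta>0)
      next
        case False
        then have "\<theta> (x * y) = - (\<theta> y * \<theta> x)" "\<theta> (y * x) = - (\<theta> x * \<theta> y)" using * x y by auto
        then show ?thesis by simp
      qed
    qed simp
    moreover have "\<theta> (x * y - y * x) = \<theta> (x * y) - \<theta> (y * x)"
      using \<theta>_add[of "x * y" "- (y * x)"] by (simp add: \<theta>_minus)
    moreover have "\<theta> x * \<theta> y - \<theta> y * \<theta> x = cm (j (\<phi> x)) (j (\<phi> y))"
      by (simp add: \<theta>_def scalg)
    ultimately show "\<theta> (x * y - y * x) = j (\<phi> (x * y - y * x))"
      by (simp add: \<phi>_bracket_even[OF x])
  qed
  have odd_odd: "\<tau> (x * y + y * x) = 0" if x: "is_odd eB x" and y: "is_odd eB y" for x y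
  proof (rule kill)
    have "\<theta> (x * y) + \<theta> (y * x) = \<theta> x * \<theta> y + \<theta> y * \<theta> x"
      using tw' x y by (auto simp: add.commute)
    moreover have "\<theta> x = j (\<phi> x)" "\<theta> y = j (\<phi> y)" by (simp_all add: \<theta>_def odd x y)
    ultimately show "\<theta> (x * y + y * x) = j (\<phi> (x * y + y * x))"
      by (simp add: \<theta>_add \<phi>_bracket_odd[OF x y])
  qed
  show "\<tau> x = 0" using mem
  proof induction
    case (gen x y)
    note h = is_even_pr0[OF idB] is_odd_pr1[OF idB]
    have swap: "\<tau> (pr1 eB x * pr0 eB y - pr0 eB y * pr1 eB x) = 0"
    proof -
      have "\<tau> (pr1 eB x * pr0 eB y - pr0 eB y * pr1 eB x)
        + \<tau> (pr0 eB y * pr1 eB x - pr1 eB x * pr0 eB y) = \<tau> 0"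
        unfolding add[symmetric] by simp
      then show ?thesis using even[OF h(1), of "pr1 eB x" y] h \<tau>0 by simp
    qed
    have "\<tau> (pr1 eB x * pr1 eB y) + \<tau> (pr1 eB y * pr1 eB x) = 0"
      unfolding add[symmetric] by (rule odd_odd[OF h(2) h(2)])
    then show ?case unfolding scomm_def add using even swap h by simp
  next
    case (smult x c)
    have "cst (\<tau> (\<iota>B c * x)) = j (\<iota>A c) * cst (\<tau> x)" by (rule assms(2)[symmetric])
    also have "\<dots> = cst 0" using smult by simp
    finally have "cst (\<tau> (\<iota>B c * x)) = cst 0" .
    then show ?case by (simp only: cst_cancel)
  qed (simp_all add: \<tau>0 add)
qed

lemma assemble:
  assumes add: "\<And>x y. \<tau> (x + y) = \<tau> x + \<tau> y"
    and smult: "\<And>b c x. (\<And>y. j (\<phi> (b * y)) = sc c (j (\<phi> y))) \<Longrightarrow> (\<And>y. b * y = y * b) \<Longrightarrow>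
      \<tau> (b * x) = c * \<tau> x"
    and odd: "\<And>x. is_odd eB x \<Longrightarrow> \<tau> x = 0"
    and tw: "twisted eB (\<lambda>x. j (\<phi> x) - cst (\<tau> x))"
  shows "\<exists>\<theta> \<tau>. (\<forall>x. j (\<phi> x) = \<theta> x + \<tau> x)
      \<and> (\<forall>x. \<theta> x \<in> central_closure j)
      \<and> (superhom \<iota>B eB (j \<circ> \<iota>A) (j eA) \<theta>
         \<or> superantihom \<iota>B eB (j \<circ> \<iota>A) (j eA) (\<lambda>x. - \<theta> x))
      \<and> (\<forall>x. \<tau> x \<in> (ring_center :: 'q set))
      \<and> F_lin \<iota>B (j \<circ> \<iota>A) \<tau>
      \<and> (\<forall>x\<in>scomm_span \<iota>B eB. \<tau> x = 0)"
proof (intro exI conjI)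
  define \<theta> where "\<theta> x = j (\<phi> x) - cst (\<tau> x)" for x
  define \<sigma> where "\<sigma> x = cst (\<tau> x)" for x
  show "\<forall>x. j (\<phi> x) = \<theta> x + \<sigma> x" by (simp add: \<theta>_def \<sigma>_def)
  have center: "cst c \<in> ring_center" for c :: "'q center" unfolding cst_eq_Rep by (rule Rep_center)
  have "j (\<phi> x) + - cst (\<tau> x) \<in> central_closure j" for x
    by (intro central_closure.add central_closure.emb central_closure.neg central_closure.cen center)
  then show "\<forall>x. \<theta> x \<in> central_closure j" by (simp add: \<theta>_def)
  show "\<forall>x. \<sigma> x \<in> ring_center" by (simp add: \<sigma>_def center)
  have smult': "j (\<iota>A c) * cst (\<tau> x) = cst (\<tau> (\<iota>B c * x))" for c x
  proof -
    \<comment> \<open>F lies in the centre of A, hence in the centre of Q, so it acts through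
      scalars.\<close>
    have "j (\<iota>A c) * j r = j r * j (\<iota>A c)" for r
      using algA unfolding F_alg_def by (metis j_mult)
    then obtain c' where c': "j (\<iota>A c) = cst c'" using centralizer_of_image by blast
    have "\<tau> (\<iota>B c * x) = c' * \<tau> x"
    proof (rule smult)
      show "j (\<phi> (\<iota>B c * y)) = sc c' (j (\<phi> y))" for y by (simp add: \<phi>_smult c' sc_simps)
      show "\<iota>B c * y = y * \<iota>B c" for y using algB by (simp add: F_alg_def)
    qed
    then show ?thesis by (simp add: c' sc_simps mult.commute)
  qed
  then show \<sigma>_lin: "F_lin \<iota>B (j \<circ> \<iota>A) \<sigma>"
    by (simp add: F_lin_def \<sigma>_def add sc_simps(4))
  have \<theta>_lin: "F_lin \<iota>B (j \<circ> \<iota>A) \<theta>"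
    using smult' by (simp add: F_lin_def \<theta>_def \<phi>_add \<phi>_smult add sc_simps(4) right_diff_distrib)
  have \<theta>_graded: "graded eB (j eA) \<theta>"
    unfolding graded_def
  proof (intro allI conjI impI)
    fix x
    show "is_even (j eA) (\<theta> x)" if "is_even eB x"
      using is_even_add[OF j_even[OF \<phi>_even[OF that]] is_even_minus[OF cst_even[of "\<tau> x"]]]
      by (simp add: \<theta>_def)
    show "is_odd (j eA) (\<theta> x)" if "is_odd eB x"
      using j_odd[OF \<phi>_odd[OF that]] by (simp add: \<theta>_def odd[OF that])
  qed
  from tw consider (hom) "\<forall>x y. \<theta> (x * y) = \<theta> x * \<theta> y"
    | (anti) "\<forall>x y. (is_even eB x \<or> is_odd eB x) \<and> (is_even eB y \<or> is_odd eB y) \<longrightarrow>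
       \<theta> (x * y) = (if is_odd eB x \<and> is_odd eB y then \<theta> y * \<theta> x else - (\<theta> y * \<theta> x))"
    unfolding twisted_def \<theta>_def by blast
  then show "superhom \<iota>B eB (j \<circ> \<iota>A) (j eA) \<theta> \<or> superantihom \<iota>B eB (j \<circ> \<iota>A) (j eA) (\<lambda>x. - \<theta> x)"
  proof cases
    case hom
    then show ?thesis using \<theta>_lin \<theta>_graded by (simp add: superhom_def)
  next
    case anti
    have "F_lin \<iota>B (j \<circ> \<iota>A) (\<lambda>x. - \<theta> x)" using \<theta>_lin by (simp add: F_lin_def)
    moreover have "graded eB (j eA) (\<lambda>x. - \<theta> x)"
      using \<theta>_graded is_even_minus is_odd_minus unfolding graded_def by blast
    ultimately show ?thesis using anti by (simp add: superantihom_def)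
  qed
  show "\<forall>x\<in>scomm_span \<iota>B eB. \<sigma> x = 0"
    using scalar_part_vanishes[OF add smult' odd tw] by (simp add: \<sigma>_def)
qed

text \<open>All of A is even, and since \<phi> reflects degrees so is B, whatever \<open>eB\<close>
  may be. Thus \<phi> is an ordinary Lie isomorphism.\<close>

lemma trivial_grading:
  assumes "eA = 0 \<or> eA = 1"
  obtains \<tau> where
    "\<And>x y. \<tau> (x + y) = \<tau> x + \<tau> y"
    "\<And>b c x. (\<And>y. j (\<phi> (b * y)) = sc c (j (\<phi> y))) \<Longrightarrow> \<tau> (b * x) = c * \<tau> x"
    "\<And>x. is_odd eB x \<Longrightarrow> \<tau> x = 0" "twisted eB (\<lambda>x. j (\<phi> x) - cst (\<tau> x))"
proof -
  have evenA: "is_even eA x" for x using assms by (auto simp: is_even_def pr0_def)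
  have even: "is_even eB x" for x by (rule \<phi>_reflects(1)[OF evenA])
  interpret L: lie_iso j \<phi>
    by unfold_locales (simp_all add: \<phi>_bij \<phi>_add \<phi>_bracket_even[OF even])
  obtain \<tau> where 1: "hom_or_neg_antihom (\<lambda>x. L.\<Phi> x - cst (\<tau> x))"
    and 2: "\<And>x y. \<tau> (x + y) = \<tau> x + \<tau> y"
    and 3: "\<And>r c x. (\<And>y. L.\<Phi> (r * y) = sc c (L.\<Phi> y)) \<Longrightarrow> \<tau> (r * x) = c * \<tau> x"
    by (rule L.standard_form) blast
  have zero: "x = 0" if "is_odd eB x" for x using even_odd_zero[OF idB even that] .
  have \<tau>0: "\<tau> 0 = 0" using 2[of 0 0] by simp
  show thesis
  proof (rule that[of \<tau>])
    show "twisted eB (\<lambda>x. j (\<phi> x) - cst (\<tau> x))"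
      using 1
    proof
      assume "\<forall>x y. L.\<Phi> (x * y) - cst (\<tau> (x * y)) = - ((L.\<Phi> y - cst (\<tau> y)) * (L.\<Phi> x - cst (\<tau> x)))"
      then show ?thesis unfolding twisted_def L.\<Phi>_def
        by (intro disjI2) (auto dest!: zero simp: \<phi>_zero \<tau>0)
    qed (simp add: twisted_def L.\<Phi>_def)
    show "\<tau> (b * x) = c * \<tau> x" if "\<And>y. j (\<phi> (b * y)) = sc c (j (\<phi> y))" for b c x
      by (rule 3) (simp only: L.\<Phi>_def that)
  qed (use 2 zero \<tau>0 in blast)+
qed

text \<open>The map ad e is the identity on e A (1 - e) and minus the identity on (1 - e) A e, and
  similarly in B. Since u = \<phi>(eB) is diagonal and scalar on both corners, (ad u)^2 = 1 on odd
  elements leaves ad u = ad e or ad u = - ad e there.\<close>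
lemma nontrivial_grading:
  assumes "eA \<noteq> 0" "eA \<noteq> 1"
  shows "peirce_iso j eA (1 - eA) eB (1 - eB) \<phi> \<or> peirce_iso j (1 - eA) eA eB (1 - eB) \<phi>"
proof -
  define e f g k where "e = eA" and "f = 1 - eA" and "g = eB" and "k = 1 - eB"
  have ee: "e * e = e" and gg: "g * g = g" using idA idB by (simp_all add: idem_def e_def g_def)
  have ef: "e + f = 1" "e * f = 0" "f * e = 0" "f * f = f" "e \<noteq> 0" "f \<noteq> 0"
    using ee assms by (simp_all add: e_def f_def algebra_simps)
  have gk: "g + k = 1" "g * k = 0" "k * g = 0" "k * k = k"
    using gg by (simp_all add: g_def k_def algebra_simps)
  have evA: "is_even eA x \<longleftrightarrow> x = e * x * e + f * x * f" for x by (simp add: is_even_def pr0_def e_def f_def)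
  have odA: "is_odd eA x \<longleftrightarrow> x = e * x * f + f * x * e" for x by (simp add: is_odd_def pr1_def e_def f_def)
  have evB: "is_even eB x \<longleftrightarrow> x = g * x * g + k * x * k" for x by (simp add: is_even_def pr0_def g_def k_def)
  have odB: "is_odd eB x \<longleftrightarrow> x = g * x * k + k * x * g" for x by (simp add: is_odd_def pr1_def g_def k_def)
  have off: "p' * x * q' = 0" if "corner p q x" "p' * p = 0 \<or> q * q' = 0" for p q p' q' x :: 'b
    using that unfolding corner_def by (metis mult.assoc mult_zero_left mult_zero_right)
  have on: "p * x * q = x" if "corner p q x" for p q x :: 'b using that by (simp add: corner_def)
  have evgg: "is_even eB x" if "corner g g x" for x unfolding evB on[OF that] using off[OF that] gk by simp
  have evkk: "is_even eB x" if "corner k k x" for x unfolding evB on[OF that] using off[OF that] gk by simp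
  have odgk: "is_odd eB x" if "corner g k x" for x unfolding odB on[OF that] using off[OF that] gk by simp
  have odkg: "is_odd eB x" if "corner k g x" for x unfolding odB on[OF that] using off[OF that] gk by simp
  have aef: "e * (e * z) = e * z" "e * (f * z) = 0" "f * (e * z) = 0" "f * (f * z) = f * z" for z
    using ee ef by (simp_all add: mult.assoc[symmetric])
  have diag: "e * \<phi> b * f = 0" "f * \<phi> b * e = 0" if "is_even eB b" for b
  proof -
    have eq: "\<phi> b = e * \<phi> b * e + f * \<phi> b * f" using \<phi>_even[OF that] unfolding evA .
    have "e * (e * \<phi> b * e + f * \<phi> b * f) * f = 0" "f * (e * \<phi> b * e + f * \<phi> b * f) * e = 0"
      using ef by (simp_all add: distrib_left distrib_right mult.assoc aef)
    then show "e * \<phi> b * f = 0" "f * \<phi> b * e = 0" using eq by simp_all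
  qed
  define E F U where "E = j e" and "F = j f" and "U = j (\<phi> g)"
  have EF: "E + F = 1" "E * F = 0" "F * E = 0" "E * E = E" "F * F = F" "E \<noteq> 0" "F \<noteq> 0"
    using ef ee by (simp_all add: E_def F_def flip: j_add j_mult)
  have aEF: "E * (E * z) = E * z" "E * (F * z) = 0" "F * (E * z) = 0" "F * (F * z) = F * z" for z
    using EF by (simp_all add: mult.assoc[symmetric])
  have g_even: "is_even eB g" by (rule evgg) (simp add: corner_def gg)
  \<comment> \<open>The idempotent g commutes with the even elements of B, and these map onto the
    even elements of A.\<close>
  have Ucomm: "U * j a = j a * U" if "is_even eA a" for a
  proof -
    obtain b where b: "\<phi> b = a" using \<phi>_bij by (metis bij_pointE)
    then have "is_even eB b" using \<phi>_reflects(1) that by blast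
    then have bb: "b = g * b * g + k * b * k" unfolding evB .
    have "g * (g * b * g + k * b * k) = (g * b * g + k * b * k) * g"
      using gk gg by (simp add: distrib_left distrib_right mult.assoc) (simp add: mult.assoc[symmetric])
    then have "g * b = b * g" using bb by simp
    then have "cm U (j a) = j (\<phi> 0)" using \<phi>_bracket_even[OF g_even, of b] b
      by (simp add: U_def flip: j_mult j_diff)
    then show ?thesis by (simp add: \<phi>_zero)
  qed
  \<comment> \<open>All hzh are even, so the compression of U to the corner of h commutes with them;
    an element that commutes with the whole corner is scalar there.\<close>
  have corner_scalar: "j h * U * j h \<in> spn [j h]"
    if h: "h * h = h" "h \<noteq> 0" and ev: "\<And>z. is_even eA (h * z * h)" for h
  proof (rule ccontr)
    assume nin: "j h * U * j h \<notin> spn [j h]"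
    have hh: "j h * j h = j h" "j h * (j h * q) = j h * q" for q
      using h(1) by (metis j_mult, metis j_mult mult.assoc)
    have "j h = 0"
    proof (rule martindale_0[OF nin, of "[- (j h * U * j h)]"])
      fix z
      from Ucomm[OF ev[of z]] have "j h * (U * (j h * j z * j h)) * j h = j h * (j h * j z * j h * U) * j h"
        by simp
      then show "j h * U * j h * j z * j h + lin [j h] [- (j h * U * j h)] (j z) = 0"
        by (simp add: mult.assoc hh)
    qed simp
    then show False using h(2) by simp
  qed
  have "E * U * E \<in> spn [E]" unfolding E_def
    by (rule corner_scalar[OF ee ef(5)]) (unfold evA, simp add: mult.assoc aef ef ee)
  moreover have "F * U * F \<in> spn [F]" unfolding F_def
    by (rule corner_scalar[OF ef(4,6)]) (unfold evA, simp add: mult.assoc aef ef ee)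
  ultimately obtain l m where lm: "E * U * E = sc l E" "F * U * F = sc m F" unfolding spn_1 by blast
  have "\<phi> g = e * \<phi> g * e + f * \<phi> g * f" using \<phi>_even[OF g_even] unfolding evA .
  then have "U = E * U * E + F * U * F" unfolding U_def E_def F_def by (metis j_add j_mult)
  then have U: "U = sc l E + sc m F" unfolding lm .
  have adU: "cm U q = sc (l - m) (E * q * F) - sc (l - m) (F * q * E)" if "q = E * q * F + F * q * E" for q
  proof -
    have "cm U (E * q * F + F * q * E) = sc (l - m) (E * q * F) - sc (l - m) (F * q * E)"
      unfolding U by (simp add: scalg aEF EF)
    then show ?thesis using that by simp
  qed
  have ad: "cm U (j (\<phi> x)) = j (\<phi> (g * x * k)) - j (\<phi> (k * x * g))" if "is_odd eB x" for x
  proof -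
    have x: "x = g * x * k + k * x * g" using that unfolding odB .
    have "g * (g * x * k + k * x * g) - (g * x * k + k * x * g) * g = g * x * k + - (k * x * g)"
      using gk gg by (simp add: distrib_left distrib_right mult.assoc) (simp add: mult.assoc[symmetric])
    then have "g * x - x * g = g * x * k + - (k * x * g)" using x by simp
    then have "\<phi> (g * x * k + - (k * x * g)) = \<phi> g * \<phi> x - \<phi> x * \<phi> g"
      using \<phi>_bracket_even[OF g_even, of x] by simp
    then have "\<phi> g * \<phi> x - \<phi> x * \<phi> g = \<phi> (g * x * k) + - \<phi> (k * x * g)"
      unfolding \<phi>_add \<phi>_minus ..
    then show ?thesis by (simp add: U_def flip: j_mult j_diff)
  qed
  have oddQ: "j (\<phi> x) = E * j (\<phi> x) * F + F * j (\<phi> x) * E" if "is_odd eB x" for x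
    using \<phi>_odd[OF that] unfolding odA E_def F_def by (metis j_add j_mult)
  have gkx: "sc (l - m) (E * j (\<phi> x) * F) - sc (l - m) (F * j (\<phi> x) * E) = j (\<phi> x)"
    if "corner g k x" for x
  proof -
    have "k * x * g = 0" using off[OF that] gk by simp
    then show ?thesis
      using ad[OF odgk[OF that]] adU[OF oddQ[OF odgk[OF that]]] on[OF that] by (simp add: \<phi>_zero)
  qed
  have kgx: "sc (l - m) (E * j (\<phi> x) * F) - sc (l - m) (F * j (\<phi> x) * E) = - j (\<phi> x)"
    if "corner k g x" for x
  proof -
    have "g * x * k = 0" using off[OF that] gk by simp
    then show ?thesis
      using ad[OF odkg[OF that]] adU[OF oddQ[OF odkg[OF that]]] on[OF that] by (simp add: \<phi>_zero)
  qed
  \<comment> \<open>The alternatives are the shapes that \<open>gkx\<close> takes for l - m = 1 and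
    \<open>kgx\<close> takes for l - m = -1. In \<open>to_fe\<close> the two roles are
    exchanged.\<close>
  have to_ef: "corner e f y" if sum: "j y = E * j y * F + F * j y * E"
    and diff: "E * j y * F - F * j y * E = j y \<or> - (E * j y * F) - - (F * j y * E) = - j y" for y
  proof -
    define p q where "p = E * j y * F" and "q = F * j y * E"
    have "q = 0"
    proof (rule double_cancel)
      have "q + q = j y - (p - q)" using sum[folded p_def q_def] by simp
      moreover have "- p - - q = - (p - q)" by simp
      then have "p - q = j y" using diff[folded p_def q_def] by (metis minus_minus)
      ultimately show "q + q = 0 + 0" by simp
    qed
    then have "j y = j (e * y * f)" using sum by (simp add: q_def E_def F_def)
    then have "y = e * y * f" by (simp only: j_eq_iff)
    then show ?thesis using ee ef unfolding corner_def by (metis mult.assoc)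
  qed
  have to_fe: "corner f e y" if sum: "j y = E * j y * F + F * j y * E"
    and diff: "E * j y * F - F * j y * E = - j y \<or> - (E * j y * F) - - (F * j y * E) = j y" for y
  proof -
    define p q where "p = E * j y * F" and "q = F * j y * E"
    have "p = 0"
    proof (rule double_cancel)
      have "p + p = j y + (p - q)" using sum[folded p_def q_def] by simp
      moreover have "- p - - q = - (p - q)" by simp
      then have "p - q = - j y" using diff[folded p_def q_def] by (metis minus_minus)
      ultimately show "p + p = 0 + 0" by simp
    qed
    then have "j y = j (f * y * e)" using sum by (simp add: p_def E_def F_def)
    then have "y = f * y * e" by (simp only: j_eq_iff)
    then show ?thesis using ee ef unfolding corner_def by (metis mult.assoc)
  qed
  have "(l - m) * (l - m) = 1"
  proof -
    obtain z where z: "e * z * f \<noteq> 0" using primeD[of e f] ef by blast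
    obtain x where x: "\<phi> x = e * z * f" using \<phi>_bij by (metis bij_pointE)
    have "is_odd eA (e * z * f)" unfolding odA using ee ef by (simp add: mult.assoc aef)
    then have xo: "is_odd eB x" using \<phi>_reflects(2) x by simp
    have c: "corner g k (g * x * k)" "corner k g (k * x * g)"
      using gg gk by (simp_all add: corner_def mult.assoc) (simp_all add: mult.assoc[symmetric])
    have "x = g * x * k + k * x * g" using xo unfolding odB .
    then have sum: "j (\<phi> (g * x * k)) + j (\<phi> (k * x * g)) = E * j z * F"
      using x by (metis E_def F_def \<phi>_add j_add j_mult)
    \<comment> \<open>On p + q = ezf the commutator with U is multiplication by l - m and gives p -
      q. Applied once more it returns p + q, hence the square of l - m is 1.\<close>
    define p q where "p = j (\<phi> (g * x * k))" and "q = j (\<phi> (k * x * g))"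
    have pq: "p + q = E * j z * F" using sum by (simp add: p_def q_def)
    have 1: "sc (l - m) (E * p * F) - sc (l - m) (F * p * E) = p" unfolding p_def by (rule gkx[OF c(1)])
    have 2: "sc (l - m) (E * q * F) - sc (l - m) (F * q * E) = - q" unfolding q_def by (rule kgx[OF c(2)])
    have "p - q = (sc (l - m) (E * p * F) - sc (l - m) (F * p * E))
       + (sc (l - m) (E * q * F) - sc (l - m) (F * q * E))" unfolding 1 2 by simp
    also have "\<dots> = sc (l - m) (E * (p + q) * F) - sc (l - m) (F * (p + q) * E)"
      by (simp add: scalg)
    also have "\<dots> = sc (l - m) (E * j z * F)" unfolding pq by (simp add: mult.assoc aEF EF)
    finally have diff: "p - q = sc (l - m) (E * j z * F)" .
    have A: "E * (p - q) * F = sc (l - m) (E * j z * F)" "F * (p - q) * E = 0"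
      unfolding diff by (simp_all add: scalg aEF EF)
    have "p + q = sc (l - m) (E * (p - q) * F) - sc (l - m) (F * (p - q) * E)"
    proof -
      have "p + q = (sc (l - m) (E * p * F) - sc (l - m) (F * p * E))
         - (sc (l - m) (E * q * F) - sc (l - m) (F * q * E))" unfolding 1 2 by simp
      also have "\<dots> = sc (l - m) (E * (p - q) * F) - sc (l - m) (F * (p - q) * E)"
        by (simp add: scalg)
      finally show ?thesis .
    qed
    then have "E * j z * F = sc (l - m) (sc (l - m) (E * j z * F)) - sc (l - m) 0"
      unfolding pq A .
    then have "E * j z * F = sc ((l - m) * (l - m)) (E * j z * F)"
      by (simp only: sc_simps(7) sc_triv diff_zero)
    then have "sc ((l - m) * (l - m) - 1) (E * j z * F) = 0"
      by (simp only: sc_simps(5) sc_triv diff_self)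
    moreover have "E * j z * F \<noteq> 0" using z by (simp add: E_def F_def flip: j_mult)
    ultimately have "(l - m) * (l - m) - 1 = 0" using sc_eq_0 by blast
    then show ?thesis by simp
  qed
  then have "(l - m - 1) * (l - m + 1) = 0" by (simp add: algebra_simps)
  then consider "l - m = 1" | "l - m = - 1" using center_domain by (fastforce simp: eq_neg_iff_add_eq_0)
  then have "(\<forall>x. (corner g k x \<longrightarrow> corner e f (\<phi> x)) \<and> (corner k g x \<longrightarrow> corner f e (\<phi> x))) \<or>
    (\<forall>x. (corner g k x \<longrightarrow> corner f e (\<phi> x)) \<and> (corner k g x \<longrightarrow> corner e f (\<phi> x)))"
  proof cases
    case 1
    have "corner e f (\<phi> x)" if "corner g k x" for x
      using oddQ[OF odgk[OF that]] gkx[OF that] unfolding 1 sc_triv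
      by (rule to_ef[OF _ disjI1])
    moreover have "corner f e (\<phi> x)" if "corner k g x" for x
      using oddQ[OF odkg[OF that]] kgx[OF that] unfolding 1 sc_triv
      by (rule to_fe[OF _ disjI1])
    ultimately show ?thesis by blast
  next
    case 2
    have "corner f e (\<phi> x)" if "corner g k x" for x
      using oddQ[OF odgk[OF that]] gkx[OF that] unfolding 2 sc_simps(6) sc_triv
      by (rule to_fe[OF _ disjI2])
    moreover have "corner e f (\<phi> x)" if "corner k g x" for x
      using oddQ[OF odkg[OF that]] kgx[OF that] unfolding 2 sc_simps(6) sc_triv
      by (rule to_ef[OF _ disjI2])
    ultimately show ?thesis by blast
  qed
  then show ?thesis
  proof
    assume *: "\<forall>x. (corner g k x \<longrightarrow> corner e f (\<phi> x)) \<and> (corner k g x \<longrightarrow> corner f e (\<phi> x))"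
    have "peirce_iso j e f g k \<phi>"
      by unfold_locales (use ef gk * diag evgg evkk odgk odkg \<phi>_bracket_even \<phi>_bracket_odd \<phi>_add
        bij_is_surj[OF \<phi>_bij] in blast)+
    then show ?thesis unfolding e_def f_def g_def k_def ..
  next
    assume *: "\<forall>x. (corner g k x \<longrightarrow> corner f e (\<phi> x)) \<and> (corner k g x \<longrightarrow> corner e f (\<phi> x))"
    have fe: "f + e = 1" using ef(1) by (simp add: add.commute)
    have "peirce_iso j f e g k \<phi>"
      by unfold_locales (use fe ef gk * diag evgg evkk odgk odkg \<phi>_bracket_even \<phi>_bracket_odd \<phi>_add
        bij_is_surj[OF \<phi>_bij] in blast)+
    then show ?thesis unfolding e_def f_def g_def k_def ..
  qed
qed

end

theorem theorem3p2:
  fixes \<iota>A :: "'f::field \<Rightarrow> 'a::ring_1" and \<iota>B :: "'f \<Rightarrow> 'b::ring_1"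
    and eA :: 'a and eB :: 'b
    and j :: "'a \<Rightarrow> 'q::ring_1"
    and \<phi> :: "'b \<Rightarrow> 'a"
  assumes char: "(2::'f) \<noteq> 0"
    and algA: "F_alg \<iota>A" and algB: "F_alg \<iota>B"
    and primeA: "prime_ring (UNIV :: 'a set)" and primeB: "prime_ring (UNIV :: 'b set)"
    and idA: "idem eA" and idB: "idem eB"
    and Q: "max_left_quot j"
    and notC: "\<not> (\<exists>h. ring_iso_on (ring_center :: 'q set) (+) (*) (central_closure j) h)"
    and notM2: "\<not> (\<exists>h. ring_iso_on (M2 (ring_center :: 'q set)) M2_add M2_mult (central_closure j) h)"
    and lie: "lie_superiso \<iota>B eB \<iota>A eA \<phi>"
  shows "\<exists>\<theta> \<tau>. (\<forall>x. j (\<phi> x) = \<theta> x + \<tau> x)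
      \<and> (\<forall>x. \<theta> x \<in> central_closure j)
      \<and> (superhom \<iota>B eB (j \<circ> \<iota>A) (j eA) \<theta>
         \<or> superantihom \<iota>B eB (j \<circ> \<iota>A) (j eA) (\<lambda>x. - \<theta> x))
      \<and> (\<forall>x. \<tau> x \<in> (ring_center :: 'q set))
      \<and> F_lin \<iota>B (j \<circ> \<iota>A) \<tau>
      \<and> (\<forall>x\<in>scomm_span \<iota>B eB. \<tau> x = 0)"
proof -
  have two: "(2 :: 'a) \<noteq> 0"
  proof
    assume "(2 :: 'a) = 0"
    have "\<iota>A (2 * inverse 2) = \<iota>A 1" using char by simp
    moreover have "\<iota>A 2 = \<iota>A 1 + \<iota>A 1" using algA unfolding F_alg_def by (metis one_add_one)
    then have "\<iota>A 2 = 0" using algA \<open>(2 :: 'a) = 0\<close> by (simp add: F_alg_def)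
    ultimately show False using algA unfolding F_alg_def by (metis mult_zero_left zero_neq_one)
  qed
  interpret superiso j \<iota>A \<iota>B eA eB \<phi>
    by unfold_locales (use Q primeA two algA algB idA idB lie in blast)+
  show ?thesis
  proof (cases "eA = 0 \<or> eA = 1")
    case True
    obtain \<tau> where \<tau>: "\<And>x y. \<tau> (x + y) = \<tau> x + \<tau> y"
      "\<And>b c x. (\<And>y. j (\<phi> (b * y)) = sc c (j (\<phi> y))) \<Longrightarrow> \<tau> (b * x) = c * \<tau> x"
      "\<And>x. is_odd eB x \<Longrightarrow> \<tau> x = 0" "twisted eB (\<lambda>x. j (\<phi> x) - cst (\<tau> x))"
      by (rule trivial_grading[OF True]) blast
    show ?thesis by (rule assemble) (rule \<tau>; assumption)+
  next
    case False
    \<comment> \<open>Depending on the sign found, e is \<open>eA\<close> or its complement. Only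
      the grading of B enters the form of \<theta>, so both choices serve.\<close>
    then obtain e f where "peirce_iso j e f eB (1 - eB) \<phi>" using nontrivial_grading by blast
    then interpret P: peirce_iso j e f eB "1 - eB" \<phi> .
    obtain \<tau> where \<tau>: "\<And>x y. \<tau> (x + y) = \<tau> x + \<tau> y"
      "\<And>b c x. (\<And>y. P.\<Phi> (b * y) = sc c (P.\<Phi> y)) \<Longrightarrow> (\<And>y. b * y = y * b) \<Longrightarrow> \<tau> (b * x) = c * \<tau> x"
      "\<And>x. is_odd eB x \<Longrightarrow> \<tau> x = 0" "twisted eB (\<lambda>x. P.\<Phi> x - cst (\<tau> x))"
      by (rule P.peirce_standard_form[OF notM2]) blast
    show ?thesis by (rule assemble) (rule \<tau>[unfolded P.\<Phi>_def]; assumption)+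
  qed
qed

end
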